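(* Let $\mathbf{u}^*\in U_{ad}$ be a strict local solution of the continuous optimal control problem $\min\{j(\mathbf{u}):\mathbf{u}\in U_{ad}\}$, and let $\{\mathbf{u}^*_h\}_{h>0}\subset U_{ad}$ be a sequence of local minima of the discrete problems $\min\{j_h(\mathbf{u}_h):\mathbf{u}_h\in U_{ad}\}$ such that $\mathbf{u}^*_h\to\mathbf{u}^*$ in $\mathbb{R}^\ell$ as $h\downarrow0$. Suppose that $\mathbf{u}^*$ satisfies the second-order condition: there exist $\tau,\nu>0$ such that $j''(\mathbf{u}^* )\mathbf{v}^2\ge\nu\|\mathbf{v}\|_{\mathbb{R}^\ell}^2$ for all $\mathbf{v}\in\mathbf{C}^\tau_{\mathbf{u}^*}$. Assume further that $\boldsymbol{f}\in\mathbf{H}(\mathrm{div},\Omega)$, that $\mu,\varepsilon_\sigma\in PW^{1,\infty}(\Omega)$, and that there exists $\mathfrak{s}\in(0,1]$ such that, for arbitrary $\mathbf{u}\in U_{ad}$, $\|\boldsymbol{p}_{\mathbf{u}}-\boldsymbol{p}_{\mathbf{u},h}\|_\Omega\lesssim h^{\mathfrak{s}}$. Then, for $s\in[0,\mathfrak{t})$, there exists $h_\dagger>0$ such that $$\|\mathbf{u}^*-\mathbf{u}^*_h\|_{\mathbb{R}^\ell}\lesssim h^{\min\{s,\mathfrak{s}\}}\qquad\forall\,h<h_\dagger.$$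
   Context: $\Omega\subset\mathbb{R}^3$ is an open, bounded, simply connected polyhedral domain with Lipschitz boundary $\Gamma$ and outward unit normal $\boldsymbol{n}$. $\mathbf{L}^2(\Omega;\mathbb{C})$ is the space of $\mathbb{C}^3$-valued square integrable fields; $(\boldsymbol v,\boldsymbol w)_\Omega=\int_\Omega \boldsymbol v\cdot\overline{\boldsymbol w}$ and $\|\cdot\|_\Omega$ are its inner product and norm ($\boldsymbol v\cdot\boldsymbol w=\sum_i v_iw_i$). $\mathbf{H}(\mathrm{div},\Omega)$ and $\mathbf{H}(\mathbf{curl},\Omega)$ are the spaces of $\boldsymbol{w}\in\mathbf{L}^2(\Omega;\mathbb{C})$ with square integrable divergence, respectively curl, with graph norms; $\mathbf{H}_0(\mathbf{curl},\Omega)=\{\boldsymbol{w}\in\mathbf{H}(\mathbf{curl},\Omega):\boldsymbol{w}\times\boldsymbol{n}=\mathbf{0}\text{ on }\Gamma\}$; $\mathbf{H}^s(\mathbf{curl},\Omega)=\{\boldsymbol{w}\in\mathbf{H}^s(\Omega;\mathbb{C}):\mathbf{curl}\,\boldsymbol{w}\in\mathbf{H}^s(\Omega;\mathbb{C})\}$. Data: $\omega>0$; $\mu\in L^\infty(\Omega)$ real with $\mu\ge\mu_0>0$; $\varepsilon,\sigma\in L^\infty(\Omega)$ real with $0<\varepsilon_+\le\varepsilon\le\varepsilon^+$ and $0<\sigma_+\le\sigma\le\sigma^+$ (constants); $\varepsilon_\sigma:=\varepsilon+i\sigma\omega^{-1}$; $\ell\in\mathbb{N}$; $\mathcal{P}=\{\Omega_k\}_{k=1}^\ell$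 is a partition of $\Omega$ into pairwise disjoint subdomains with $\overline\Omega=\cup_k\overline{\Omega}_k$; $PW^{1,\infty}(\Omega)=\{\zeta\in L^\infty(\Omega;\mathbb{C}):\zeta|_{\Omega_k}\in W^{1,\infty}(\Omega_k;\mathbb{C}),\ 1\le k\le\ell\}$. For $\mathbf{u}\in\mathbb{R}^\ell$, $\varepsilon_\sigma\cdot\mathbf{u}$ denotes the function equal to $\mathbf{u}_k\varepsilon_\sigma$ on $\Omega_k$. $\boldsymbol{f},\boldsymbol{y}_\Omega,\boldsymbol{E}_\Omega\in\mathbf{L}^2(\Omega;\mathbb{C})$, $\alpha>0$. Vector inequalities are componentwise; $\mathbf{a},\mathbf{b}\in\mathbb{R}^\ell$ with $\mathbf{0}<\mathbf{a}<\mathbf{b}$ and $U_{ad}:=\{\mathbf{v}\in\mathbb{R}^\ell:\mathbf{a}\le\mathbf{v}\le\mathbf{b}\}$. Meshes: $\{\mathscr{T}_h\}_{h>0}$ is a collection of conforming, shape regular simplicial meshes of $\overline\Omega$, all refinements of an initial mesh, with $h=\max_{T\in\mathscr{T}_h}\mathrm{diam}(T)$, such that each $T\in\mathscr{T}_h$ is contained in (the closure of) one element of $\mathcal{P}$. $\mathbf{V}(\mathscr{T}_h)=\{\boldsymbol{v}_h\in\mathbf{H}_0(\mathbf{curl},\Omega):\boldsymbol{v}_h|_T\in[\mathbb{P}_0(T)]^3\oplus\boldsymbol{x}\times[\widetilde{\mathbb{P}}_0(T)]^3\ \forall T\in\mathscr{T}_h\}$ is the lowest-order Nédélec space ($\widetilde{\mathbb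 P}_0$: homogeneous polynomials of degree $0$). Write $a_{\mathbf{u}}(\boldsymbol{y},\boldsymbol{w})=(\mu^{-1}\mathbf{curl}\,\boldsymbol{y},\mathbf{curl}\,\boldsymbol{w})_\Omega-\omega^2((\varepsilon_\sigma\cdot\mathbf{u})\boldsymbol{y},\boldsymbol{w})_\Omega$. For $\mathbf{u}>\mathbf{0}$: $\mathcal{S}\mathbf{u}\in\mathbf{H}_0(\mathbf{curl},\Omega)$ is the unique solution of $a_{\mathbf{u}}(\mathcal{S}\mathbf{u},\boldsymbol{w})=(\boldsymbol{f},\boldsymbol{w})_\Omega$ for all $\boldsymbol{w}\in\mathbf{H}_0(\mathbf{curl},\Omega)$, and $\mathcal{S}_h\mathbf{u}\in\mathbf{V}(\mathscr{T}_h)$ is the unique solution of $a_{\mathbf{u}}(\mathcal{S}_h\mathbf{u},\boldsymbol{w}_h)=(\boldsymbol{f},\boldsymbol{w}_h)_\Omega$ for all $\boldsymbol{w}_h\in\mathbf{V}(\mathscr{T}_h)$. With $\mathcal{J}(\boldsymbol{y},\mathbf{u})=\tfrac12\|\boldsymbol{y}-\boldsymbol{y}_\Omega\|_\Omega^2+\tfrac12\|\mathbf{curl}\,\boldsymbol{y}-\boldsymbol{E}_\Omega\|_\Omega^2+\tfrac{\alpha}{2}\|\mathbf{u}\|_{\mathbb{R}^\ell}^2$, set $j(\mathbf{u})=\mathcal{J}(\mathcal{S}\mathbf{u},\mathbf{u})$, $j_h(\mathbf{u})=\mathcal{J}(\mathcal{S}_h\mathbf{u},\mathbf{u})$; $j''(\mathbf{u})\mathbf{v}^2$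 is the second derivative of $j$ applied to $(\mathbf{v},\mathbf{v})$. Adjoint: for $\mathbf{u}\in U_{ad}$ and $\boldsymbol{y}=\mathcal{S}\mathbf{u}$, $\boldsymbol{p}_{\mathbf{u}}\in\mathbf{H}_0(\mathbf{curl},\Omega)$ is the unique solution of $a_{\mathbf{u}}(\boldsymbol{p}_{\mathbf{u}},\boldsymbol{w})=(\overline{\boldsymbol{y}-\boldsymbol{y}_\Omega},\boldsymbol{w})_\Omega+(\overline{\mathbf{curl}\,\boldsymbol{y}-\boldsymbol{E}_\Omega},\mathbf{curl}\,\boldsymbol{w})_\Omega$ for all $\boldsymbol{w}\in\mathbf{H}_0(\mathbf{curl},\Omega)$, and $\boldsymbol{p}_{\mathbf{u},h}\in\mathbf{V}(\mathscr{T}_h)$ is its finite element approximation: the solution of the same equation (same right-hand side, with $\boldsymbol{y}=\mathcal{S}\mathbf{u}$) with test functions in $\mathbf{V}(\mathscr{T}_h)$. Cone: with $\boldsymbol{y}^*=\mathcal{S}\mathbf{u}^*$, $\boldsymbol{p}^*=\boldsymbol{p}_{\mathbf{u}^*}$ and $\bar{\mathfrak{d}}_k=\alpha\mathbf{u}^*_k+\omega^2\mathfrak{Re}\{\int_{\Omega_k}\varepsilon_\sigma\boldsymbol{y}^*\cdot\boldsymbol{p}^*\}$, $\mathbf{C}^\tau_{\mathbf{u}^*}$ is the set of $\mathbf{v}\in\mathbb{R}^\ell$ such that for every $k$: $\mathbf{v}_k\ge0$ if $\mathbf{u}^*_k=\mathbf{a}_k$; $\mathbf{v}_k\le0$ if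 $\mathbf{u}^*_k=\mathbf{b}_k$; and $\mathbf{v}_k=0$ if $|\bar{\mathfrak{d}}_k|>\tau$. Exponent $\mathfrak{t}$: when $\mu,\varepsilon_\sigma\in PW^{1,\infty}(\Omega)$, $\mathfrak{t}\in(0,\tfrac12)$ denotes the (known to exist) regularity exponent such that, for right-hand sides $\boldsymbol{f}\in\mathbf{H}(\mathrm{div},\Omega)$ and $\mathbf{u}\in U_{ad}$, $\mathcal{S}\mathbf{u}\in\mathbf{H}^s(\mathbf{curl},\Omega)$ and $\|\mathcal{S}\mathbf{u}-\mathcal{S}_h\mathbf{u}\|_{\mathbf{H}(\mathbf{curl},\Omega)}\lesssim h^s\|\boldsymbol{f}\|_{\mathbf{H}(\mathrm{div},\Omega)}$ for all $s\in[0,\mathfrak{t})$. $A\lesssim B$ means $A\le CB$ with $C>0$ independent of $A$, $B$ and of discretization parameters (in particular, in the assumption on $\boldsymbol p_{\mathbf u}$, independent of $\mathbf u$ and $h$). *)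

theory Defs
  imports "HOL-Analysis.Analysis"
begin

text \<open>Elements of Lebesgue and Sobolev spaces are represented by functions on the whole space of
  which only the values almost everywhere in the domain matter.  Norms, integrals and weak
  derivatives below are invariant under changes on null sets.\<close>

definition cdot :: "complex^3 \<Rightarrow> complex^3 \<Rightarrow> complex" where
  "cdot v w = (\<Sum>i\<in>UNIV. v $ i * w $ i)"

definition vcnj :: "complex^3 \<Rightarrow> complex^3" where
  "vcnj v = (\<chi> i. cnj (v $ i))"

definition ccross :: "complex^3 \<Rightarrow> complex^3 \<Rightarrow> complex^3" where
  "ccross v w = vector [v $ 2 * w $ 3 - v $ 3 * w $ 2,
                        v $ 3 * w $ 1 - v $ 1 * w $ 3,
                        v $ 1 * w $ 2 - v $ 2 * w $ 1]"

definition cvec :: "real^3 \<Rightarrow> complex^3" where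
  "cvec x = (\<chi> i. complex_of_real (x $ i))"

definition pd :: "3 \<Rightarrow> (real^3 \<Rightarrow> 'b::real_normed_vector) \<Rightarrow> real^3 \<Rightarrow> 'b" where
  "pd i \<phi> x = frechet_derivative \<phi> (at x) (axis i 1)"

primrec Ck :: "nat \<Rightarrow> (real^3 \<Rightarrow> 'b::real_normed_vector) \<Rightarrow> bool" where
  "Ck 0 \<phi> \<longleftrightarrow> continuous_on UNIV \<phi>"
| "Ck (Suc k) \<phi> \<longleftrightarrow> \<phi> differentiable_on UNIV \<and> (\<forall>i. Ck k (pd i \<phi>))"

definition smooth :: "(real^3 \<Rightarrow> 'b::real_normed_vector) \<Rightarrow> bool" where
  "smooth \<phi> \<longleftrightarrow> (\<forall>k. Ck k \<phi>)"

definition test_function :: "(real^3) set \<Rightarrow> (real^3 \<Rightarrow> 'b::real_normed_vector) \<Rightarrow> bool" where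
  "test_function \<Omega> \<phi> \<longleftrightarrow>
     smooth \<phi> \<and> compact (closure {x. \<phi> x \<noteq> 0}) \<and> closure {x. \<phi> x \<noteq> 0} \<subseteq> \<Omega>"

definition classical_curl :: "(real^3 \<Rightarrow> complex^3) \<Rightarrow> real^3 \<Rightarrow> complex^3" where
  "classical_curl \<phi> x = vector [pd 2 \<phi> x $ 3 - pd 3 \<phi> x $ 2,
                                pd 3 \<phi> x $ 1 - pd 1 \<phi> x $ 3,
                                pd 1 \<phi> x $ 2 - pd 2 \<phi> x $ 1]"

definition classical_grad :: "(real^3 \<Rightarrow> complex) \<Rightarrow> real^3 \<Rightarrow> complex^3" where
  "classical_grad \<phi> x = (\<chi> i. pd i \<phi> x)"

definition L2 :: "(real^3) set \<Rightarrow> (real^3 \<Rightarrow> 'b::euclidean_space) set" where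
  "L2 \<Omega> = {v. v \<in> borel_measurable (lebesgue_on \<Omega>) \<and>
               integrable (lebesgue_on \<Omega>) (\<lambda>x. (norm (v x))\<^sup>2)}"

definition Linf :: "(real^3) set \<Rightarrow> (real^3 \<Rightarrow> 'b::euclidean_space) set" where
  "Linf \<Omega> = {v. v \<in> borel_measurable (lebesgue_on \<Omega>) \<and>
                 (\<exists>C. AE x in lebesgue_on \<Omega>. norm (v x) \<le> C)}"

definition ip :: "(real^3) set \<Rightarrow> (real^3 \<Rightarrow> complex^3) \<Rightarrow> (real^3 \<Rightarrow> complex^3) \<Rightarrow> complex" where
  "ip \<Omega> v w = (LINT x|lebesgue_on \<Omega>. cdot (v x) (vcnj (w x)))"

definition norm_L2 :: "(real^3) set \<Rightarrow> (real^3 \<Rightarrow> 'b::euclidean_space) \<Rightarrow> real" where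
  "norm_L2 \<Omega> v = sqrt (LINT x|lebesgue_on \<Omega>. (norm (v x))\<^sup>2)"

definition is_weak_curl ::
  "(real^3) set \<Rightarrow> (real^3 \<Rightarrow> complex^3) \<Rightarrow> (real^3 \<Rightarrow> complex^3) \<Rightarrow> bool" where
  "is_weak_curl \<Omega> w c \<longleftrightarrow> (\<forall>\<phi>. test_function \<Omega> \<phi> \<longrightarrow>
     (LINT x|lebesgue_on \<Omega>. cdot (c x) (\<phi> x)) =
     (LINT x|lebesgue_on \<Omega>. cdot (w x) (classical_curl \<phi> x)))"

definition is_weak_div ::
  "(real^3) set \<Rightarrow> (real^3 \<Rightarrow> complex^3) \<Rightarrow> (real^3 \<Rightarrow> complex) \<Rightarrow> bool" where
  "is_weak_div \<Omega> w d \<longleftrightarrow> (\<forall>\<phi>. test_function \<Omega> \<phi> \<longrightarrow>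
     (LINT x|lebesgue_on \<Omega>. d x * \<phi> x) =
     - (LINT x|lebesgue_on \<Omega>. cdot (w x) (classical_grad \<phi> x)))"

definition is_weak_pd ::
  "(real^3) set \<Rightarrow> 3 \<Rightarrow> (real^3 \<Rightarrow> complex) \<Rightarrow> (real^3 \<Rightarrow> complex) \<Rightarrow> bool" where
  "is_weak_pd \<Omega> i \<zeta> g \<longleftrightarrow> (\<forall>\<phi>. test_function \<Omega> \<phi> \<longrightarrow>
     (LINT x|lebesgue_on \<Omega>. g x * \<phi> x) = - (LINT x|lebesgue_on \<Omega>. \<zeta> x * pd i \<phi> x))"

definition Curl :: "(real^3) set \<Rightarrow> (real^3 \<Rightarrow> complex^3) \<Rightarrow> real^3 \<Rightarrow> complex^3" where
  "Curl \<Omega> w = (SOME c. c \<in> L2 \<Omega> \<and> is_weak_curl \<Omega> w c)"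

definition Div :: "(real^3) set \<Rightarrow> (real^3 \<Rightarrow> complex^3) \<Rightarrow> real^3 \<Rightarrow> complex" where
  "Div \<Omega> w = (SOME d. d \<in> L2 \<Omega> \<and> is_weak_div \<Omega> w d)"

definition Hcurl :: "(real^3) set \<Rightarrow> (real^3 \<Rightarrow> complex^3) set" where
  "Hcurl \<Omega> = {w \<in> L2 \<Omega>. \<exists>c \<in> L2 \<Omega>. is_weak_curl \<Omega> w c}"

definition Hdiv :: "(real^3) set \<Rightarrow> (real^3 \<Rightarrow> complex^3) set" where
  "Hdiv \<Omega> = {w \<in> L2 \<Omega>. \<exists>d \<in> L2 \<Omega>. is_weak_div \<Omega> w d}"

definition norm_Hcurl :: "(real^3) set \<Rightarrow> (real^3 \<Rightarrow> complex^3) \<Rightarrow> real" where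
  "norm_Hcurl \<Omega> w = sqrt ((norm_L2 \<Omega> w)\<^sup>2 + (norm_L2 \<Omega> (Curl \<Omega> w))\<^sup>2)"

definition norm_Hdiv :: "(real^3) set \<Rightarrow> (real^3 \<Rightarrow> complex^3) \<Rightarrow> real" where
  "norm_Hdiv \<Omega> w = sqrt ((norm_L2 \<Omega> w)\<^sup>2 + (norm_L2 \<Omega> (Div \<Omega> w))\<^sup>2)"

text \<open>The trace \<open>w \<times> n\<close> of a field in \<open>H(curl)\<close> on the boundary of a bounded Lipschitz domain is
  the functional given by Green's formula: if \<open>w\<close> is smooth up to the boundary,
  \<open>tangential_trace \<Omega> w \<phi>\<close> is the surface integral of \<open>(w \<times> n) \<cdot> \<phi>\<close>.\<close>

definition tangential_trace ::
  "(real^3) set \<Rightarrow> (real^3 \<Rightarrow> complex^3) \<Rightarrow> (real^3 \<Rightarrow> complex^3) \<Rightarrow> complex" where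
  "tangential_trace \<Omega> w \<phi> =
     (LINT x|lebesgue_on \<Omega>. cdot (w x) (classical_curl \<phi> x)) -
     (LINT x|lebesgue_on \<Omega>. cdot (Curl \<Omega> w x) (\<phi> x))"

definition H0curl :: "(real^3) set \<Rightarrow> (real^3 \<Rightarrow> complex^3) set" where
  "H0curl \<Omega> = {w \<in> Hcurl \<Omega>. \<forall>\<phi>. smooth \<phi> \<longrightarrow> tangential_trace \<Omega> w \<phi> = 0}"

text \<open>Sobolev--Slobodeckij space of order \<open>s\<close>; meaningful for \<open>0 \<le> s < 1\<close> only, which is the
  range in which it is used.\<close>

definition Hs :: "real \<Rightarrow> (real^3) set \<Rightarrow> (real^3 \<Rightarrow> complex^3) set" where
  "Hs s \<Omega> = {w \<in> L2 \<Omega>. s = 0 \<or>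
     (\<integral>\<^sup>+x. (\<integral>\<^sup>+y. ennreal ((norm (w x - w y))\<^sup>2 / (norm (x - y)) powr (3 + 2 * s))
        \<partial>lebesgue_on \<Omega>) \<partial>lebesgue_on \<Omega>) < \<infinity>}"

definition Hs_curl :: "real \<Rightarrow> (real^3) set \<Rightarrow> (real^3 \<Rightarrow> complex^3) set" where
  "Hs_curl s \<Omega> = {w \<in> Hcurl \<Omega>. w \<in> Hs s \<Omega> \<and> Curl \<Omega> w \<in> Hs s \<Omega>}"

definition W1inf :: "(real^3) set \<Rightarrow> (real^3 \<Rightarrow> complex) set" where
  "W1inf \<Omega> = {\<zeta> \<in> Linf \<Omega>. \<forall>i. \<exists>g \<in> Linf \<Omega>. is_weak_pd \<Omega> i \<zeta> g}"

definition PW1inf :: "(real^3) set \<Rightarrow> ('l \<Rightarrow> (real^3) set) \<Rightarrow> (real^3 \<Rightarrow> complex) set" where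
  "PW1inf \<Omega> \<Omega>s = {\<zeta> \<in> Linf \<Omega>. \<forall>k. \<zeta> \<in> W1inf (\<Omega>s k)}"

definition lipschitz_boundary :: "(real^3) set \<Rightarrow> bool" where
  "lipschitz_boundary \<Omega> \<longleftrightarrow>
     (\<forall>x\<in>frontier \<Omega>. \<exists>(R::real^3 \<Rightarrow> real^3) (g::real^2 \<Rightarrow> real) L r.
        orthogonal_transformation R \<and> L-lipschitz_on UNIV g \<and> r > 0 \<and>
        (\<forall>y\<in>ball x r. y \<in> \<Omega> \<longleftrightarrow> R y $ 3 < g (vector [R y $ 1, R y $ 2])))"

definition polyhedral :: "(real^3) set \<Rightarrow> bool" where
  "polyhedral \<Omega> \<longleftrightarrow> (\<exists>F. finite F \<and> (\<forall>P\<in>F. polytope P) \<and> closure \<Omega> = \<Union>F)"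

text \<open>The last clause says that the pieces cover \<open>\<Omega>\<close> up to a null set, so that a function
  prescribed on each piece is determined as an element of \<open>L\<^sup>\<infinity>(\<Omega>)\<close>; the equality of closures
  does not imply it for arbitrary open sets.\<close>

definition domain_partition :: "(real^3) set \<Rightarrow> ('l::finite \<Rightarrow> (real^3) set) \<Rightarrow> bool" where
  "domain_partition \<Omega> \<Omega>s \<longleftrightarrow>
     (\<forall>k. open (\<Omega>s k) \<and> connected (\<Omega>s k) \<and> \<Omega>s k \<noteq> {} \<and> \<Omega>s k \<subseteq> \<Omega>) \<and>
     (\<forall>k l. k \<noteq> l \<longrightarrow> \<Omega>s k \<inter> \<Omega>s l = {}) \<and>
     closure \<Omega> = (\<Union>k. closure (\<Omega>s k)) \<and>
     negligible (\<Omega> - (\<Union>k. \<Omega>s k))"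

record 'l maxwell =
  dom :: "(real^3) set"
  part :: "'l \<Rightarrow> (real^3) set"
  mu :: "real^3 \<Rightarrow> real"
  eps :: "real^3 \<Rightarrow> real"
  sig :: "real^3 \<Rightarrow> real"
  freq :: real

definition eps_sigma :: "'l maxwell \<Rightarrow> real^3 \<Rightarrow> complex" where
  "eps_sigma M x = complex_of_real (eps M x) + \<i> * complex_of_real (sig M x / freq M)"

definition maxwell_data :: "'l::finite maxwell \<Rightarrow> bool" where
  "maxwell_data M \<longleftrightarrow>
     open (dom M) \<and> bounded (dom M) \<and> dom M \<noteq> {} \<and> simply_connected (dom M) \<and>
     polyhedral (dom M) \<and> lipschitz_boundary (dom M) \<and>
     domain_partition (dom M) (part M) \<and>
     freq M > 0 \<and>
     mu M \<in> Linf (dom M) \<and> eps M \<in> Linf (dom M) \<and> sig M \<in> Linf (dom M) \<and>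
     (\<exists>\<mu>0 > 0. AE x in lebesgue_on (dom M). \<mu>0 \<le> mu M x) \<and>
     (\<exists>e > 0. \<exists>E. AE x in lebesgue_on (dom M). e \<le> eps M x \<and> eps M x \<le> E) \<and>
     (\<exists>s > 0. \<exists>S. AE x in lebesgue_on (dom M). s \<le> sig M x \<and> sig M x \<le> S)"

definition simplicial_mesh :: "(real^3) set \<Rightarrow> (real^3) set set \<Rightarrow> bool" where
  "simplicial_mesh \<Omega> \<T> \<longleftrightarrow>
     triangulation \<T> \<and> (\<forall>T\<in>\<T>. 3 simplex T) \<and> \<Union>\<T> = closure \<Omega>"

definition inradius :: "(real^3) set \<Rightarrow> real" where
  "inradius T = Sup {r. \<exists>x. cball x r \<subseteq> T}"

text \<open>The family is indexed by the set \<open>H\<close> of the occurring mesh sizes, which accumulates at zero: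
  refinements of one initial mesh cannot have arbitrarily large mesh size.\<close>

definition mesh_family ::
  "'l::finite maxwell \<Rightarrow> real set \<Rightarrow> (real \<Rightarrow> (real^3) set set) \<Rightarrow> bool" where
  "mesh_family M H \<T> \<longleftrightarrow>
     H \<subseteq> {0<..} \<and> 0 islimpt H \<and>
     (\<forall>h\<in>H. simplicial_mesh (dom M) (\<T> h) \<and> h = Max (diameter ` \<T> h) \<and>
            (\<forall>T\<in>\<T> h. \<exists>k. T \<subseteq> closure (part M k))) \<and>
     (\<exists>\<T>0. simplicial_mesh (dom M) \<T>0 \<and> (\<forall>h\<in>H. \<forall>T\<in>\<T> h. \<exists>T0\<in>\<T>0. T \<subseteq> T0)) \<and>
     (\<exists>\<kappa>>0. \<forall>h\<in>H. \<forall>T\<in>\<T> h. diameter T \<le> \<kappa> * inradius T)"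

text \<open>The local representation is required almost everywhere in each element: a pointwise
  requirement on the closed elements would force the values on common faces to agree.\<close>

definition nedelec :: "(real^3) set \<Rightarrow> (real^3) set set \<Rightarrow> (real^3 \<Rightarrow> complex^3) set" where
  "nedelec \<Omega> \<T> = {v \<in> H0curl \<Omega>.
     \<forall>T\<in>\<T>. \<exists>c d. AE x in lebesgue_on T. v x = c + ccross (cvec x) d}"

definition coef :: "'l::finite maxwell \<Rightarrow> real^'l \<Rightarrow> real^3 \<Rightarrow> complex" where
  "coef M u x = (\<Sum>k\<in>UNIV. if x \<in> part M k then complex_of_real (u $ k) * eps_sigma M x else 0)"

definition aform ::
  "'l::finite maxwell \<Rightarrow> real^'l \<Rightarrow> (real^3 \<Rightarrow> complex^3) \<Rightarrow> (real^3 \<Rightarrow> complex^3) \<Rightarrow> complex" where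
  "aform M u y w =
     ip (dom M) (\<lambda>x. complex_of_real (inverse (mu M x)) *s Curl (dom M) y x) (Curl (dom M) w) -
     complex_of_real ((freq M)\<^sup>2) * ip (dom M) (\<lambda>x. coef M u x *s y x) w"

text \<open>A representative of the solution, which for the problems below is unique up to equality
  almost everywhere in the domain.\<close>

definition variational_solution ::
  "'l::finite maxwell \<Rightarrow> real^'l \<Rightarrow> (real^3 \<Rightarrow> complex^3) set \<Rightarrow>
   ((real^3 \<Rightarrow> complex^3) \<Rightarrow> complex) \<Rightarrow> real^3 \<Rightarrow> complex^3" where
  "variational_solution M u V F = (SOME y. y \<in> V \<and> (\<forall>w\<in>V. aform M u y w = F w))"

definition state :: "'l::finite maxwell \<Rightarrow> (real^3 \<Rightarrow> complex^3) \<Rightarrow> real^'l \<Rightarrow> real^3 \<Rightarrow> complex^3" where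
  "state M f u = variational_solution M u (H0curl (dom M)) (ip (dom M) f)"

definition discrete_state ::
  "'l::finite maxwell \<Rightarrow> (real^3) set set \<Rightarrow> (real^3 \<Rightarrow> complex^3) \<Rightarrow> real^'l \<Rightarrow> real^3 \<Rightarrow> complex^3" where
  "discrete_state M \<T> f u = variational_solution M u (nedelec (dom M) \<T>) (ip (dom M) f)"

definition adjoint_rhs ::
  "(real^3) set \<Rightarrow> (real^3 \<Rightarrow> complex^3) \<Rightarrow> (real^3 \<Rightarrow> complex^3) \<Rightarrow> (real^3 \<Rightarrow> complex^3) \<Rightarrow>
   (real^3 \<Rightarrow> complex^3) \<Rightarrow> complex" where
  "adjoint_rhs \<Omega> y\<Omega> E\<Omega> y w =
     ip \<Omega> (\<lambda>x. vcnj (y x - y\<Omega> x)) w + ip \<Omega> (\<lambda>x. vcnj (Curl \<Omega> y x - E\<Omega> x)) (Curl \<Omega> w)"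

definition adjoint_state ::
  "'l::finite maxwell \<Rightarrow> (real^3 \<Rightarrow> complex^3) \<Rightarrow> (real^3 \<Rightarrow> complex^3) \<Rightarrow> (real^3 \<Rightarrow> complex^3) \<Rightarrow>
   real^'l \<Rightarrow> real^3 \<Rightarrow> complex^3" where
  "adjoint_state M f y\<Omega> E\<Omega> u =
     variational_solution M u (H0curl (dom M)) (adjoint_rhs (dom M) y\<Omega> E\<Omega> (state M f u))"

text \<open>The right-hand side involves the continuous state.\<close>

definition discrete_adjoint_state ::
  "'l::finite maxwell \<Rightarrow> (real^3) set set \<Rightarrow> (real^3 \<Rightarrow> complex^3) \<Rightarrow> (real^3 \<Rightarrow> complex^3) \<Rightarrow>
   (real^3 \<Rightarrow> complex^3) \<Rightarrow> real^'l \<Rightarrow> real^3 \<Rightarrow> complex^3" where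
  "discrete_adjoint_state M \<T> f y\<Omega> E\<Omega> u =
     variational_solution M u (nedelec (dom M) \<T>) (adjoint_rhs (dom M) y\<Omega> E\<Omega> (state M f u))"

text \<open>The order on vectors is componentwise.\<close>

definition Uad :: "real^'l \<Rightarrow> real^'l \<Rightarrow> (real^'l::finite) set" where
  "Uad a b = {v. a \<le> v \<and> v \<le> b}"

definition cost ::
  "(real^3) set \<Rightarrow> (real^3 \<Rightarrow> complex^3) \<Rightarrow> (real^3 \<Rightarrow> complex^3) \<Rightarrow> real \<Rightarrow>
   (real^3 \<Rightarrow> complex^3) \<Rightarrow> real^'l::finite \<Rightarrow> real" where
  "cost \<Omega> y\<Omega> E\<Omega> \<alpha> y u =
     1 / 2 * (norm_L2 \<Omega> (\<lambda>x. y x - y\<Omega> x))\<^sup>2 +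
     1 / 2 * (norm_L2 \<Omega> (\<lambda>x. Curl \<Omega> y x - E\<Omega> x))\<^sup>2 + \<alpha> / 2 * (norm u)\<^sup>2"

definition jred ::
  "'l::finite maxwell \<Rightarrow> (real^3 \<Rightarrow> complex^3) \<Rightarrow> (real^3 \<Rightarrow> complex^3) \<Rightarrow> (real^3 \<Rightarrow> complex^3) \<Rightarrow>
   real \<Rightarrow> real^'l \<Rightarrow> real" where
  "jred M f y\<Omega> E\<Omega> \<alpha> u = cost (dom M) y\<Omega> E\<Omega> \<alpha> (state M f u) u"

definition discrete_jred ::
  "'l::finite maxwell \<Rightarrow> (real^3) set set \<Rightarrow> (real^3 \<Rightarrow> complex^3) \<Rightarrow> (real^3 \<Rightarrow> complex^3) \<Rightarrow>
   (real^3 \<Rightarrow> complex^3) \<Rightarrow> real \<Rightarrow> real^'l \<Rightarrow> real" where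
  "discrete_jred M \<T> f y\<Omega> E\<Omega> \<alpha> u = cost (dom M) y\<Omega> E\<Omega> \<alpha> (discrete_state M \<T> f u) u"

definition local_solution :: "('a::metric_space \<Rightarrow> real) \<Rightarrow> 'a set \<Rightarrow> 'a \<Rightarrow> bool" where
  "local_solution J U u \<longleftrightarrow>
     u \<in> U \<and> (\<exists>\<delta>>0. \<forall>v\<in>U. dist v u < \<delta> \<longrightarrow> J u \<le> J v)"

definition strict_local_solution :: "('a::metric_space \<Rightarrow> real) \<Rightarrow> 'a set \<Rightarrow> 'a \<Rightarrow> bool" where
  "strict_local_solution J U u \<longleftrightarrow>
     u \<in> U \<and> (\<exists>\<delta>>0. \<forall>v\<in>U. v \<noteq> u \<and> dist v u < \<delta> \<longrightarrow> J u < J v)"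

definition second_derivative :: "('a::real_normed_vector \<Rightarrow> real) \<Rightarrow> 'a \<Rightarrow> 'a \<Rightarrow> 'a \<Rightarrow> real" where
  "second_derivative J u v w =
     frechet_derivative (\<lambda>x. frechet_derivative J (at x) v) (at u) w"

definition reduced_gradient ::
  "'l::finite maxwell \<Rightarrow> (real^3 \<Rightarrow> complex^3) \<Rightarrow> (real^3 \<Rightarrow> complex^3) \<Rightarrow> (real^3 \<Rightarrow> complex^3) \<Rightarrow>
   real \<Rightarrow> real^'l \<Rightarrow> 'l \<Rightarrow> real" where
  "reduced_gradient M f y\<Omega> E\<Omega> \<alpha> u k =
     \<alpha> * u $ k + (freq M)\<^sup>2 * Re (LINT x|lebesgue_on (part M k).
       eps_sigma M x * cdot (state M f u x) (adjoint_state M f y\<Omega> E\<Omega> u x))"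

definition critical_cone ::
  "'l::finite maxwell \<Rightarrow> (real^3 \<Rightarrow> complex^3) \<Rightarrow> (real^3 \<Rightarrow> complex^3) \<Rightarrow> (real^3 \<Rightarrow> complex^3) \<Rightarrow>
   real \<Rightarrow> real^'l \<Rightarrow> real^'l \<Rightarrow> real \<Rightarrow> real^'l \<Rightarrow> (real^'l) set" where
  "critical_cone M f y\<Omega> E\<Omega> \<alpha> a b \<tau> u = {v. \<forall>k.
     (u $ k = a $ k \<longrightarrow> v $ k \<ge> 0) \<and>
     (u $ k = b $ k \<longrightarrow> v $ k \<le> 0) \<and>
     (\<bar>reduced_gradient M f y\<Omega> E\<Omega> \<alpha> u k\<bar> > \<tau> \<longrightarrow> v $ k = 0)}"

text \<open>The constant may depend on \<open>s\<close>, but not on \<open>g\<close>, \<open>u\<close> or \<open>h\<close>.\<close>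

definition regularity_exponent ::
  "'l::finite maxwell \<Rightarrow> real set \<Rightarrow> (real \<Rightarrow> (real^3) set set) \<Rightarrow> real^'l \<Rightarrow> real^'l \<Rightarrow> real \<Rightarrow> bool" where
  "regularity_exponent M H \<T> a b t \<longleftrightarrow> 0 < t \<and> t < 1 / 2 \<and>
     (\<forall>s. 0 \<le> s \<and> s < t \<longrightarrow>
        (\<forall>g\<in>Hdiv (dom M). \<forall>u\<in>Uad a b. state M g u \<in> Hs_curl s (dom M)) \<and>
        (\<exists>C>0. \<forall>g\<in>Hdiv (dom M). \<forall>u\<in>Uad a b. \<forall>h\<in>H.
           norm_Hcurl (dom M) (\<lambda>x. state M g u x - discrete_state M (\<T> h) g u x)
             \<le> C * h powr s * norm_Hdiv (dom M) g))"

end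

theory Submission
  imports Defs "HOL-Computational_Algebra.Polynomial"
begin

text \<open>Pairing a field with its curl embeds \<open>H\<^sub>0(curl)\<close> and the edge element spaces as closed
  subspaces of the real Hilbert space \<open>L\<^sup>2 \<times> L\<^sup>2\<close>.  There the Maxwell form becomes a family of
  symmetric bilinear forms, affine in the control; because of the absorption \<open>\<sigma> > 0\<close> it is coercive
  when tested with \<open>(1 - \<i>K)\<close> times a field, conjugated, with \<open>K\<close> large.  By Lax--Milgram the solution
  operators exist, are uniformly bounded, depend differentiably on the control, and the adjoint state
  gives the gradients \<open>j'\<close> and \<open>j\<^sub>h'\<close>.  Their difference is bounded by the errors of state and adjoint
  state.  For small \<open>h\<close> the direction \<open>v = u\<^sub>h\<^sup>* - u\<^sup>*\<close> lies in the critical cone, since the signs of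
  the large gradient components agree, so the second-order condition and the two variational inequalities give
  \<open>\<nu>/2 \<parallel>v\<parallel>\<^sup>2 \<le> (j'(u\<^sub>h\<^sup>*) - j'(u\<^sup>*)) v \<le> (j'(u\<^sub>h\<^sup>*) - j\<^sub>h'(u\<^sub>h\<^sup>*)) v\<close>.\<close>

section \<open>Variational problems in Hilbert spaces\<close>

text \<open>The Maxwell form has a complex coefficient and an indefinite mass term, so it is neither
  Hermitian nor positive. Real parts restore symmetry: the real part of \<open>m * cdot v w\<close>
  is symmetric in \<open>v\<close> and \<open>w\<close> for every complex \<open>m\<close>. Hence
  one operator governs state and adjoint state, and the conjugated residual in the adjoint equation
  becomes a plain residual. Positivity comes from the test map alone. It maps every edge element
  space onto itself, so coercivity on the large space passes to all discrete spaces with the same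
  constants and takes the place of a discrete inf-sup condition. The adjoint error is given only in
  L^2. This suffices because the control enters only the mass term, whose derivative does not see
  curls; the size function \<open>q\<close> records this. Moreover the discrete gradient contains
  the adjoint built from the discrete state, whereas the given rate concerns the one built from the
  continuous state; stability turns their difference into a state error.\<close>

lemma projection_on_closed_subspace:
  fixes S :: "'a::{real_inner,complete_space} set"
  assumes S: "subspace S" "closed S"
  shows "\<exists>p\<in>S. \<forall>w\<in>S. (x - p) \<bullet> w = 0"
proof -
  define d where "d = infdist x S"
  have ne: "S \<noteq> {}" using S(1) subspace_0 by auto
  have dle: "d \<le> norm (x - w)" if "w \<in> S" for w
    using infdist_le[OF that, of x] by (simp add: d_def dist_norm)
  have d0: "d \<ge> 0" by (simp add: d_def infdist_nonneg)
  have "\<exists>p\<in>S. norm (x - p) < d + 1 / real (Suc n)" for n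
  proof -
    have "infdist x S < d + 1 / real (Suc n)" by (simp add: d_def)
    then show ?thesis
      using cInf_lessD[of "(\<lambda>w. norm (x - w)) ` S"] ne by (auto simp: infdist_def dist_norm)
  qed
  then obtain p where p: "\<And>n. p n \<in> S" "\<And>n. norm (x - p n) < d + 1 / real (Suc n)"
    by metis
  have lim_norm: "(\<lambda>n. norm (x - p n)) \<longlonglongrightarrow> d"
  proof (rule tendsto_sandwich[OF always_eventually always_eventually])
    show "\<forall>n. d \<le> norm (x - p n)" using dle p by auto
    show "\<forall>n. norm (x - p n) \<le> d + 1 / real (Suc n)" using p(2) less_imp_le by blast
    show "(\<lambda>n. d + 1 / real (Suc n)) \<longlonglongrightarrow> d"
      using tendsto_add[OF tendsto_const LIMSEQ_inverse_real_of_nat, of d] by (simp add: inverse_eq_divide)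
  qed simp
  \<comment> \<open>Parallelogram identity for \<open>x - p m\<close> and \<open>x - p n\<close>:
    the midpoint is \<open>x - ?q\<close> with \<open>?q\<close> in \<open>S\<close>, so its norm is
    at least \<open>d\<close>. A minimising sequence is therefore Cauchy.\<close>
  have par: "(norm (p m - p n))\<^sup>2 \<le> 2 * ((norm (x - p m))\<^sup>2 - d\<^sup>2) + 2 * ((norm (x - p n))\<^sup>2 - d\<^sup>2)" for m n
  proof -
    let ?q = "(1/2) *\<^sub>R (p m + p n)"
    have "?q \<in> S" by (intro subspace_scale[OF S(1)] subspace_add[OF S(1)] p)
    then have "d\<^sup>2 \<le> (norm (x - ?q))\<^sup>2" using dle d0 by (simp add: power_mono)
    moreover have "(norm (p m - p n))\<^sup>2 = 2 * (norm (x - p m))\<^sup>2 + 2 * (norm (x - p n))\<^sup>2 - 4 * (norm (x - ?q))\<^sup>2"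
      unfolding power2_norm_eq_inner
      by (simp add: inner_add_left inner_add_right inner_diff_left inner_diff_right algebra_simps inner_commute)
    ultimately show ?thesis by simp
  qed
  have "Cauchy p"
  proof (rule CauchyI)
    fix e :: real assume e: "e > 0"
    have "(\<lambda>n. (norm (x - p n))\<^sup>2 - d\<^sup>2) \<longlonglongrightarrow> d\<^sup>2 - d\<^sup>2"
      by (intro tendsto_intros lim_norm)
    then have "\<forall>\<^sub>F n in sequentially. (norm (x - p n))\<^sup>2 - d\<^sup>2 < e\<^sup>2 / 4"
      using e by (intro order_tendstoD(2)) auto
    then obtain N where N: "\<And>n. n \<ge> N \<Longrightarrow> (norm (x - p n))\<^sup>2 - d\<^sup>2 < e\<^sup>2 / 4"
      by (auto simp: eventually_sequentially)
    have "norm (p m - p n) < e" if "m \<ge> N" "n \<ge> N" for m n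
    proof -
      have "(norm (p m - p n))\<^sup>2 < e\<^sup>2" using par[of m n] N[OF that(1)] N[OF that(2)] by simp
      then show ?thesis using e by (simp add: power2_less_imp_less)
    qed
    then show "\<exists>M. \<forall>m\<ge>M. \<forall>n\<ge>M. norm (p m - p n) < e" by blast
  qed
  then obtain q where q: "p \<longlonglongrightarrow> q" using Cauchy_convergent_iff convergent_def by blast
  have qS: "q \<in> S" using closed_sequentially[OF S(2)] p(1) q by blast
  have nq: "norm (x - q) = d"
    using LIMSEQ_unique[OF tendsto_norm[OF tendsto_diff[OF tendsto_const q]] lim_norm] .
  have "(x - q) \<bullet> w = 0" if w: "w \<in> S" for w
  proof (cases "w = 0")
    case False
    \<comment> \<open>Moves from \<open>q\<close> to the point nearest to \<open>x\<close> on the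
      line in direction \<open>w\<close>. As \<open>q\<close> is already nearest within
      \<open>S\<close>, nothing is gained and \<open>t\<close> must vanish.\<close>
    define t where "t = ((x - q) \<bullet> w) / (w \<bullet> w)"
    have "q + t *\<^sub>R w \<in> S" by (intro subspace_scale[OF S(1)] subspace_add[OF S(1)] qS w)
    then have "(norm (x - q))\<^sup>2 \<le> (norm (x - (q + t *\<^sub>R w)))\<^sup>2"
      using dle nq d0 by (simp add: power_mono)
    also have "\<dots> = (norm (x - q))\<^sup>2 - 2 * t * ((x - q) \<bullet> w) + t\<^sup>2 * (w \<bullet> w)"
      unfolding power2_norm_eq_inner
      by (simp add: inner_add_left inner_add_right inner_diff_left inner_diff_right algebra_simps inner_commute power2_eq_square)
    finally have "2 * t * ((x - q) \<bullet> w) \<le> t\<^sup>2 * (w \<bullet> w)" by simp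
    moreover have "t * (w \<bullet> w) = (x - q) \<bullet> w" using False by (simp add: t_def)
    ultimately have "2 * t\<^sup>2 * (w \<bullet> w) \<le> t\<^sup>2 * (w \<bullet> w)"
      by (metis mult.assoc mult.commute power2_eq_square)
    then have "t\<^sup>2 * (w \<bullet> w) \<le> 0" by (simp add: mult.commute)
    then have "t = 0" using False
      by (metis inner_gt_zero_iff mult_pos_pos not_less zero_less_power2)
    then show ?thesis using False by (simp add: t_def)
  qed simp
  then show ?thesis using qS by blast
qed

text \<open>If \<open>l\<close> is not zero on \<open>S\<close>, its kernel in \<open>S\<close> has
  codimension one: the component \<open>v\<close> of \<open>u\<close> orthogonal to the kernel spans
  the rest, because \<open>w - (l w / l v) *\<^sub>R v\<close> lies in the kernel. The
  representative is a multiple of \<open>v\<close>.\<close>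

lemma riesz_closed_subspace:
  fixes S :: "'a::{real_inner,complete_space} set"
  assumes S: "subspace S" "closed S" and l: "bounded_linear l"
  shows "\<exists>r\<in>S. \<forall>w\<in>S. l w = r \<bullet> w"
proof (cases "\<forall>w\<in>S. l w = 0")
  case True
  then show ?thesis using subspace_0[OF S(1)] by (intro bexI[of _ 0]) auto
next
  case False
  then obtain u where u: "u \<in> S" "l u \<noteq> 0" by blast
  interpret l: bounded_linear l by fact
  define K where "K = S \<inter> {w. l w = 0}"
  have "subspace K"
    unfolding K_def using S(1) by (auto simp: subspace_def l.add l.scaleR l.zero)
  moreover have "closed K" unfolding K_def
    by (intro closed_Int S(2) closed_Collect_eq continuous_intros l.continuous_on)
  ultimately obtain p where p: "p \<in> K" "\<forall>w\<in>K. (u - p) \<bullet> w = 0"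
    using projection_on_closed_subspace by blast
  define v where "v = u - p"
  have v: "v \<in> S" "l v \<noteq> 0"
    using u p(1) subspace_diff[OF S(1)] by (auto simp: v_def K_def l.diff)
  then have v0: "v \<bullet> v \<noteq> 0" using l.zero by auto
  have "l w = ((l v / (v \<bullet> v)) *\<^sub>R v) \<bullet> w" if w: "w \<in> S" for w
  proof -
    have "w - (l w / l v) *\<^sub>R v \<in> K"
      using w v subspace_diff[OF S(1)] subspace_scale[OF S(1)] by (auto simp: K_def l.diff l.scaleR)
    then have "v \<bullet> (w - (l w / l v) *\<^sub>R v) = 0" using p(2) by (simp add: v_def)
    then have "v \<bullet> w = (l w / l v) * (v \<bullet> v)" by (simp add: inner_diff_right)
    then show ?thesis using v v0 by simp
  qed
  then show ?thesis using v(1) subspace_scale[OF S(1)] by blast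
qed

text \<open>A fixed point argument, since composing with the test map below need not leave
  \<open>B\<close> symmetric: with \<open>R y\<close> the Riesz representative of the residual at
  \<open>y\<close>, subtracting a small multiple of \<open>R y\<close> from \<open>y\<close> is a
  contraction of \<open>S\<close>.\<close>

lemma lax_milgram:
  fixes S :: "'a::{real_inner,complete_space} set"
  assumes S: "subspace S" "closed S" and B: "bounded_bilinear B" and l: "bounded_linear l"
    and c: "c > 0" and coercive: "\<And>y. y \<in> S \<Longrightarrow> c * (norm y)\<^sup>2 \<le> B y y"
  shows "\<exists>y\<in>S. \<forall>w\<in>S. B y w = l w"
proof -
  interpret B: bounded_bilinear B by fact
  interpret l: bounded_linear l by fact
  obtain K where K: "K > 0" "\<And>y w. norm (B y w) \<le> norm y * norm w * K" using B.pos_bounded by blast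
  have "\<exists>r\<in>S. \<forall>w\<in>S. B y w - l w = r \<bullet> w" for y
    by (rule riesz_closed_subspace[OF S])
      (intro bounded_linear_sub B.bounded_linear_right l)
  then obtain R where R: "\<And>y. R y \<in> S" "\<And>y w. w \<in> S \<Longrightarrow> B y w - l w = R y \<bullet> w" by metis
  \<comment> \<open>Enlarging the bound to at least \<open>c\<close> keeps
    \<open>1 - c\<^sup>2 / K'\<^sup>2\<close> nonnegative, so that \<open>q\<close> is a genuine
    square root.\<close>
  define K' where "K' = max K c"
  have K': "K' > 0" "K' \<ge> c" "K' \<ge> K" using K c by (auto simp: K'_def)
  \<comment> \<open>Minimises \<open>1 - 2 * \<rho> * c + \<rho>\<^sup>2 * K'\<^sup>2\<close>, the
    bound on the squared contraction factor.\<close>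
  define \<rho> where "\<rho> = c / K'\<^sup>2"
  define \<Phi> where "\<Phi> y = y - \<rho> *\<^sub>R R y" for y
  define q where "q = sqrt (1 - c\<^sup>2 / K'\<^sup>2)"
  have q: "0 \<le> 1 - c\<^sup>2 / K'\<^sup>2" "1 - c\<^sup>2 / K'\<^sup>2 < 1"
    using c K' by (simp_all add: field_simps power_mono)
  have contr: "dist (\<Phi> y) (\<Phi> z) \<le> q * dist y z" if y: "y \<in> S" and z: "z \<in> S" for y z
  proof -
    define d e where "d = y - z" and "e = R y - R z"
    have d: "d \<in> S" and e: "e \<in> S" using y z R(1) subspace_diff[OF S(1)] by (auto simp: d_def e_def)
    have eB: "e \<bullet> w = B d w" if "w \<in> S" for w
      using R(2)[OF that, of y] R(2)[OF that, of z] by (simp add: d_def e_def B.diff_left inner_diff_left)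
    have "(norm e)\<^sup>2 = B d e" using eB[OF e] by (simp add: power2_norm_eq_inner)
    also have "\<dots> \<le> norm d * norm e * K" using K(2)[of d e] by simp
    finally have "norm e * norm e \<le> norm e * (norm d * K)" by (simp add: power2_eq_square algebra_simps)
    then have "norm e \<le> norm d * K" by (cases "e = 0") (use K in auto)
    also have "\<dots> \<le> norm d * K'" using K' by (simp add: mult_left_mono)
    finally have ne: "(norm e)\<^sup>2 \<le> (norm d)\<^sup>2 * K'\<^sup>2" by (metis norm_ge_zero power_mono power_mult_distrib)
    have de: "c * (norm d)\<^sup>2 \<le> e \<bullet> d" using coercive[OF d] eB[OF d] by simp
    have rho: "\<rho> > 0" using c K' by (simp add: \<rho>_def)
    have "(norm (d - \<rho> *\<^sub>R e))\<^sup>2 = (norm d)\<^sup>2 - 2 * \<rho> * (e \<bullet> d) + \<rho>\<^sup>2 * (norm e)\<^sup>2"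
      unfolding power2_norm_eq_inner
      by (simp add: inner_diff_left inner_diff_right algebra_simps inner_commute power2_eq_square)
    also have "\<dots> \<le> (norm d)\<^sup>2 - 2 * \<rho> * (c * (norm d)\<^sup>2) + \<rho>\<^sup>2 * ((norm d)\<^sup>2 * K'\<^sup>2)"
      using rho de ne by (intro add_mono diff_mono mult_left_mono) auto
    also have "\<dots> = (1 - c\<^sup>2 / K'\<^sup>2) * (norm d)\<^sup>2"
      using K' by (simp add: \<rho>_def field_simps power2_eq_square)
    also have "\<dots> = (q * norm d)\<^sup>2" using q by (simp add: q_def power_mult_distrib)
    finally have "norm (d - \<rho> *\<^sub>R e) \<le> q * norm d"
      by (rule power2_le_imp_le) (use q in \<open>simp add: q_def\<close>)
    moreover have "\<Phi> y - \<Phi> z = d - \<rho> *\<^sub>R e" by (simp add: \<Phi>_def d_def e_def algebra_simps)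
    ultimately show ?thesis by (simp add: dist_norm d_def)
  qed
  have "\<exists>!y\<in>S. \<Phi> y = y"
  proof (rule Banach_fix)
    show "complete S" using S(2) complete_eq_closed by blast
    show "S \<noteq> {}" using subspace_0[OF S(1)] by auto
    show "0 \<le> q" "q < 1" using q by (simp_all add: q_def real_sqrt_lt_1_iff)
    show "\<Phi> ` S \<subseteq> S" using R(1) subspace_diff[OF S(1)] subspace_scale[OF S(1)] by (auto simp: \<Phi>_def)
  qed (use contr in auto)
  then obtain y where y: "y \<in> S" "\<Phi> y = y" by auto
  then have "R y = 0" using c K' by (auto simp: \<Phi>_def \<rho>_def)
  then show ?thesis using y(1) R(2)[of _ y] by (intro bexI[of _ y]) auto
qed

text \<open>Replacing \<open>a\<close> by its component \<open>e\<close> orthogonal to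
  \<open>S\<close> does not change the span. A vector then lies in the span iff removing its
  component along \<open>e\<close> leaves an element of \<open>S\<close>, which is a preimage of
  \<open>S\<close> under a continuous map.\<close>

lemma closed_span_insert:
  fixes S :: "'a::{real_inner,complete_space} set"
  assumes S: "subspace S" "closed S"
  shows "closed (span (insert a S))"
proof -
  obtain p where p: "p \<in> S" "\<forall>w\<in>S. (a - p) \<bullet> w = 0" using projection_on_closed_subspace[OF S] by blast
  define e where "e = a - p"
  have eS: "e \<bullet> w = 0" if "w \<in> S" for w using p(2) that by (simp add: e_def)
  have spanS: "span S = S" using S(1) by (simp add: span_eq_iff)
  have sp: "span (insert a S) = {x. \<exists>t. x - t *\<^sub>R e \<in> S}"
  proof -
    have "(\<exists>t. x - t *\<^sub>R a \<in> S) \<longleftrightarrow> (\<exists>t. x - t *\<^sub>R e \<in> S)" for x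
    proof -
      have "x - t *\<^sub>R a \<in> S \<longleftrightarrow> x - t *\<^sub>R e \<in> S" for t
      proof -
        have "x - t *\<^sub>R e = (x - t *\<^sub>R a) + t *\<^sub>R p" by (simp add: e_def algebra_simps)
        then show ?thesis
          by (metis S(1) add_diff_cancel_right' p(1) subspace_add subspace_diff subspace_scale)
      qed
      then show ?thesis by blast
    qed
    then show ?thesis by (simp add: span_insert spanS)
  qed
  show ?thesis
  proof (cases "e = 0")
    case True
    then show ?thesis using sp S(2) by simp
  next
    case False
    have "span (insert a S) = (\<lambda>x. x - ((x \<bullet> e) / (e \<bullet> e)) *\<^sub>R e) -` S"
    proof -
      have "x - ((x \<bullet> e) / (e \<bullet> e)) *\<^sub>R e \<in> S" if "x - t *\<^sub>R e \<in> S" for x t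
      proof -
        have "(x - t *\<^sub>R e) \<bullet> e = 0" using eS[OF that] by (simp add: inner_commute)
        then have "t = (x \<bullet> e) / (e \<bullet> e)" using False by (simp add: inner_diff_left field_simps)
        then show ?thesis using that by simp
      qed
      then show ?thesis unfolding sp by auto
    qed
    moreover have "continuous_on UNIV (\<lambda>x. x - ((x \<bullet> e) / (e \<bullet> e)) *\<^sub>R e)"
      by (intro continuous_intros) (use False in auto)
    ultimately show ?thesis using S(2) by (simp add: closed_vimage)
  qed
qed

lemma closed_span_finite:
  fixes B :: "'a::{real_inner,complete_space} set"
  assumes "finite B"
  shows "closed (span B)"
  using assms
proof (induction B)
  case (insert a B)
  have "span (insert a B) = span (insert a (span B))"
    by (auto simp: span_insert span_span)
  then show ?case using closed_span_insert[OF subspace_span insert.IH, of a] by simp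
qed simp

text \<open>\<open>T\<close> is the test map that makes the form coercive and \<open>G\<close> the
  full solution space. Coercivity is uniform over an open set \<open>U\<close> of controls, so that
  solutions can be differentiated at every point of \<open>U\<close>.\<close>

locale parametric_problem =
  fixes A0 :: "'z::{real_inner,complete_space} \<Rightarrow> 'z"
    and A1 :: "'l::finite \<Rightarrow> 'z \<Rightarrow> 'z"
    and T :: "'z \<Rightarrow> 'z" and G :: "'z set" and c KT :: real and U :: "(real^'l) set"
  assumes A0: "bounded_linear A0" and A1: "\<And>k. bounded_linear (A1 k)"
    and sym0: "\<And>y w. A0 y \<bullet> w = A0 w \<bullet> y" and sym1: "\<And>k y w. A1 k y \<bullet> w = A1 k w \<bullet> y"
    and T: "bounded_linear T" and KT: "\<And>y. norm (T y) \<le> KT * norm y" and c: "c > 0" and U: "open U"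
    and G: "subspace G" "closed G" "T ` G = G"
    and coercive: "\<And>u y. u \<in> U \<Longrightarrow> y \<in> G \<Longrightarrow>
           c * (norm y)\<^sup>2 \<le> (A0 y + (\<Sum>k\<in>UNIV. u $ k *\<^sub>R A1 k y)) \<bullet> T y"
begin

definition L :: "real^'l \<Rightarrow> 'z \<Rightarrow> 'z" where
  "L v y = (\<Sum>k\<in>UNIV. v $ k *\<^sub>R A1 k y)"

definition A :: "real^'l \<Rightarrow> 'z \<Rightarrow> 'z" where
  "A u y = A0 y + L u y"

text \<open>Invariance under \<open>T\<close> is the property that lets a subspace inherit
  coercivity from \<open>G\<close> with unchanged constants.\<close>

definition admissible :: "'z set \<Rightarrow> bool" where
  "admissible V \<longleftrightarrow> subspace V \<and> closed V \<and> V \<subseteq> G \<and> T ` V = V"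

definition sol :: "'z set \<Rightarrow> real^'l \<Rightarrow> 'z \<Rightarrow> 'z" where
  "sol V u g = (THE y. y \<in> V \<and> (\<forall>w\<in>V. A u y \<bullet> w = g \<bullet> w))"

lemma admissible_G: "admissible G"
  using G by (simp add: admissible_def)

lemma L_bilinear: "bounded_bilinear L"
proof
  have "\<exists>K. \<forall>y. norm (A1 k y) \<le> norm y * K" for k
    using bounded_linear.bounded[OF A1] by blast
  then obtain K where K: "\<And>k y. norm (A1 k y) \<le> norm y * K k" by metis
  have "norm (L v y) \<le> norm v * norm y * (\<Sum>k\<in>UNIV. K k)" for v y
  proof -
    have "norm (L v y) \<le> (\<Sum>k\<in>UNIV. norm (v $ k *\<^sub>R A1 k y))" unfolding L_def by (rule norm_sum)
    also have "\<dots> \<le> (\<Sum>k\<in>UNIV. norm v * (norm y * K k))"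
    proof (rule sum_mono)
      fix k
      show "norm (v $ k *\<^sub>R A1 k y) \<le> norm v * (norm y * K k)"
        using mult_mono[OF component_le_norm_cart[of v k] K[of k y]] by simp
    qed
    finally show ?thesis by (simp add: sum_distrib_left mult.assoc)
  qed
  then show "\<exists>K. \<forall>v y. norm (L v y) \<le> norm v * norm y * K" by blast
qed (simp_all add: L_def linear_simps[OF A1] scaleR_add_left scaleR_add_right sum.distrib scaleR_sum_right mult.commute)

lemma A_linear: "bounded_linear (A u)"
  unfolding A_def by (intro bounded_linear_add A0 bounded_bilinear.bounded_linear_right[OF L_bilinear])

lemma A_sym: "A u y \<bullet> w = A u w \<bullet> y"
  by (simp add: A_def L_def inner_add_left inner_sum_left sym0[of y w] sym1[of _ y w])

lemma A_coercive: "u \<in> U \<Longrightarrow> y \<in> G \<Longrightarrow> c * (norm y)\<^sup>2 \<le> A u y \<bullet> T y"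
  using coercive by (simp add: A_def L_def)

text \<open>Test with \<open>T y\<close>. The constant depends on neither \<open>V\<close> nor
  \<open>u\<close>, and all bounds uniform in the mesh rest on this.\<close>

lemma stability:
  assumes "u \<in> U" "y \<in> V" "admissible V" "\<And>w. w \<in> V \<Longrightarrow> A u y \<bullet> w = r \<bullet> w"
  shows "norm y \<le> KT / c * norm r"
proof -
  have "c * (norm y)\<^sup>2 \<le> A u y \<bullet> T y" using assms A_coercive by (auto simp: admissible_def)
  also have "\<dots> = r \<bullet> T y" using assms by (auto simp: admissible_def)
  also have "\<dots> \<le> norm r * (KT * norm y)"
    using norm_cauchy_schwarz[of r "T y"] mult_left_mono[OF KT[of y] norm_ge_zero[of r]] by linarith
  finally have "norm y * (c * norm y) \<le> norm y * (KT * norm r)"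
    by (simp add: power2_eq_square algebra_simps)
  then have "c * norm y \<le> KT * norm r \<or> y = 0" by auto
  \<comment> \<open>The sign of \<open>KT\<close> is not prescribed: a nonzero vector forces it to
    be nonnegative, and in the trivial space \<open>r\<close> vanishes.\<close>
  moreover have "0 \<le> KT * norm r" if "y = 0"
  proof (cases "\<exists>x::'z. x \<noteq> 0")
    case True
    then obtain x :: 'z where "x \<noteq> 0" by blast
    then have "0 \<le> KT" using KT[of x] by (metis norm_ge_zero norm_le_zero_iff order_trans zero_le_mult_iff)
    then show ?thesis by simp
  next
    case False
    then have "r = 0" by blast
    then show ?thesis by simp
  qed
  ultimately show ?thesis using c by (auto simp: field_simps)
qed

lemma sol_unique:
  assumes "u \<in> U" "admissible V" "y \<in> V" "\<And>w. w \<in> V \<Longrightarrow> A u y \<bullet> w = g \<bullet> w"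
  shows "sol V u g = y"
  unfolding sol_def
proof (rule the_equality)
  fix z assume z: "z \<in> V \<and> (\<forall>w\<in>V. A u z \<bullet> w = g \<bullet> w)"
  have "norm (z - y) \<le> KT / c * norm (0::'z)"
  proof (rule stability[OF assms(1) _ assms(2)])
    show "z - y \<in> V" using assms z by (auto simp: admissible_def subspace_diff)
    show "A u (z - y) \<bullet> w = 0 \<bullet> w" if "w \<in> V" for w
      using assms z that by (simp add: linear_simps[OF A_linear] inner_diff_left)
  qed
  then show "z = y" by simp
qed (use assms in auto)

lemma sol:
  assumes u: "u \<in> U" and V: "admissible V"
  shows "sol V u g \<in> V" "\<And>w. w \<in> V \<Longrightarrow> A u (sol V u g) \<bullet> w = g \<bullet> w"
proof -
  \<comment> \<open>Lax-Milgram for the form tested through \<open>T\<close>. As \<open>T\<close>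
    maps \<open>V\<close> onto itself, this is equivalent to the original equation.\<close>
  have "\<exists>y\<in>V. \<forall>w\<in>V. A u y \<bullet> T w = g \<bullet> T w"
  proof (rule lax_milgram)
    show "subspace V" "closed V" using V by (auto simp: admissible_def)
    show "bounded_bilinear (\<lambda>y w. A u y \<bullet> T w)"
      by (rule bounded_bilinear.comp[OF bounded_bilinear_inner A_linear T])
    show "bounded_linear (\<lambda>w. g \<bullet> T w)"
      by (rule bounded_linear_compose[OF bounded_linear_inner_right T])
    show "c * (norm y)\<^sup>2 \<le> A u y \<bullet> T y" if "y \<in> V" for y
      using A_coercive u that V by (auto simp: admissible_def)
  qed (rule c)
  then obtain y where y: "y \<in> V" "\<And>w. w \<in> V \<Longrightarrow> A u y \<bullet> T w = g \<bullet> T w" by blast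
  have yw: "A u y \<bullet> w = g \<bullet> w" if "w \<in> V" for w
  proof -
    have "w \<in> T ` V" using that V by (simp add: admissible_def)
    then obtain w' where "w' \<in> V" "w = T w'" by blast
    then show ?thesis using y(2) by simp
  qed
  have "sol V u g = y" using sol_unique[OF u V y(1) yw] .
  then show "sol V u g \<in> V" "\<And>w. w \<in> V \<Longrightarrow> A u (sol V u g) \<bullet> w = g \<bullet> w" using y(1) yw by auto
qed

lemma sol_bound: "u \<in> U \<Longrightarrow> admissible V \<Longrightarrow> norm (sol V u g) \<le> KT / c * norm g"
  by (rule stability[OF _ sol(1) _ sol(2)])

lemma sol_linear:
  assumes u: "u \<in> U" and V: "admissible V"
  shows "linear (sol V u)"
proof
  have S: "subspace V" using V by (simp add: admissible_def)
  show "sol V u (x + y) = sol V u x + sol V u y" for x y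
    by (rule sol_unique[OF u V])
      (auto simp: subspace_add[OF S] sol[OF u V] linear_simps[OF A_linear] inner_add_left)
  show "sol V u (r *\<^sub>R x) = r *\<^sub>R sol V u x" for r x
    by (rule sol_unique[OF u V])
      (auto simp: subspace_scale[OF S] sol[OF u V] linear_simps[OF A_linear])
qed

lemma sol_diff: "u \<in> U \<Longrightarrow> admissible V \<Longrightarrow> sol V u (x - y) = sol V u x - sol V u y"
  using linear_diff[OF sol_linear] .

text \<open>The change of the operator is moved to the right-hand side, so the difference is
  expressed through the solution map at one fixed control. Differentiability in the control then
  needs no calculus of inverse operators.\<close>

lemma sol_increment:
  assumes u: "u \<in> U" "u' \<in> U" and V: "admissible V"
  shows "sol V u' g' - sol V u g = sol V u (g' - g - L (u' - u) (sol V u' g'))"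
proof (rule sol_unique[OF u(1) V, symmetric])
  show "sol V u' g' - sol V u g \<in> V" using sol[OF _ V] u V by (auto simp: admissible_def subspace_diff)
  interpret L: bounded_bilinear L by (rule L_bilinear)
  fix w assume w: "w \<in> V"
  have "A u (sol V u' g') = A u' (sol V u' g') - L (u' - u) (sol V u' g')"
    by (simp add: A_def L.diff_left)
  then show "A u (sol V u' g' - sol V u g) \<bullet> w = (g' - g - L (u' - u) (sol V u' g')) \<bullet> w"
    using w by (simp add: linear_simps[OF A_linear] inner_diff_left sol[OF u(1) V] sol[OF u(2) V])
qed

text \<open>By \<open>sol_increment\<close> the solution near \<open>u\<close> is, up to a constant,
  the fixed bounded linear map \<open>sol V u\<close> applied to
  \<open>g x - g u - L (x - u) (y x)\<close>. The last term is a product whose first factor vanishes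
  at \<open>u\<close>, so continuity of \<open>y\<close> is enough to differentiate it.\<close>

lemma sol_has_derivative:
  assumes u: "u \<in> U" and V: "admissible V" and g: "(g has_derivative g') (at u)"
  shows "((\<lambda>x. sol V x (g x)) has_derivative (\<lambda>v. sol V u (g' v - L v (sol V u (g u))))) (at u)"
proof -
  interpret L: bounded_bilinear L by (rule L_bilinear)
  define y where "y x = sol V x (g x)" for x
  have evU: "\<forall>\<^sub>F x in at u. x \<in> U" using U u eventually_at_topological by blast
  have bl: "bounded_linear (sol V u)"
    using sol_linear[OF u V] sol_bound[OF u V]
    by (intro bounded_linear_intro[where K = "KT / c"]) (auto simp: linear_add linear_cmul mult.commute)
  have g_lim: "(g \<longlongrightarrow> g u) (at u)"
    using has_derivative_continuous[OF g] by (simp add: isCont_def)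
  have id_lim: "((\<lambda>x. x - u) \<longlongrightarrow> 0) (at u)"
    using LIM_zero[OF tendsto_ident_at, of u UNIV] by simp
  \<comment> \<open>The a priori bound on \<open>y x\<close> gives this limit; through the increment
    formula it yields continuity of \<open>y\<close>.\<close>
  have Lu_lim: "((\<lambda>x. L (x - u) (y x)) \<longlongrightarrow> 0) (at u)"
  proof -
    obtain K where K: "K \<ge> 0" "\<And>v z. norm (L v z) \<le> norm v * norm z * K" using L.nonneg_bounded by blast
    have "((\<lambda>x. norm (x - u) * (\<bar>KT / c\<bar> * norm (g x)) * K) \<longlongrightarrow> norm (0::real^'l) * (\<bar>KT / c\<bar> * norm (g u)) * K) (at u)"
      by (intro tendsto_intros g_lim id_lim)
    then have 1: "((\<lambda>x. norm (x - u) * (\<bar>KT / c\<bar> * norm (g x)) * K) \<longlongrightarrow> 0) (at u)" by simp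
    show ?thesis
    proof (rule Lim_null_comparison[OF _ 1])
      show "\<forall>\<^sub>F x in at u. norm (L (x - u) (y x)) \<le> norm (x - u) * (\<bar>KT / c\<bar> * norm (g x)) * K"
        using evU
      proof eventually_elim
        case (elim x)
        have "norm (y x) \<le> \<bar>KT / c\<bar> * norm (g x)"
          using sol_bound[OF elim V, of "g x"] abs_ge_self[of "KT / c"]
          by (smt (verit) mult_right_mono norm_ge_zero y_def)
        then show ?case
          using K(1) by (intro order_trans[OF K(2)] mult_right_mono mult_left_mono) auto
      qed
    qed
  qed
  have y_lim: "(y \<longlongrightarrow> y u) (at u)"
  proof -
    have "((\<lambda>x. sol V u (g x - g u - L (x - u) (y x))) \<longlongrightarrow> sol V u (g u - g u - 0)) (at u)"
      by (intro bounded_linear.tendsto[OF bl] tendsto_diff g_lim tendsto_const Lu_lim)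
    then have "((\<lambda>x. sol V u (g x - g u - L (x - u) (y x))) \<longlongrightarrow> 0) (at u)"
      by (simp add: linear_0[OF sol_linear[OF u V]])
    then have "((\<lambda>x. y x - y u) \<longlongrightarrow> 0) (at u)"
      by (rule Lim_transform_eventually)
        (use evU in eventually_elim, simp add: y_def sol_increment[OF u _ V])
    then show ?thesis using LIM_zero_cancel by blast
  qed
  have prod: "((\<lambda>x. L (x - u) (y x)) has_derivative (\<lambda>v. L v (y u))) (at u)"
  proof (rule has_derivativeI)
    show "bounded_linear (\<lambda>v. L v (y u))" by (rule L.bounded_linear_left)
    obtain K where K: "K \<ge> 0" "\<And>v z. norm (L v z) \<le> norm v * norm z * K" using L.nonneg_bounded by blast
    have "((\<lambda>x. norm (y x - y u) * K) \<longlongrightarrow> norm (y u - y u) * K) (at u)"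
      by (intro tendsto_intros y_lim)
    then have 1: "((\<lambda>x. norm (y x - y u) * K) \<longlongrightarrow> 0) (at u)" by simp
    have "((\<lambda>x. (L (x - u) (y x) - L (x - u) (y u)) /\<^sub>R norm (x - u)) \<longlongrightarrow> 0) (at u)"
    proof (rule Lim_null_comparison[OF _ 1])
      have "norm ((L (x - u) (y x) - L (x - u) (y u)) /\<^sub>R norm (x - u)) \<le> norm (y x - y u) * K"
        if "x \<noteq> u" for x
      proof -
        have "norm ((L (x - u) (y x) - L (x - u) (y u)) /\<^sub>R norm (x - u)) = norm (L (x - u) (y x - y u)) / norm (x - u)"
          by (simp add: L.diff_right divide_inverse)
        also have "\<dots> \<le> norm (x - u) * norm (y x - y u) * K / norm (x - u)"
          by (intro divide_right_mono K) simp
        finally show ?thesis using that by simp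
      qed
      then show "\<forall>\<^sub>F x in at u. norm ((L (x - u) (y x) - L (x - u) (y u)) /\<^sub>R norm (x - u)) \<le> norm (y x - y u) * K"
        using eventually_neq_at_within[of u u UNIV] by (rule eventually_mono[rotated])
    qed
    then show "((\<lambda>x. (L (x - u) (y x) - L (u - u) (y u) - L (x - u) (y u)) /\<^sub>R norm (x - u)) \<longlongrightarrow> 0) (at u)"
      by (simp add: L.zero_left)
  qed
  have "((\<lambda>x. y u + sol V u (g x - g u - L (x - u) (y x))) has_derivative
          (\<lambda>v. 0 + sol V u (g' v - 0 - L v (y u)))) (at u)"
    by (intro has_derivative_add has_derivative_const bounded_linear.has_derivative[OF bl] has_derivative_diff g prod)
  then have "((\<lambda>x. y u + sol V u (g x - g u - L (x - u) (y x))) has_derivative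
          (\<lambda>v. sol V u (g' v - L v (y u)))) (at u)" by simp
  then have "(y has_derivative (\<lambda>v. sol V u (g' v - L v (y u)))) (at u)"
  proof (rule has_derivative_transform_within_open[OF _ U u])
    show "y u + sol V u (g x - g u - L (x - u) (y x)) = y x" if "x \<in> U" for x
      by (simp add: y_def sol_increment[OF u that V, symmetric])
  qed
  then show ?thesis by (simp add: y_def[abs_def])
qed

end

section \<open>The control problem in Hilbert space\<close>

text \<open>\<open>g\<close> is the load, \<open>D\<close> the desired state, and \<open>q\<close>
  measures adjoint errors more weakly than the norm. The bound with \<open>Kb\<close> says that the
  control derivatives \<open>A1 k\<close> see their second argument only through
  \<open>q\<close>.\<close>

locale control_problem = parametric_problem +
  fixes g D :: 'a and q :: "'a \<Rightarrow> real" and Kb \<alpha> :: real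
  assumes q: "\<And>y. 0 \<le> q y" "\<And>y. q y \<le> norm y"
    and Kb: "0 \<le> Kb" "\<And>k y w. \<bar>A1 k y \<bullet> w\<bar> \<le> Kb * norm y * q w"
begin

definition S :: "'a set \<Rightarrow> real^'b \<Rightarrow> 'a" where
  "S V u = sol V u g"

text \<open>\<open>V\<close> is the space of the adjoint equation, \<open>W\<close> that of the
  state in its right-hand side: \<open>P V V\<close> is the adjoint belonging to the discrete
  problem, \<open>P V G\<close> the finite element approximation of the continuous adjoint.\<close>

definition P :: "'a set \<Rightarrow> 'a set \<Rightarrow> real^'b \<Rightarrow> 'a" where
  "P V W u = sol V u (S W u - D)"

definition J :: "'a set \<Rightarrow> real^'b \<Rightarrow> real" where
  "J V u = 1 / 2 * (norm (S V u - D))\<^sup>2 + \<alpha> / 2 * (norm u)\<^sup>2"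

text \<open>The minus sign is that of the load \<open>- L v (S V u)\<close> in the linearised state
  equation. It turns into a plus in \<open>reduced_gradient\<close>, because the mass operators
  carry a negative factor.\<close>

definition grad :: "'a set \<Rightarrow> real^'b \<Rightarrow> real^'b" where
  "grad V u = (\<chi> k. \<alpha> * u $ k - A1 k (S V u) \<bullet> P V V u)"

lemma S_has_derivative:
  assumes "u \<in> U" "admissible V"
  shows "(S V has_derivative (\<lambda>v. sol V u (- L v (S V u)))) (at u)"
  using sol_has_derivative[OF assms has_derivative_const[of g]] by (simp add: S_def[abs_def])

lemma J_has_derivative:
  assumes u: "u \<in> U" and V: "admissible V"
  shows "(J V has_derivative (\<lambda>v. grad V u \<bullet> v)) (at u)"
proof -
  define \<eta> where "\<eta> v = sol V u (- L v (S V u))" for v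
  have "((\<lambda>x. 1 / 2 * ((S V x - D) \<bullet> (S V x - D)) + \<alpha> / 2 * (x \<bullet> x)) has_derivative
     (\<lambda>v. 1 / 2 * ((S V u - D) \<bullet> (\<eta> v - 0) + (\<eta> v - 0) \<bullet> (S V u - D)) + \<alpha> / 2 * (u \<bullet> v + v \<bullet> u))) (at u)"
    unfolding \<eta>_def
    by (intro has_derivative_add has_derivative_mult_right has_derivative_inner has_derivative_diff
        has_derivative_const has_derivative_ident S_has_derivative[OF u V])
  moreover have "(\<lambda>x. 1 / 2 * ((S V x - D) \<bullet> (S V x - D)) + \<alpha> / 2 * (x \<bullet> x)) = J V"
    by (simp add: fun_eq_iff J_def power2_norm_eq_inner)
  moreover have "1 / 2 * ((S V u - D) \<bullet> (\<eta> v - 0) + (\<eta> v - 0) \<bullet> (S V u - D)) + \<alpha> / 2 * (u \<bullet> v + v \<bullet> u) = grad V u \<bullet> v" for v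
  proof -
    \<comment> \<open>Adjoint argument: the equation of \<open>P V V u\<close> tested with
      \<open>\<eta> v\<close>, then symmetry of \<open>A u\<close>, then the linearised state
      equation tested with \<open>P V V u\<close>.\<close>
    have "(S V u - D) \<bullet> \<eta> v = A u (P V V u) \<bullet> \<eta> v"
      using sol[OF u V] by (simp add: P_def \<eta>_def)
    also have "\<dots> = A u (\<eta> v) \<bullet> P V V u" by (rule A_sym)
    also have "\<dots> = - L v (S V u) \<bullet> P V V u"
      using sol[OF u V] by (simp add: P_def \<eta>_def)
    also have "\<dots> = - (\<Sum>k\<in>UNIV. v $ k * (A1 k (S V u) \<bullet> P V V u))"
      by (simp add: L_def inner_sum_left)
    finally show ?thesis
      by (simp add: grad_def inner_vec_def inner_commute algebra_simps sum.distrib sum_subtractf sum_distrib_left)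
  qed
  ultimately show ?thesis by simp
qed

lemma grad_differentiable:
  assumes u: "u \<in> U" and V: "admissible V"
  shows "grad V differentiable (at u)"
proof (subst differentiable_componentwise_within, intro ballI)
  fix i :: "real^'b" assume "i \<in> Basis"
  then obtain k where i: "i = axis k 1" by (auto simp: Basis_vec_def)
  have S: "S V differentiable (at u)"
    using S_has_derivative[OF u V] by (auto simp: differentiable_def)
  have "((\<lambda>x. S V x - D) has_derivative (\<lambda>v. sol V u (- L v (S V u)) - 0)) (at u)"
    by (intro has_derivative_diff has_derivative_const S_has_derivative[OF u V])
  then have P: "P V V differentiable (at u)"
    using sol_has_derivative[OF u V] by (auto simp: differentiable_def P_def[abs_def])
  have AS: "(\<lambda>x. A1 k (S V x)) differentiable (at u)"
    using S bounded_linear.has_derivative[OF A1] unfolding differentiable_def by blast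
  have "(\<lambda>x. A1 k (S V x) \<bullet> P V V x) differentiable (at u)"
    using AS P has_derivative_inner unfolding differentiable_def by blast
  moreover have "(\<lambda>x::real^'b. \<alpha> * x $ k) differentiable (at u)"
    by (auto simp: differentiable_def intro!: exI has_derivative_mult_right
        bounded_linear.has_derivative[OF bounded_linear_vec_nth] has_derivative_ident)
  ultimately have "(\<lambda>x. \<alpha> * x $ k - A1 k (S V x) \<bullet> P V V x) differentiable (at u)"
    by (intro differentiable_diff)
  then show "(\<lambda>x. grad V x \<bullet> i) differentiable (at u)"
    by (simp add: i inner_axis grad_def)
qed

text \<open>The product of state and adjoint is split three ways: state error, adjoint error for
  equal states, and adjoint error caused by the state error. The middle one is the term left in
  \<open>q\<close>; stability bounds the third by the state error.\<close>

lemma grad_error: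
  "\<exists>C\<ge>0. \<forall>V u. admissible V \<longrightarrow> u \<in> U \<longrightarrow>
     norm (grad G u - grad V u) \<le> C * (norm (S G u - S V u) + q (P G G u - P V G u))"
proof -
  define K where "K = \<bar>KT / c\<bar>"
  have K: "norm (sol V u x) \<le> K * norm x" if "u \<in> U" "admissible V" for V u x
    using sol_bound[OF that, of x] mult_right_mono[OF abs_ge_self[of "KT / c"] norm_ge_zero[of x]]
    by (simp add: K_def)
  have K0: "K \<ge> 0" by (simp add: K_def)
  \<comment> \<open>\<open>M\<close> bounds the states of all admissible spaces and \<open>N\<close>
    the continuous adjoint states; \<open>C\<close> adds the coefficients of the three
    terms.\<close>
  define M where "M = K * norm g"
  define N where "N = K * (M + norm D)"
  define C where "C = Kb * N + Kb * M + Kb * M * K"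
  have M0: "M \<ge> 0" "N \<ge> 0" by (simp_all add: M_def N_def K0)
  have C0: "C \<ge> 0" using Kb(1) K0 M0 by (simp add: C_def)
  have "norm (grad G u - grad V u) \<le> real CARD('b) * C * (norm (S G u - S V u) + q (P G G u - P V G u))"
    if V: "admissible V" and u: "u \<in> U" for V u
  proof -
    define s where "s = norm (S G u - S V u)"
    define p where "p = q (P G G u - P V G u)"
    have SM: "norm (S W u) \<le> M" if "admissible W" for W
      using K[OF u that] by (simp add: S_def M_def)
    have "norm (S G u - D) \<le> M + norm D"
      using SM[OF admissible_G] norm_triangle_ineq4[of "S G u" D] by linarith
    then have PN: "norm (P G G u) \<le> N"
      unfolding P_def N_def by (intro order_trans[OF K[OF u admissible_G]] mult_left_mono K0)
    have PP: "norm (P V G u - P V V u) \<le> K * s"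
      using K[OF u V, of "S G u - D - (S V u - D)"] by (simp add: P_def sol_diff[OF u V, symmetric] s_def)
    have comp: "\<bar>(grad G u - grad V u) $ k\<bar> \<le> C * (s + p)" for k
    proof -
      have "A1 k (S G u) \<bullet> P G G u - A1 k (S V u) \<bullet> P V V u =
        A1 k (S G u - S V u) \<bullet> P G G u + A1 k (S V u) \<bullet> (P G G u - P V G u) + A1 k (S V u) \<bullet> (P V G u - P V V u)"
        by (simp add: linear_simps[OF A1] inner_diff_left inner_diff_right)
      moreover have "\<bar>A1 k (S G u - S V u) \<bullet> P G G u\<bar> \<le> Kb * s * N"
        unfolding s_def using PN q(2)[of "P G G u"] Kb(1)
        by (intro order_trans[OF Kb(2)] mult_left_mono) auto
      moreover have "\<bar>A1 k (S V u) \<bullet> (P G G u - P V G u)\<bar> \<le> Kb * M * p"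
        unfolding p_def using SM[OF V] q(1) Kb(1)
        by (intro order_trans[OF Kb(2)] mult_right_mono mult_left_mono) auto
      moreover have "\<bar>A1 k (S V u) \<bullet> (P V G u - P V V u)\<bar> \<le> Kb * M * (K * s)"
      proof (rule order_trans[OF Kb(2)])
        show "Kb * norm (S V u) * q (P V G u - P V V u) \<le> Kb * M * (K * s)"
          using SM[OF V] PP q(1) order_trans[OF q(2) PP] Kb(1) M0 by (intro mult_mono mult_left_mono) auto
      qed
      \<comment> \<open>Pads the coefficients of \<open>s\<close> and \<open>p\<close> to the common
        value \<open>C\<close>.\<close>
      moreover have "0 \<le> (Kb * N + Kb * M * K) * p" "0 \<le> Kb * M * s"
        using Kb(1) K0 M0 q(1) by (simp_all add: p_def s_def)
      ultimately show ?thesis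
        by (simp add: grad_def C_def algebra_simps)
    qed
    have "norm (grad G u - grad V u) \<le> (\<Sum>k\<in>UNIV. \<bar>(grad G u - grad V u) $ k\<bar>)" by (rule norm_le_l1_cart)
    also have "\<dots> \<le> (\<Sum>k\<in>(UNIV::'b set). C * (s + p))" by (intro sum_mono comp)
    finally show ?thesis by (simp add: s_def p_def mult.assoc)
  qed
  then show ?thesis using C0 by (intro exI[of _ "real CARD('b) * C"]) auto
qed

end

section \<open>Box constraints: first-order conditions and the abstract error estimate\<close>

lemma mem_Uad: "v \<in> Uad a b \<longleftrightarrow> (\<forall>k. a $ k \<le> v $ k \<and> v $ k \<le> b $ k)"
  by (auto simp: Uad_def less_eq_vec_def)

text \<open>Otherwise \<open>J\<close> would strictly decrease along the segment from
  \<open>u\<close> towards \<open>v\<close>, which stays in the box by convexity.\<close>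

lemma local_solution_variational_inequality:
  fixes u :: "real^'l"
  assumes loc: "local_solution J (Uad a b) u" and J: "(J has_derivative (\<lambda>v. g \<bullet> v)) (at u)"
    and v: "v \<in> Uad a b"
  shows "0 \<le> g \<bullet> (v - u)"
proof (rule ccontr)
  assume neg: "\<not> 0 \<le> g \<bullet> (v - u)"
  obtain \<delta> where u: "u \<in> Uad a b" and \<delta>: "\<delta> > 0" "\<And>w. w \<in> Uad a b \<Longrightarrow> dist w u < \<delta> \<Longrightarrow> J u \<le> J w"
    using loc by (auto simp: local_solution_def)
  define \<phi> where "\<phi> t = J (u + t *\<^sub>R (v - u))" for t
  have "((\<lambda>t. u + t *\<^sub>R (v - u)) has_derivative (\<lambda>t. t *\<^sub>R (v - u))) (at 0)"
    by (auto intro!: derivative_eq_intros)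
  then have "(\<phi> has_derivative (\<lambda>t. g \<bullet> (t *\<^sub>R (v - u)))) (at 0)"
    unfolding \<phi>_def using J by (intro has_derivative_compose[where g = J and f = "\<lambda>t. u + t *\<^sub>R (v - u)"]) auto
  then have "(\<phi> has_real_derivative (g \<bullet> (v - u))) (at 0)"
    by (simp add: has_field_derivative_def mult.commute[of _ "g \<bullet> (v - u)"] fun_eq_iff)
  then obtain d where d: "d > 0" "\<And>t. t > 0 \<Longrightarrow> t < d \<Longrightarrow> \<phi> (0 + t) < \<phi> 0"
    using DERIV_neg_dec_right neg by (metis not_le)
  \<comment> \<open>Below \<open>d\<close> the value decreases, at most 1 keeps the point on the
    segment, and the last entry keeps it within \<open>\<delta>\<close>; the 1 in the denominator
    avoids division by zero.\<close>
  define t where "t = min (min (d / 2) 1) (\<delta> / (norm (v - u) + 1) / 2)"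
  have n: "norm (v - u) + 1 > 0" using norm_ge_zero[of "v - u"] by linarith
  have t: "0 < t" "t < d" "t \<le> 1" "t \<le> \<delta> / (norm (v - u) + 1) / 2"
    using d(1) \<delta>(1) n by (auto simp: t_def)
  have "u + t *\<^sub>R (v - u) \<in> Uad a b"
    unfolding mem_Uad
  proof (intro allI)
    fix k
    have "(u + t *\<^sub>R (v - u)) $ k = (1 - t) * u $ k + t * v $ k" by (simp add: algebra_simps)
    moreover have "(1 - t) * a $ k + t * a $ k \<le> (1 - t) * u $ k + t * v $ k"
      "(1 - t) * u $ k + t * v $ k \<le> (1 - t) * b $ k + t * b $ k"
      using u v t by (auto simp: mem_Uad intro!: add_mono mult_left_mono)
    ultimately show "a $ k \<le> (u + t *\<^sub>R (v - u)) $ k \<and> (u + t *\<^sub>R (v - u)) $ k \<le> b $ k"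
      by (simp add: algebra_simps)
  qed
  moreover have "dist (u + t *\<^sub>R (v - u)) u < \<delta>"
  proof -
    have "t * (norm (v - u) + 1) \<le> \<delta> / 2" using t(4) n by (simp add: field_simps)
    moreover have "dist (u + t *\<^sub>R (v - u)) u = t * norm (v - u)" using t(1) by (simp add: dist_norm)
    ultimately show ?thesis using \<delta>(1) t(1) by (simp add: algebra_simps)
  qed
  ultimately have "\<phi> 0 \<le> \<phi> t" using \<delta>(2) by (simp add: \<phi>_def)
  then show False using d(2)[OF t(1,2)] by simp
qed

text \<open>The variational inequality for competitors that differ from \<open>u\<close> in the
  single coordinate \<open>k\<close>.\<close>

lemma local_solution_active:
  fixes u :: "real^'l"
  assumes loc: "local_solution J (Uad a b) u" and J: "(J has_derivative (\<lambda>v. g \<bullet> v)) (at u)"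
  shows "g $ k > 0 \<Longrightarrow> u $ k = a $ k" "g $ k < 0 \<Longrightarrow> u $ k = b $ k"
proof -
  have u: "u \<in> Uad a b" using loc by (simp add: local_solution_def)
  have *: "0 \<le> g $ k * (t - u $ k)" if "a $ k \<le> t" "t \<le> b $ k" for t
  proof -
    define v where "v = u + (t - u $ k) *\<^sub>R axis k 1"
    have "v \<in> Uad a b" using u that by (auto simp: mem_Uad v_def axis_def)
    then have "0 \<le> g \<bullet> (v - u)" by (rule local_solution_variational_inequality[OF loc J])
    then show ?thesis by (simp add: v_def inner_axis mult.commute)
  qed
  have uk: "a $ k \<le> u $ k" "u $ k \<le> b $ k" using u by (auto simp: mem_Uad)
  show "u $ k = a $ k" if "g $ k > 0"
    using *[of "a $ k"] uk that by (simp add: zero_le_mult_iff)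
  show "u $ k = b $ k" if "g $ k < 0"
    using *[of "b $ k"] uk that by (simp add: zero_le_mult_iff)
qed

text \<open>In \<open>second_derivative\<close> the direction \<open>v\<close> is inserted before
  the second differentiation, so it suffices to differentiate the scalar function
  \<open>g x \<bullet> v\<close>.\<close>

lemma second_derivative_of_gradient:
  assumes U: "open U" "u \<in> U" and J: "\<And>x. x \<in> U \<Longrightarrow> (J has_derivative (\<lambda>v. g x \<bullet> v)) (at x)"
    and g: "(g has_derivative g') (at u)"
  shows "second_derivative J u v w = g' w \<bullet> v"
proof -
  have "((\<lambda>x. g x \<bullet> v) has_derivative (\<lambda>w. g u \<bullet> 0 + g' w \<bullet> v)) (at u)"
    by (intro has_derivative_inner g has_derivative_const)
  then have "((\<lambda>x. frechet_derivative J (at x) v) has_derivative (\<lambda>w. g u \<bullet> 0 + g' w \<bullet> v)) (at u)"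
    by (rule has_derivative_transform_within_open[OF _ U])
      (simp add: frechet_derivative_at[OF J, symmetric])
  then show ?thesis
    unfolding second_derivative_def by (simp add: frechet_derivative_at[symmetric])
qed

text \<open>The finite-dimensional core, free of the differential equation: the distance of the
  minimisers is controlled by the gradient error at the discrete minimiser, so every rate for the
  latter carries over.\<close>

lemma local_solution_error_estimate:
  fixes J :: "real^'l \<Rightarrow> real" and Jh :: "real \<Rightarrow> real^'l \<Rightarrow> real"
  assumes U: "open U" "Uad a b \<subseteq> U"
    and J: "\<And>u. u \<in> U \<Longrightarrow> (J has_derivative (\<lambda>v. g u \<bullet> v)) (at u)"
    and Jh: "\<And>h u. h \<in> H \<Longrightarrow> u \<in> U \<Longrightarrow> (Jh h has_derivative (\<lambda>v. gh h u \<bullet> v)) (at u)"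
    and g: "g differentiable (at ustar)"
    and loc: "local_solution J (Uad a b) ustar"
    and loch: "\<And>h. h \<in> H \<Longrightarrow> local_solution (Jh h) (Uad a b) (uh h)"
    and conv: "(uh \<longlongrightarrow> ustar) (at 0 within H)"
    and \<tau>: "\<tau> > 0" and \<nu>: "\<nu> > 0"
    and second_order: "\<And>v. (\<And>k. (ustar $ k = a $ k \<longrightarrow> v $ k \<ge> 0) \<and> (ustar $ k = b $ k \<longrightarrow> v $ k \<le> 0) \<and>
           (\<bar>g ustar $ k\<bar> > \<tau> \<longrightarrow> v $ k = 0)) \<Longrightarrow> second_derivative J ustar v v \<ge> \<nu> * (norm v)\<^sup>2"
    and consistent: "((\<lambda>h. g (uh h) - gh h (uh h)) \<longlongrightarrow> 0) (at 0 within H)"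
  shows "\<forall>\<^sub>F h in at 0 within H. norm (ustar - uh h) \<le> 2 / \<nu> * norm (g (uh h) - gh h (uh h))"
proof -
  have us: "ustar \<in> Uad a b" "ustar \<in> U" using loc U by (auto simp: local_solution_def)
  obtain g' where g': "(g has_derivative g') (at ustar)" using g by (auto simp: differentiable_def)
  have "isCont g ustar" using g' has_derivative_continuous by blast
  then have "((\<lambda>h. g (uh h)) \<longlongrightarrow> g ustar) (at 0 within H)" using conv by (rule isCont_tendsto_compose)
  from tendsto_diff[OF this consistent] have "((\<lambda>h. gh h (uh h)) \<longlongrightarrow> g ustar) (at 0 within H)" by simp
  then have close: "\<forall>\<^sub>F h in at 0 within H. dist (gh h (uh h)) (g ustar) < \<tau>" using \<tau> by (rule tendstoD)
  \<comment> \<open>Differentiability of the gradient at \<open>ustar\<close> with tolerance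
    \<open>\<nu> / 2\<close>: the linearisation error consumes half of the second-order
    constant.\<close>
  obtain d where d: "d > 0" "\<And>x. norm (x - ustar) < d \<Longrightarrow>
      norm (g x - g ustar - g' (x - ustar)) \<le> \<nu> / 2 * norm (x - ustar)"
    using g' \<nu> unfolding has_derivative_at_alt by (meson half_gt_zero)
  have near: "\<forall>\<^sub>F h in at 0 within H. dist (uh h) ustar < d" using conv d(1) by (rule tendstoD)
  have inH: "\<forall>\<^sub>F h in at 0 within H. h \<in> H" by (simp add: eventually_at_filter)
  from close near inH show ?thesis
  proof eventually_elim
    case (elim h)
    define v where "v = uh h - ustar"
    have uhU: "uh h \<in> Uad a b" "uh h \<in> U" using loch[OF elim(3)] U by (auto simp: local_solution_def)
    have cone: "(ustar $ k = a $ k \<longrightarrow> v $ k \<ge> 0) \<and> (ustar $ k = b $ k \<longrightarrow> v $ k \<le> 0) \<and>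
           (\<bar>g ustar $ k\<bar> > \<tau> \<longrightarrow> v $ k = 0)" for k
    proof (intro conjI impI)
      show "v $ k \<ge> 0" if "ustar $ k = a $ k" using that uhU by (auto simp: v_def mem_Uad)
      show "v $ k \<le> 0" if "ustar $ k = b $ k" using that uhU by (auto simp: v_def mem_Uad)
      assume big: "\<bar>g ustar $ k\<bar> > \<tau>"
      have "\<bar>(gh h (uh h) - g ustar) $ k\<bar> < \<tau>"
        using elim(1) component_le_norm_cart[of "gh h (uh h) - g ustar" k] by (simp add: dist_norm)
      \<comment> \<open>The discrete component differs from the continuous one by less than
        \<open>\<tau>\<close>, which is below its size. The signs agree, so both minimisers sit at
        the same bound.\<close>
      then have "(g ustar $ k > 0 \<and> gh h (uh h) $ k > 0) \<or> (g ustar $ k < 0 \<and> gh h (uh h) $ k < 0)"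
        using big \<tau> by (auto simp: abs_if split: if_splits)
      then show "v $ k = 0"
        using local_solution_active[OF loc J[OF us(2)], of k]
          local_solution_active[OF loch[OF elim(3)] Jh[OF elim(3) uhU(2)], of k]
        by (auto simp: v_def)
    qed
    have "\<nu> * (norm v)\<^sup>2 \<le> g' v \<bullet> v"
      using second_order[OF cone] second_derivative_of_gradient[OF U(1) us(2) J g'] by simp
    moreover have "- (\<nu> / 2 * (norm v)\<^sup>2) \<le> (g (uh h) - g ustar - g' v) \<bullet> v"
    proof -
      have "norm (g (uh h) - g ustar - g' v) \<le> \<nu> / 2 * norm v"
        using d(2)[of "uh h"] elim(2) by (simp add: v_def dist_norm)
      then have "norm (g (uh h) - g ustar - g' v) * norm v \<le> \<nu> / 2 * norm v * norm v"
        by (rule mult_right_mono) simp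
      then show ?thesis
        using Cauchy_Schwarz_ineq2[of "g (uh h) - g ustar - g' v" v] by (simp add: power2_eq_square)
    qed
    \<comment> \<open>Each first-order condition is used with the other minimiser as
      competitor.\<close>
    moreover have "0 \<le> g ustar \<bullet> v"
      using local_solution_variational_inequality[OF loc J[OF us(2)] uhU(1)] by (simp add: v_def)
    moreover have "0 \<le> gh h (uh h) \<bullet> (- v)"
      using local_solution_variational_inequality[OF loch[OF elim(3)] Jh[OF elim(3) uhU(2)] us(1)] by (simp add: v_def)
    ultimately have "\<nu> / 2 * (norm v)\<^sup>2 \<le> (g (uh h) - gh h (uh h)) \<bullet> v"
      by (simp add: inner_diff_left)
    also have "\<dots> \<le> norm (g (uh h) - gh h (uh h)) * norm v" by (rule norm_cauchy_schwarz)
    finally have "norm v * (\<nu> / 2 * norm v) \<le> norm v * norm (g (uh h) - gh h (uh h))"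
      by (simp add: power2_eq_square algebra_simps)
    then have "\<nu> / 2 * norm v \<le> norm (g (uh h) - gh h (uh h))"
      by (cases "v = 0") auto
    then show ?case using \<nu> by (simp add: v_def norm_minus_commute field_simps)
  qed
qed

section \<open>Square integrable functions as a Hilbert space\<close>

definition square_integrable :: "('a::euclidean_space \<Rightarrow> 'b::euclidean_space) \<Rightarrow> bool" where
  "square_integrable f \<longleftrightarrow> f \<in> borel_measurable lebesgue \<and> integrable lebesgue (\<lambda>x. (norm (f x))\<^sup>2)"

lemma square_integrable_measurable: "square_integrable f \<Longrightarrow> f \<in> borel_measurable lebesgue"
  by (simp add: square_integrable_def)

lemma square_integrable_dominated:
  assumes "f \<in> borel_measurable lebesgue" "integrable lebesgue g" "AE x in lebesgue. (norm (f x))\<^sup>2 \<le> g x"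
  shows "square_integrable f"
  unfolding square_integrable_def
proof
  show "integrable lebesgue (\<lambda>x. (norm (f x))\<^sup>2)"
  proof (rule Bochner_Integration.integrable_bound[OF assms(2)])
    show "(\<lambda>x. (norm (f x))\<^sup>2) \<in> borel_measurable lebesgue" using assms(1) by measurable
    show "AE x in lebesgue. norm ((norm (f x))\<^sup>2) \<le> norm (g x)"
      using assms(3) by eventually_elim simp
  qed
qed fact

lemma square_integrable_zero: "square_integrable (\<lambda>x. 0)"
  by (simp add: square_integrable_def)

lemma square_integrable_add:
  assumes "square_integrable f" "square_integrable g"
  shows "square_integrable (\<lambda>x. f x + g x)"
proof (rule square_integrable_dominated)
  show "integrable lebesgue (\<lambda>x. 2 * (norm (f x))\<^sup>2 + 2 * (norm (g x))\<^sup>2)"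
    using assms by (auto simp: square_integrable_def)
  have "(norm (x + y))\<^sup>2 \<le> 2 * (norm x)\<^sup>2 + 2 * (norm y)\<^sup>2" for x y :: 'b
  proof -
    have "(norm (x + y))\<^sup>2 \<le> (norm x + norm y)\<^sup>2" by (intro power_mono norm_triangle_ineq) simp
    also have "\<dots> \<le> 2 * (norm x)\<^sup>2 + 2 * (norm y)\<^sup>2"
      using sum_squares_bound[of "norm x" "norm y"] by (simp add: power2_sum)
    finally show ?thesis .
  qed
  then show "AE x in lebesgue. (norm (f x + g x))\<^sup>2 \<le> 2 * (norm (f x))\<^sup>2 + 2 * (norm (g x))\<^sup>2" by simp
qed (use assms in \<open>auto simp: square_integrable_def\<close>)

lemma square_integrable_scaleR: "square_integrable f \<Longrightarrow> square_integrable (\<lambda>x. r *\<^sub>R f x)"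
  by (auto simp: square_integrable_def power_mult_distrib)

lemma square_integrable_diff:
  "square_integrable f \<Longrightarrow> square_integrable g \<Longrightarrow> square_integrable (\<lambda>x. f x - g x)"
  using square_integrable_add[OF _ square_integrable_scaleR[of g "-1"]] by simp

lemma square_integrable_inner:
  assumes "square_integrable f" "square_integrable g"
  shows "integrable lebesgue (\<lambda>x. f x \<bullet> g x)"
proof (rule Bochner_Integration.integrable_bound)
  show "integrable lebesgue (\<lambda>x. (norm (f x))\<^sup>2 + (norm (g x))\<^sup>2)"
    using assms by (auto simp: square_integrable_def)
  have "norm (x \<bullet> y) \<le> norm ((norm x)\<^sup>2 + (norm y)\<^sup>2)" for x y :: 'b
    using Cauchy_Schwarz_ineq2[of x y] sum_squares_bound[of "norm x" "norm y"]
      mult_nonneg_nonneg[OF norm_ge_zero[of x] norm_ge_zero[of y]] by simp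
  then show "AE x in lebesgue. norm (f x \<bullet> g x) \<le> norm ((norm (f x))\<^sup>2 + (norm (g x))\<^sup>2)" by simp
qed (use assms in \<open>auto simp: square_integrable_def\<close>)

\<comment> \<open>A partial quotient: only square integrable functions have a class. The functions
  live on the whole space, and fields on a domain will enter through extension by zero.\<close>
quotient_type (overloaded) ('a, 'b) l2 = "'a::euclidean_space \<Rightarrow> 'b::euclidean_space" /
  partial: "\<lambda>f g. square_integrable f \<and> square_integrable g \<and> (AE x in lebesgue. f x = g x)"
  morphisms rep_l2 abs_l2
proof (rule part_equivpI)
  show "\<exists>f::'a \<Rightarrow> 'b. square_integrable f \<and> square_integrable f \<and> (AE x in lebesgue. f x = f x)"
    using square_integrable_zero by blast
  show "transp (\<lambda>(f::'a \<Rightarrow> 'b) g. square_integrable f \<and> square_integrable g \<and> (AE x in lebesgue. f x = g x))"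
    by (rule transpI) auto
  show "symp (\<lambda>(f::'a \<Rightarrow> 'b) g. square_integrable f \<and> square_integrable g \<and> (AE x in lebesgue. f x = g x))"
  proof (rule sympI)
    fix f g :: "'a \<Rightarrow> 'b"
    assume "square_integrable f \<and> square_integrable g \<and> (AE x in lebesgue. f x = g x)"
    moreover have "AE x in lebesgue. g x = f x" if "AE x in lebesgue. f x = g x"
      using that by eventually_elim simp
    ultimately show "square_integrable g \<and> square_integrable f \<and> (AE x in lebesgue. g x = f x)" by blast
  qed
qed

instantiation l2 :: (euclidean_space, euclidean_space) real_vector
begin

lift_definition zero_l2 :: "('a, 'b) l2" is "\<lambda>x. 0" by (simp add: square_integrable_zero)

lift_definition plus_l2 :: "('a, 'b) l2 \<Rightarrow> ('a, 'b) l2 \<Rightarrow> ('a, 'b) l2" is "\<lambda>f g x. f x + g x"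
  by (auto simp: square_integrable_add)

lift_definition minus_l2 :: "('a, 'b) l2 \<Rightarrow> ('a, 'b) l2 \<Rightarrow> ('a, 'b) l2" is "\<lambda>f g x. f x - g x"
  by (auto simp: square_integrable_diff)

lift_definition uminus_l2 :: "('a, 'b) l2 \<Rightarrow> ('a, 'b) l2" is "\<lambda>f x. - f x"
  using square_integrable_scaleR[of _ "-1"] by auto

lift_definition scaleR_l2 :: "real \<Rightarrow> ('a, 'b) l2 \<Rightarrow> ('a, 'b) l2" is "\<lambda>r f x. r *\<^sub>R f x"
  by (auto simp: square_integrable_scaleR)

instance
proof
  fix f g h :: "('a, 'b) l2" and r s :: real
  show "f + g + h = f + (g + h)" by transfer (auto simp: add.assoc square_integrable_add)
  show "f + g = g + f" by transfer (auto simp: add.commute square_integrable_add)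
  show "0 + f = f" by transfer auto
  show "- f + f = 0" by transfer (auto simp: square_integrable_zero)
  show "f - g = f + - g" by transfer (auto simp: square_integrable_diff)
  show "r *\<^sub>R (f + g) = r *\<^sub>R f + r *\<^sub>R g"
    by transfer (auto simp: scaleR_add_right square_integrable_add square_integrable_scaleR)
  show "(r + s) *\<^sub>R f = r *\<^sub>R f + s *\<^sub>R f"
    by transfer (auto simp: scaleR_add_left square_integrable_add square_integrable_scaleR)
  show "r *\<^sub>R s *\<^sub>R f = (r * s) *\<^sub>R f" by transfer (auto simp: square_integrable_scaleR)
  show "1 *\<^sub>R f = f" by transfer auto
qed

end

instantiation l2 :: (euclidean_space, euclidean_space) real_inner
begin

lift_definition inner_l2 :: "('a, 'b) l2 \<Rightarrow> ('a, 'b) l2 \<Rightarrow> real" is "\<lambda>f g. LINT x|lebesgue. f x \<bullet> g x"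
proof -
  fix f g f' g' :: "'a \<Rightarrow> 'b"
  assume "square_integrable f \<and> square_integrable f' \<and> (AE x in lebesgue. f x = f' x)"
    "square_integrable g \<and> square_integrable g' \<and> (AE x in lebesgue. g x = g' x)"
  then show "(LINT x|lebesgue. f x \<bullet> g x) = (LINT x|lebesgue. f' x \<bullet> g' x)"
    by (intro integral_cong_AE) (auto simp: square_integrable_def)
qed

definition norm_l2 :: "('a, 'b) l2 \<Rightarrow> real" where "norm_l2 f = sqrt (f \<bullet> f)"

definition sgn_l2 :: "('a, 'b) l2 \<Rightarrow> ('a, 'b) l2" where "sgn_l2 f = f /\<^sub>R norm f"

definition dist_l2 :: "('a, 'b) l2 \<Rightarrow> ('a, 'b) l2 \<Rightarrow> real" where "dist_l2 f g = norm (f - g)"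

definition uniformity_l2 :: "(('a, 'b) l2 \<times> ('a, 'b) l2) filter" where
  "uniformity_l2 = (INF e\<in>{0 <..}. principal {(f, g). dist f g < e})"

definition open_l2 :: "('a, 'b) l2 set \<Rightarrow> bool" where
  "open_l2 S = (\<forall>f\<in>S. \<forall>\<^sub>F (f', g) in uniformity. f' = f \<longrightarrow> g \<in> S)"

instance
proof
  fix f g h :: "('a, 'b) l2" and r :: real
  show "f \<bullet> g = g \<bullet> f" by transfer (simp add: inner_commute)
  show "(f + g) \<bullet> h = f \<bullet> h + g \<bullet> h"
    by transfer (simp add: inner_add_left Bochner_Integration.integral_add square_integrable_inner)
  show "(r *\<^sub>R f) \<bullet> g = r * (f \<bullet> g)" by transfer simp
  show "0 \<le> f \<bullet> f" by transfer simp
  show "f \<bullet> f = 0 \<longleftrightarrow> f = 0"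
  proof transfer
    fix f :: "'a \<Rightarrow> 'b"
    assume f: "square_integrable f \<and> square_integrable f \<and> (AE x in lebesgue. f x = f x)"
    then have "(LINT x|lebesgue. f x \<bullet> f x) = 0 \<longleftrightarrow> (AE x in lebesgue. f x \<bullet> f x = 0)"
      by (intro integral_nonneg_eq_0_iff_AE square_integrable_inner) auto
    then show "(LINT x|lebesgue. f x \<bullet> f x) = 0 \<longleftrightarrow>
        square_integrable f \<and> square_integrable (\<lambda>x. 0::'b) \<and> (AE x in lebesgue. f x = 0)"
      using f by (simp add: square_integrable_zero)
  qed
qed (simp_all add: norm_l2_def sgn_l2_def dist_l2_def uniformity_l2_def open_l2_def)

end

section \<open>Representatives and completeness of L^2\<close>

lemma square_integrable_rep: "square_integrable (rep_l2 X)"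
  using Quotient3_rep_reflp[OF Quotient3_l2] by blast

lemma abs_rep_l2: "abs_l2 (rep_l2 X) = X"
  using Quotient3_abs_rep[OF Quotient3_l2] .

lemma abs_l2_eq_iff:
  "square_integrable f \<Longrightarrow> square_integrable g \<Longrightarrow> abs_l2 f = abs_l2 g \<longleftrightarrow> (AE x in lebesgue. f x = g x)"
  using Quotient3_rel[OF Quotient3_l2, of f g] by auto

lemma rep_abs_l2: "square_integrable f \<Longrightarrow> AE x in lebesgue. rep_l2 (abs_l2 f) x = f x"
  using abs_l2_eq_iff[of "rep_l2 (abs_l2 f)" f] abs_rep_l2 square_integrable_rep by blast

lemma abs_l2_add:
  "square_integrable f \<Longrightarrow> square_integrable g \<Longrightarrow> abs_l2 (\<lambda>x. f x + g x) = abs_l2 f + abs_l2 g"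
  by (simp add: plus_l2.abs_eq)

lemma abs_l2_diff:
  "square_integrable f \<Longrightarrow> square_integrable g \<Longrightarrow> abs_l2 (\<lambda>x. f x - g x) = abs_l2 f - abs_l2 g"
  by (simp add: minus_l2.abs_eq)

lemma abs_l2_scaleR: "square_integrable f \<Longrightarrow> abs_l2 (\<lambda>x. r *\<^sub>R f x) = r *\<^sub>R abs_l2 f"
  by (simp add: scaleR_l2.abs_eq)

lemma abs_l2_inner:
  "square_integrable f \<Longrightarrow> square_integrable g \<Longrightarrow> abs_l2 f \<bullet> abs_l2 g = (LINT x|lebesgue. f x \<bullet> g x)"
  by (simp add: inner_l2.abs_eq)

lemma norm_abs_l2: "square_integrable f \<Longrightarrow> (norm (abs_l2 f))\<^sup>2 = (LINT x|lebesgue. (norm (f x))\<^sup>2)"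
  by (simp add: power2_norm_eq_inner abs_l2_inner)

lemma nn_integral_square_integrable:
  "square_integrable f \<Longrightarrow> (\<integral>\<^sup>+x. ennreal ((norm (f x))\<^sup>2) \<partial>lebesgue) = ennreal ((norm (abs_l2 f))\<^sup>2)"
  by (simp add: norm_abs_l2 square_integrable_def nn_integral_eq_integral)

text \<open>Finiteness bounds every term, so \<open>norm (d k)\<close> is at most a constant times
  \<open>(1/2) ^ k\<close>. The weight \<open>4 ^ k\<close> is mild enough that increments of norm
  below \<open>(1/4) ^ k\<close> keep the integrated series finite.\<close>

lemma summable_norm_of_weighted_squares:
  fixes d :: "nat \<Rightarrow> 'b::banach"
  assumes "(\<Sum>k. ennreal (4 ^ k * (norm (d k))\<^sup>2)) \<noteq> \<infinity>"
  shows "summable d"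
proof (rule summable_norm_cancel, rule summable_comparison_test')
  define C where "C = enn2real (\<Sum>k. ennreal (4 ^ k * (norm (d k))\<^sup>2))"
  have "norm (d k) \<le> sqrt C * (1/2) ^ k" for k
  proof -
    have "t k \<le> suminf t" for t :: "nat \<Rightarrow> ennreal"
      using sum_le_suminf[of t "{k}"] by simp
    then have "ennreal (4 ^ k * (norm (d k))\<^sup>2) \<le> (\<Sum>k. ennreal (4 ^ k * (norm (d k))\<^sup>2))" .
    also have "\<dots> = ennreal C" using assms by (simp add: C_def less_top)
    finally have "4 ^ k * (norm (d k))\<^sup>2 \<le> C"
      by (simp add: C_def)
    then have "sqrt (4 ^ k * (norm (d k))\<^sup>2) \<le> sqrt C" by simp
    moreover have "sqrt (4 ^ k * (norm (d k))\<^sup>2) = 2 ^ k * norm (d k)"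
      by (simp add: real_sqrt_mult real_sqrt_power)
    ultimately show ?thesis by (simp add: field_simps power_divide)
  qed
  then show "\<And>k. k \<ge> 0 \<Longrightarrow> norm (norm (d k)) \<le> sqrt C * (1/2) ^ k" by simp
  show "summable (\<lambda>k. sqrt C * (1/2::real) ^ k)" by (intro summable_mult summable_geometric) simp
qed

text \<open>Riesz--Fischer: a subsequence with geometrically decreasing increments converges almost
  everywhere, and by Fatou's lemma the pointwise limit is the limit in the mean.\<close>

instance l2 :: (euclidean_space, euclidean_space) complete_space
proof
  fix X :: "nat \<Rightarrow> ('a, 'b) l2" assume X: "Cauchy X"
  have "\<exists>N. \<forall>m\<ge>N. \<forall>n\<ge>N. norm (X m - X n) < (1/4) ^ k" for k
    using CauchyD[OF X, of "(1/4) ^ k"] by simp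
  then obtain N where N: "\<And>k m n. m \<ge> N k \<Longrightarrow> n \<ge> N k \<Longrightarrow> norm (X m - X n) < (1/4) ^ k" by metis
  \<comment> \<open>Adding all earlier thresholds makes \<open>r\<close> strictly increasing with
    \<open>r k\<close> at least \<open>N k\<close>.\<close>
  define r where "r k = k + (\<Sum>i\<le>k. N i)" for k
  have r: "strict_mono r" unfolding strict_mono_Suc_iff by (simp add: r_def)
  have rN: "r k \<ge> N k" for k
    using member_le_sum[of k "{..k}" N] by (simp add: r_def)
  have rmono: "k \<le> l \<Longrightarrow> r k \<le> r l" for k l using r strict_mono_less_eq by blast
  have incr: "norm (X (r l) - X (r k)) < (1/4) ^ k" if "k \<le> l" for k l
    using N[of k "r l" "r k"] rN[of k] rmono[OF that] by simp
  define f where "f k = rep_l2 (X (r k))" for k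
  have f: "square_integrable (f k)" for k by (simp add: f_def square_integrable_rep)
  have af: "abs_l2 (f k) = X (r k)" for k by (simp add: f_def abs_rep_l2)
  have fm [measurable]: "f k \<in> borel_measurable lebesgue" for k using f by (rule square_integrable_measurable)
  define d where "d k x = f (Suc k) x - f k x" for k x
  have d: "square_integrable (d k)" for k unfolding d_def by (intro square_integrable_diff f)
  have dm [measurable]: "d k \<in> borel_measurable lebesgue" for k using d by (rule square_integrable_measurable)
  have "(\<integral>\<^sup>+x. ennreal (4 ^ k * (norm (d k x))\<^sup>2) \<partial>lebesgue) \<le> ennreal ((1/4) ^ k)" for k
  proof -
    have "(\<integral>\<^sup>+x. ennreal (4 ^ k * (norm (d k x))\<^sup>2) \<partial>lebesgue) = ennreal (4 ^ k * (norm (X (r (Suc k)) - X (r k)))\<^sup>2)"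
    proof -
      have "abs_l2 (d k) = X (r (Suc k)) - X (r k)"
        unfolding d_def by (simp add: abs_l2_diff f af)
      then have "(\<integral>\<^sup>+x. ennreal ((norm (d k x))\<^sup>2) \<partial>lebesgue) = ennreal ((norm (X (r (Suc k)) - X (r k)))\<^sup>2)"
        using nn_integral_square_integrable[OF d, of k] by simp
      then show ?thesis by (simp add: ennreal_mult' nn_integral_cmult)
    qed
    also have "\<dots> \<le> ennreal (4 ^ k * ((1/4) ^ k)\<^sup>2)"
      using incr[of k "Suc k"] by (intro ennreal_leI mult_left_mono power_mono) auto
    also have "(4::real) ^ k * ((1/4) ^ k)\<^sup>2 = (1/4) ^ k"
      by (simp add: power2_eq_square power_divide)
    finally show ?thesis .
  qed
  then have "(\<Sum>k. \<integral>\<^sup>+x. ennreal (4 ^ k * (norm (d k x))\<^sup>2) \<partial>lebesgue) \<le> (\<Sum>k. ennreal ((1/4) ^ k))"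
    by (intro suminf_le) auto
  also have "\<dots> = ennreal (\<Sum>k. (1/4) ^ k)" by (intro suminf_ennreal2 summable_geometric) auto
  finally have "(\<integral>\<^sup>+x. (\<Sum>k. ennreal (4 ^ k * (norm (d k x))\<^sup>2)) \<partial>lebesgue) \<noteq> \<infinity>"
    by (subst nn_integral_suminf) (auto simp: top_unique)
  then have "AE x in lebesgue. (\<Sum>k. ennreal (4 ^ k * (norm (d k x))\<^sup>2)) \<noteq> \<infinity>"
    by (intro nn_integral_PInf_AE) auto
  then have conv: "AE x in lebesgue. convergent (\<lambda>k. f k x)"
  proof eventually_elim
    case (elim x)
    then have "summable (\<lambda>k. d k x)" by (rule summable_norm_of_weighted_squares)
    then have "convergent (\<lambda>n. \<Sum>k<n. d k x)" by (simp add: summable_iff_convergent)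
    moreover have "(\<Sum>k<n. d k x) = f n x - f 0 x" for n
      unfolding d_def by (rule sum_lessThan_telescope)
    ultimately have "convergent (\<lambda>n. f n x - f 0 x)" by simp
    then show ?case using convergent_add[OF _ convergent_const[of "f 0 x"]] by fastforce
  qed
  \<comment> \<open>Where the sequence diverges, \<open>lim\<close> has no meaning as a limit; by
    \<open>conv\<close> this is a null set.\<close>
  define F where "F x = lim (\<lambda>k. f k x)" for x
  have Fm [measurable]: "F \<in> borel_measurable lebesgue" unfolding F_def by measurable
  have fatou: "(\<integral>\<^sup>+x. ennreal ((norm (F x - f n x))\<^sup>2) \<partial>lebesgue) \<le> ennreal (((1/4) ^ n)\<^sup>2)" for n
  proof -
    have "(\<integral>\<^sup>+x. ennreal ((norm (F x - f n x))\<^sup>2) \<partial>lebesgue) = (\<integral>\<^sup>+x. liminf (\<lambda>k. ennreal ((norm (f k x - f n x))\<^sup>2)) \<partial>lebesgue)"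
    proof (rule nn_integral_cong_AE, use conv in eventually_elim)
      case (elim x)
      then have "(\<lambda>k. f k x) \<longlonglongrightarrow> F x" unfolding F_def using convergent_LIMSEQ_iff by blast
      then have "(\<lambda>k. ennreal ((norm (f k x - f n x))\<^sup>2)) \<longlonglongrightarrow> ennreal ((norm (F x - f n x))\<^sup>2)"
        by (intro tendsto_intros tendsto_ennrealI)
      then show ?case using lim_imp_Liminf[of sequentially] by fastforce
    qed
    also have "\<dots> \<le> liminf (\<lambda>k. \<integral>\<^sup>+x. ennreal ((norm (f k x - f n x))\<^sup>2) \<partial>lebesgue)"
      by (rule nn_integral_liminf) measurable
    also have "\<dots> \<le> ennreal (((1/4) ^ n)\<^sup>2)"
    proof (rule order_trans[OF Liminf_le_Limsup[OF sequentially_bot] Limsup_bounded[OF eventually_sequentiallyI]])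
      fix k assume "n \<le> k"
      have "(\<integral>\<^sup>+x. ennreal ((norm (f k x - f n x))\<^sup>2) \<partial>lebesgue) = ennreal ((norm (X (r k) - X (r n)))\<^sup>2)"
        using nn_integral_square_integrable[OF square_integrable_diff[OF f f], of k n]
        by (simp add: abs_l2_diff f af)
      also have "\<dots> \<le> ennreal (((1/4) ^ n)\<^sup>2)"
        using incr[OF \<open>n \<le> k\<close>] by (intro ennreal_leI power_mono) auto
      finally show "(\<integral>\<^sup>+x. ennreal ((norm (f k x - f n x))\<^sup>2) \<partial>lebesgue) \<le> ennreal (((1/4) ^ n)\<^sup>2)" .
    qed
    finally show ?thesis .
  qed
  have Fd: "square_integrable (\<lambda>x. F x - f n x)" for n
  proof -
    have "integrable lebesgue (\<lambda>x. (norm (F x - f n x))\<^sup>2)"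
      using le_less_trans[OF fatou[of n]] by (intro integrableI_bounded) auto
    then show ?thesis by (simp add: square_integrable_def)
  qed
  have F: "square_integrable F" using square_integrable_add[OF Fd f, of 0 0] by simp
  have "norm (abs_l2 F - X (r n)) \<le> (1/4) ^ n" for n
  proof -
    have "ennreal ((norm (abs_l2 F - X (r n)))\<^sup>2) \<le> ennreal (((1/4) ^ n)\<^sup>2)"
      using fatou[of n] nn_integral_square_integrable[OF Fd, of n] by (simp add: abs_l2_diff F f af)
    then have "(norm (abs_l2 F - X (r n)))\<^sup>2 \<le> ((1/4) ^ n)\<^sup>2" by simp
    then show ?thesis by (rule power2_le_imp_le) simp
  qed
  then have "(\<lambda>n. X (r n) - abs_l2 F) \<longlonglongrightarrow> 0"
    by (intro Lim_null_comparison[OF _ LIMSEQ_power_zero[of "1/4"]]) (auto simp: norm_minus_commute)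
  then have "(X \<circ> r) \<longlonglongrightarrow> abs_l2 F" using LIM_zero_cancel by (fastforce simp: o_def)
  then show "convergent X" using Cauchy_converges_subseq[OF X r] by (auto simp: convergent_def)
qed

section \<open>Test functions\<close>

lemma sigma_finite_completion:
  assumes "sigma_finite_measure M"
  shows "sigma_finite_measure (completion M)"
proof -
  interpret sigma_finite_measure M by fact
  obtain A where A: "countable A" "A \<subseteq> sets M" "\<Union>A = space M" "\<forall>a\<in>A. emeasure M a \<noteq> \<infinity>"
    using sigma_finite_countable by blast
  show ?thesis
    by standard (use A in \<open>auto intro!: exI[of _ A] sets_completionI_sets\<close>)
qed

text \<open>Boxes form an intersection-stable generator of the Borel sets, so the integral vanishes
  over every Borel set; \<open>h0\<close> serves the complements, since the whole space is not a
  box. Lebesgue sets differ from Borel sets by null sets.\<close>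

lemma AE_zero_of_box_integrals:
  fixes h :: "'a::euclidean_space \<Rightarrow> 'b::{banach, second_countable_topology}"
  assumes h: "integrable lebesgue h" and h0: "integral\<^sup>L lebesgue h = 0"
    and box: "\<And>a b. set_lebesgue_integral lebesgue (box a b) h = 0"
  shows "AE x in lebesgue. h x = 0"
proof (rule sigma_finite_measure.density_zero[OF sigma_finite_completion[OF sigma_finite_lborel] h])
  have si: "set_integrable lebesgue A h" if "A \<in> sets lebesgue" for A
    unfolding set_integrable_def using integrable_mult_indicator[OF that h] .
  have borel: "set_lebesgue_integral lebesgue A h = 0" if "A \<in> sets borel" for A
  proof -
    let ?E = "range (\<lambda>(a, b). box a b :: 'a set)"
    have "Int_stable ?E"
    proof (rule Int_stableI)
      fix X Y assume "X \<in> ?E" "Y \<in> ?E"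
      then obtain a b c d where "X = box a b" "Y = box c d" by auto
      then show "X \<inter> Y \<in> ?E" by (simp only: box_Int_box) (rule range_eqI[of _ _ "(_, _)"], simp)
    qed
    moreover have "?E \<subseteq> Pow UNIV" by auto
    moreover have "A \<in> sigma_sets UNIV ?E" using that by (simp add: borel_eq_box)
    ultimately show ?thesis
    proof (induction rule: sigma_sets_induct_disjoint)
      case (basic A)
      then show ?case using box by auto
    next
      case empty
      then show ?case by (simp add: set_lebesgue_integral_def)
    next
      case (compl A)
      then have "A \<in> sets borel" by (simp add: borel_eq_box)
      then have A: "A \<in> sets lebesgue" using sets_completionI_sets[of A lborel] by simp
      have "set_lebesgue_integral lebesgue (UNIV - A) h = (LINT x|lebesgue. h x - indicator A x *\<^sub>R h x)"
        unfolding set_lebesgue_integral_def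
        by (rule Bochner_Integration.integral_cong) (auto simp: indicator_def)
      also have "\<dots> = 0"
        using compl.IH h0 si[OF A] h by (simp add: set_lebesgue_integral_def set_integrable_def)
      finally show ?case .
    next
      case (union F)
      then have "F i \<in> sets borel" for i by (auto simp: borel_eq_box)
      then have F: "F i \<in> sets lebesgue" for i using sets_completionI_sets[of "F i" lborel] by simp
      have "set_lebesgue_integral lebesgue (\<Union>(range F)) h = (\<Sum>i. set_lebesgue_integral lebesgue (F i) h)"
        using union(1) F by (intro lebesgue_integral_countable_add si) (auto simp: disjoint_family_on_def)
      then show ?case using union.IH by simp
    qed
  qed
  fix A :: "'a set" assume A: "A \<in> sets lebesgue"
  obtain N where N: "N \<in> null_sets lborel" "null_part lborel A \<subseteq> N" using null_part[OF A] by auto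
  then have "N \<in> null_sets lebesgue" by (simp add: null_sets_completionI)
  then have ae: "AE x in lebesgue. x \<notin> N" by (rule AE_not_in)
  have "set_lebesgue_integral lebesgue A h = set_lebesgue_integral lebesgue (main_part lborel A) h"
    unfolding set_lebesgue_integral_def
  proof (rule integral_cong_AE)
    show "(\<lambda>x. indicat_real A x *\<^sub>R h x) \<in> borel_measurable lebesgue" using si[OF A] by (auto simp: set_integrable_def)
    show "(\<lambda>x. indicat_real (main_part lborel A) x *\<^sub>R h x) \<in> borel_measurable lebesgue"
      using si[OF sets_completionI_sets[OF main_part_sets[OF A]]] by (auto simp: set_integrable_def)
    show "AE x in lebesgue. indicat_real A x *\<^sub>R h x = indicat_real (main_part lborel A) x *\<^sub>R h x"
      using ae
    proof eventually_elim
      case (elim x)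
      then have "x \<in> A \<longleftrightarrow> x \<in> main_part lborel A" using main_part_null_part_Un[OF A] N(2) by blast
      then show ?case by (simp add: indicator_def)
    qed
  qed
  also have "\<dots> = 0" using borel main_part_sets[OF A] by simp
  finally show "set_lebesgue_integral lebesgue A h = 0" .
qed

text \<open>Cover \<open>\<Omega>\<close> by countably many closed boxes and cut \<open>g\<close>
  off to the interior of each. Two open boxes meet in a box whose closure again lies in
  \<open>\<Omega>\<close>, so the cut-off function has vanishing integrals over all boxes.\<close>

lemma AE_zero_of_box_integrals_on:
  fixes g :: "'a::euclidean_space \<Rightarrow> 'b::{banach, second_countable_topology}"
  assumes \<Omega>: "open \<Omega>" and g: "integrable (lebesgue_on \<Omega>) g"
    and box: "\<And>a b. cbox a b \<subseteq> \<Omega> \<Longrightarrow> set_lebesgue_integral lebesgue (box a b) g = 0"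
  shows "AE x in lebesgue_on \<Omega>. g x = 0"
proof -
  have \<Omega>l: "\<Omega> \<in> sets lebesgue" using sets_completionI_sets[of \<Omega> lborel] \<Omega> by simp
  obtain \<D> where \<D>: "countable \<D>" "\<D> \<subseteq> Pow \<Omega>" "\<And>X. X \<in> \<D> \<Longrightarrow> \<exists>a b. X = cbox a b" "\<Union>\<D> = \<Omega>"
    using open_countable_Union_open_cbox[OF \<Omega>] by metis
  have "AE x in lebesgue. x \<in> X \<longrightarrow> g x = 0" if X: "X \<in> \<D>" for X
  proof -
    obtain a b where ab: "X = cbox a b" "cbox a b \<subseteq> \<Omega>" using \<D>(2,3) X by blast
    define h where "h x = indicator (box a b) x *\<^sub>R g x" for x
    have bs: "box a b \<subseteq> \<Omega>" using ab box_subset_cbox by blast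
    have h: "integrable lebesgue h"
    proof -
      have "integrable lebesgue (\<lambda>x. indicator (box a b) x *\<^sub>R (indicator \<Omega> x *\<^sub>R g x))"
        by (rule integrable_mult_indicator) (use g \<Omega>l in \<open>auto simp: integrable_restrict_space\<close>)
      also have "(\<lambda>x. indicator (box a b) x *\<^sub>R (indicator \<Omega> x *\<^sub>R g x)) = h"
        using bs by (auto simp: h_def indicator_def fun_eq_iff)
      finally show ?thesis .
    qed
    have "AE x in lebesgue. h x = 0"
    proof (rule AE_zero_of_box_integrals[OF h])
      show "integral\<^sup>L lebesgue h = 0" using box[OF ab(2)] by (simp add: h_def[abs_def] set_lebesgue_integral_def)
      fix c d
      obtain e f where ef: "box a b \<inter> box c d = box e f" using box_Int_box by blast
      have "set_lebesgue_integral lebesgue (box c d) h = set_lebesgue_integral lebesgue (box e f) g"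
        unfolding set_lebesgue_integral_def h_def ef[symmetric]
        by (rule Bochner_Integration.integral_cong) (auto simp: indicator_def)
      also have "\<dots> = 0"
      proof (cases "box e f = {}")
        case False
        then have "cbox e f \<subseteq> cbox a b" using ef by (metis closure_box closure_mono inf_le1 box_eq_empty(1) Int_empty_left)
        then show ?thesis using box ab(2) by blast
      qed (simp add: set_lebesgue_integral_def)
      finally show "set_lebesgue_integral lebesgue (box c d) h = 0" .
    qed
    moreover have "AE x in lebesgue. x \<notin> cbox a b - box a b"
      by (rule AE_not_in) (simp add: negligible_iff_null_sets[symmetric] negligible_frontier_interval)
    ultimately show ?thesis
      by eventually_elim (auto simp: h_def ab)
  qed
  then have "AE x in lebesgue. \<forall>X\<in>\<D>. x \<in> X \<longrightarrow> g x = 0"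
    by (subst AE_ball_countable[OF \<D>(1)]) blast
  then have "AE x in lebesgue. x \<in> \<Omega> \<longrightarrow> g x = 0"
    by eventually_elim (use \<D>(4) in blast)
  then show ?thesis using \<Omega>l by (simp add: AE_restrict_space_iff)
qed

text \<open>The classical flat function \<open>exp (- (1 / t))\<close>, extended by zero. The
  polynomial factors in \<open>1 / t\<close> make the family closed under differentiation, which
  gives smoothness without formulas for higher derivatives.\<close>

definition flat :: "real poly \<Rightarrow> real \<Rightarrow> real" where
  "flat p t = (if t > 0 then poly p (1 / t) * exp (- (1 / t)) else 0)"

lemma flat_tendsto_zero: "(flat p \<longlongrightarrow> 0) (at 0)"
proof -
  have l: "((\<lambda>x. poly p x * exp (- x)) \<longlongrightarrow> 0) at_top"
  proof -
    have "((\<lambda>x. \<Sum>i\<le>degree p. coeff p i * (x ^ i / exp x)) \<longlongrightarrow> (\<Sum>i\<le>degree p. coeff p i * 0)) at_top"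
      by (intro tendsto_sum tendsto_mult tendsto_const tendsto_power_div_exp_0)
    then show ?thesis
      by (simp add: poly_altdef sum_distrib_right exp_minus divide_inverse mult.assoc)
  qed
  have "(flat p \<longlongrightarrow> 0) (at_right 0)"
    unfolding filterlim_at_right_to_top
    by (rule Lim_transform_eventually[OF l])
      (use eventually_gt_at_top[of 0] in eventually_elim, simp add: flat_def inverse_eq_divide)
  moreover have "(flat p \<longlongrightarrow> 0) (at_left 0)"
    by (rule Lim_transform_eventually[OF tendsto_const[of 0]])
      (simp add: eventually_at_filter flat_def)
  ultimately show ?thesis by (simp add: filterlim_split_at)
qed

text \<open>For \<open>t > 0\<close> the chain rule produces the factor
  \<open>1 / t\<^sup>2\<close>, that is, the square \<open>monom 1 2\<close> of the indeterminate,
  and the exponential and the polynomial contribute \<open>p\<close> and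
  \<open>- pderiv p\<close>.\<close>

lemma flat_has_derivative:
  "(flat p has_real_derivative flat (monom 1 2 * (p - pderiv p)) t) (at t)"
proof -
  consider "t > 0" | "t < 0" | "t = 0" by linarith
  then show ?thesis
  proof cases
    case 1
    have "((\<lambda>t. poly p (1 / t) * exp (- (1 / t))) has_real_derivative flat (monom 1 2 * (p - pderiv p)) t) (at t)"
      using 1 by (auto intro!: derivative_eq_intros DERIV_chain2[OF poly_DERIV]
          simp: flat_def poly_monom power2_eq_square field_simps)
    then show ?thesis
      by (rule has_field_derivative_transform_within_open[of _ _ _ "{0<..}"]) (use 1 in \<open>auto simp: flat_def\<close>)
  next
    case 2
    have "((\<lambda>t. 0) has_real_derivative flat (monom 1 2 * (p - pderiv p)) t) (at t)"
      using 2 by (simp add: flat_def)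
    then show ?thesis
      by (rule has_field_derivative_transform_within_open[of _ _ _ "{..<0}"]) (use 2 in \<open>auto simp: flat_def\<close>)
  next
    case 3
    \<comment> \<open>The difference quotient at 0 is itself flat: dividing by \<open>h\<close>
      multiplies the polynomial by the indeterminate, which is \<open>pCons 0 p\<close>.\<close>
    have "((\<lambda>h. (flat p (0 + h) - flat p 0) / h) \<longlongrightarrow> 0) (at 0)"
      by (rule Lim_transform_eventually[OF flat_tendsto_zero[of "pCons 0 p"]])
        (simp add: eventually_at_filter flat_def)
    then show ?thesis by (simp add: 3 DERIV_def flat_def)
  qed
qed

lemma flat_one_bounds: "0 \<le> flat 1 t" "flat 1 t \<le> 1"
  by (simp_all add: flat_def)

lemma flat_one_eq_0_iff: "flat 1 t = 0 \<longleftrightarrow> t \<le> 0"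
  by (simp add: flat_def)

lemma flat_one_tendsto: "(\<lambda>n. flat 1 (real (Suc n) * t)) \<longlonglongrightarrow> (if t > 0 then 1 else 0)"
proof (cases "t > 0")
  case True
  have "(\<lambda>n. exp (- (inverse (real (Suc n)) * (1 / t)))) \<longlonglongrightarrow> exp (- (0 * (1 / t)))"
    by (intro tendsto_intros LIMSEQ_inverse_real_of_nat)
  moreover have "flat 1 (real (Suc n) * t) = exp (- (inverse (real (Suc n)) * (1 / t)))" for n
    using True zero_less_mult_iff[of "real (Suc n)" t] by (simp add: flat_def inverse_eq_divide del: of_nat_Suc)
  ultimately show ?thesis using True by simp
qed (simp add: flat_def mult_nonneg_nonpos not_less zero_less_mult_iff)

text \<open>A class of functions containing enough bumps and closed under partial derivatives, so that
  its members are smooth.\<close>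

inductive flat_generated :: "(real^3 \<Rightarrow> real) \<Rightarrow> bool" where
  const: "flat_generated (\<lambda>x. r)"
| flat: "flat_generated (\<lambda>x. flat p (r + s * x $ i))"
| add: "flat_generated \<phi> \<Longrightarrow> flat_generated \<psi> \<Longrightarrow> flat_generated (\<lambda>x. \<phi> x + \<psi> x)"
| mult: "flat_generated \<phi> \<Longrightarrow> flat_generated \<psi> \<Longrightarrow> flat_generated (\<lambda>x. \<phi> x * \<psi> x)"

lemma flat_generated_prod:
  "finite A \<Longrightarrow> (\<And>i. i \<in> A \<Longrightarrow> flat_generated (\<phi> i)) \<Longrightarrow> flat_generated (\<lambda>x. \<Prod>i\<in>A. \<phi> i x)"
  by (induction A rule: finite_induct) (auto intro: flat_generated.intros)

lemma flat_generated_derivative: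
  assumes "flat_generated \<phi>"
  shows "\<exists>D. (\<forall>i. flat_generated (D i)) \<and> (\<forall>x. (\<phi> has_derivative (\<lambda>v. \<Sum>i\<in>UNIV. v $ i * D i x)) (at x))"
  using assms
proof induction
  case (const r)
  show ?case by (rule exI[of _ "\<lambda>i x. 0"]) (auto intro: flat_generated.const)
next
  case (flat p r s i)
  let ?q = "monom 1 2 * (p - pderiv p)"
  have "((\<lambda>x. flat p (r + s * x $ i)) has_derivative
      (\<lambda>v. \<Sum>j\<in>UNIV. v $ j * (if j = i then s * flat ?q (r + s * x $ i) else 0))) (at x)" for x
  proof -
    have 1: "((\<lambda>x. r + s * x $ i) has_derivative (\<lambda>v. s * v $ i)) (at x)"
      by (auto intro!: derivative_eq_intros bounded_linear.has_derivative[OF bounded_linear_vec_nth])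
    have "((\<lambda>x. flat p (r + s * x $ i)) has_derivative (\<lambda>v. (s * v $ i) * flat ?q (r + s * x $ i))) (at x)"
      using has_derivative_compose[OF 1, of "flat p" "\<lambda>t. t * flat ?q (r + s * x $ i)"]
        flat_has_derivative[of p "r + s * x $ i"]
      by (simp add: has_field_derivative_def mult.commute[of _ "flat ?q _"])
    moreover have "(s * v $ i) * flat ?q (r + s * x $ i) =
        (\<Sum>j\<in>UNIV. v $ j * (if j = i then s * flat ?q (r + s * x $ i) else 0))" for v
      by (simp add: if_distrib[where f = "\<lambda>t. _ * t"] cong: if_cong)
    ultimately show ?thesis by simp
  qed
  moreover have "flat_generated (\<lambda>x. if j = i then s * flat ?q (r + s * x $ i) else 0)" for j
    by (cases "j = i") (auto intro!: flat_generated.intros flat_generated.mult[OF flat_generated.const])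
  ultimately show ?case by (intro exI[of _ "\<lambda>j x. if j = i then s * flat ?q (r + s * x $ i) else 0"]) blast
next
  case (add \<phi> \<psi>)
  from add.IH(1) obtain D where D: "\<And>i. flat_generated (D i)" "\<And>x. (\<phi> has_derivative (\<lambda>v. \<Sum>i\<in>UNIV. v $ i * D i x)) (at x)"
    by blast
  from add.IH(2) obtain E where E: "\<And>i. flat_generated (E i)" "\<And>x. (\<psi> has_derivative (\<lambda>v. \<Sum>i\<in>UNIV. v $ i * E i x)) (at x)"
    by blast
  have "((\<lambda>x. \<phi> x + \<psi> x) has_derivative (\<lambda>v. \<Sum>i\<in>UNIV. v $ i * (D i x + E i x))) (at x)" for x
    using has_derivative_add[OF D(2) E(2)] by (simp add: distrib_left sum.distrib)
  then show ?case using D(1) E(1)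
    by (intro exI[of _ "\<lambda>i x. D i x + E i x"] conjI allI) (auto intro: flat_generated.add)
next
  case (mult \<phi> \<psi>)
  from mult.IH(1) obtain D where D: "\<And>i. flat_generated (D i)" "\<And>x. (\<phi> has_derivative (\<lambda>v. \<Sum>i\<in>UNIV. v $ i * D i x)) (at x)"
    by blast
  from mult.IH(2) obtain E where E: "\<And>i. flat_generated (E i)" "\<And>x. (\<psi> has_derivative (\<lambda>v. \<Sum>i\<in>UNIV. v $ i * E i x)) (at x)"
    by blast
  have "((\<lambda>x. \<phi> x * \<psi> x) has_derivative (\<lambda>v. \<Sum>i\<in>UNIV. v $ i * (\<phi> x * E i x + D i x * \<psi> x))) (at x)" for x
  proof (rule has_derivative_eq_rhs[OF has_derivative_mult[OF D(2) E(2)]], rule ext)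
    fix v
    have "\<phi> x * (\<Sum>i\<in>UNIV. v $ i * E i x) = (\<Sum>i\<in>UNIV. v $ i * (\<phi> x * E i x))"
      unfolding sum_distrib_left by (rule sum.cong) (auto simp: algebra_simps)
    moreover have "(\<Sum>i\<in>UNIV. v $ i * D i x) * \<psi> x = (\<Sum>i\<in>UNIV. v $ i * (D i x * \<psi> x))"
      unfolding sum_distrib_right by (rule sum.cong) (auto simp: algebra_simps)
    ultimately show "\<phi> x * (\<Sum>i\<in>UNIV. v $ i * E i x) + (\<Sum>i\<in>UNIV. v $ i * D i x) * \<psi> x =
        (\<Sum>i\<in>UNIV. v $ i * (\<phi> x * E i x + D i x * \<psi> x))"
      by (simp add: distrib_left sum.distrib)
  qed
  then show ?case using D(1) E(1) mult.hyps
    by (intro exI[of _ "\<lambda>i x. \<phi> x * E i x + D i x * \<psi> x"] conjI allI flat_generated.add flat_generated.mult)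
qed

lemma flat_generated_continuous:
  assumes "flat_generated \<phi>"
  shows "continuous_on UNIV \<phi>"
proof -
  from flat_generated_derivative[OF assms] obtain D where
    "\<And>x. (\<phi> has_derivative (\<lambda>v. \<Sum>i\<in>UNIV. v $ i * D i x)) (at x)" by blast
  then show ?thesis by (rule has_derivative_continuous_on)
qed

lemma flat_generated_smooth:
  fixes v :: "'b::real_normed_vector"
  assumes "flat_generated \<phi>"
  shows "smooth (\<lambda>x. \<phi> x *\<^sub>R v)"
proof -
  have "Ck k (\<lambda>x. \<phi> x *\<^sub>R v)" for k
    using assms
  proof (induction k arbitrary: \<phi>)
    case 0
    then show ?case by (auto intro!: continuous_intros flat_generated_continuous)
  next
    case (Suc k)
    from flat_generated_derivative[OF Suc.prems] obtain D where
      D: "\<And>i. flat_generated (D i)" "\<And>x. (\<phi> has_derivative (\<lambda>v. \<Sum>i\<in>UNIV. v $ i * D i x)) (at x)" by blast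
    have d: "((\<lambda>x. \<phi> x *\<^sub>R v) has_derivative (\<lambda>w. (\<Sum>i\<in>UNIV. w $ i * D i x) *\<^sub>R v)) (at x)" for x
      using has_derivative_scaleR[OF D(2)[of x] has_derivative_const[of v]] by simp
    have fd: "frechet_derivative (\<lambda>x. \<phi> x *\<^sub>R v) (at x) = (\<lambda>w. (\<Sum>i\<in>UNIV. w $ i * D i x) *\<^sub>R v)" for x
      by (rule frechet_derivative_at[OF d, symmetric])
    have "pd i (\<lambda>x. \<phi> x *\<^sub>R v) = (\<lambda>x. D i x *\<^sub>R v)" for i
      by (simp add: fun_eq_iff pd_def fd axis_def if_distrib[where f = "\<lambda>t. t * _"] cong: if_cong)
    moreover have "(\<lambda>x. \<phi> x *\<^sub>R v) differentiable_on UNIV"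
      using d by (auto simp: differentiable_on_def differentiable_def)
    ultimately show ?case using Suc.IH[OF D(1)] by simp
  qed
  then show ?thesis by (simp add: smooth_def)
qed

text \<open>Products over the coordinates of one-sided flat functions. Scaling by
  \<open>Suc n\<close> sharpens them towards the indicator, while the set where they are nonzero
  remains the open box, so all supports lie in \<open>cbox a b\<close>. The vector \<open>v\<close>
  permits tests in any direction.\<close>

lemma smooth_box_approximation:
  assumes ne: "box a b \<noteq> {}" and sub: "cbox a b \<subseteq> \<Omega>"
  obtains \<phi> :: "nat \<Rightarrow> real^3 \<Rightarrow> real"
  where "\<And>n v::'b::real_normed_vector. test_function \<Omega> (\<lambda>x. \<phi> n x *\<^sub>R v)"
    "\<And>n x. \<bar>\<phi> n x\<bar> \<le> 1" "\<And>x. (\<lambda>n. \<phi> n x) \<longlonglongrightarrow> indicator (box a b) x" "\<And>n. \<phi> n \<in> borel_measurable borel"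
proof -
  define \<phi> where "\<phi> n x = (\<Prod>i\<in>UNIV. flat 1 (real (Suc n) * (x $ i - a $ i)) * flat 1 (real (Suc n) * (b $ i - x $ i)))" for n x
  have gen: "flat_generated (\<phi> n)" for n
    unfolding \<phi>_def
  proof (intro flat_generated_prod flat_generated.mult)
    fix i :: 3
    show "flat_generated (\<lambda>x. flat 1 (real (Suc n) * (x $ i - a $ i)))"
      using flat_generated.flat[of 1 "- (real (Suc n) * a $ i)" "real (Suc n)" i] by (simp add: algebra_simps)
    show "flat_generated (\<lambda>x. flat 1 (real (Suc n) * (b $ i - x $ i)))"
      using flat_generated.flat[of 1 "real (Suc n) * b $ i" "- real (Suc n)" i] by (simp add: algebra_simps)
  qed simp
  have mem: "x \<in> box a b \<longleftrightarrow> (\<forall>i. 0 < x $ i - a $ i \<and> 0 < b $ i - x $ i)" for x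
    by (simp add: mem_box_cart)
  have supp: "{x. \<phi> n x \<noteq> 0} = box a b" for n
    by (auto simp: \<phi>_def flat_one_eq_0_iff mem not_le zero_less_mult_iff prod_zero_iff)
  have "test_function \<Omega> (\<lambda>x. \<phi> n x *\<^sub>R v)" for n and v :: 'b
  proof -
    have "{x. \<phi> n x *\<^sub>R v \<noteq> 0} \<subseteq> box a b" using supp[of n] by auto
    then have "closure {x. \<phi> n x *\<^sub>R v \<noteq> 0} \<subseteq> cbox a b" using closure_box[OF ne] closure_mono by metis
    then show ?thesis using sub flat_generated_smooth[OF gen]
      using \<open>{x. \<phi> n x *\<^sub>R v \<noteq> 0} \<subseteq> box a b\<close> bounded_subset[OF bounded_box]
      by (auto simp: test_function_def compact_closure simp del: scaleR_eq_0_iff)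
  qed
  moreover have "\<bar>\<phi> n x\<bar> \<le> 1" for n x
    unfolding \<phi>_def abs_prod
    by (rule prod_le_1) (auto simp: abs_mult flat_one_bounds intro!: mult_le_one)
  moreover have "(\<lambda>n. \<phi> n x) \<longlonglongrightarrow> indicator (box a b) x" for x
  proof -
    have "(\<lambda>n. \<phi> n x) \<longlonglongrightarrow> (\<Prod>i\<in>UNIV. (if x $ i - a $ i > 0 then 1 else 0) * (if b $ i - x $ i > 0 then 1 else 0))"
      unfolding \<phi>_def by (intro tendsto_prod tendsto_mult flat_one_tendsto)
    also have "(\<Prod>i\<in>UNIV. (if x $ i - a $ i > 0 then 1 else 0) * (if b $ i - x $ i > 0 then 1 else 0)) = (indicator (box a b) x :: real)"
    proof (cases "x \<in> box a b")
      case True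
      then show ?thesis by (simp add: mem)
    next
      case False
      then obtain i where "\<not> (0 < x $ i - a $ i \<and> 0 < b $ i - x $ i)" by (auto simp: mem)
      then show ?thesis using False by (auto simp: prod_zero_iff intro!: exI[of _ i])
    qed
    finally show ?thesis .
  qed
  moreover have "\<phi> n \<in> borel_measurable borel" for n
    by (intro borel_measurable_continuous_onI flat_generated_continuous gen)
  ultimately show thesis using that by blast
qed

section \<open>Complex vector fields\<close>

lemma vcnj_add: "vcnj (v + w) = vcnj v + vcnj w"
  by (simp add: vcnj_def vec_eq_iff)

lemma vcnj_scaleR: "vcnj (r *\<^sub>R v) = r *\<^sub>R vcnj v"
  by (simp add: vcnj_def vec_eq_iff)

lemma vcnj_mult: "vcnj (c *s v) = cnj c *s vcnj v"
  by (simp add: vcnj_def vec_eq_iff)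

lemma vcnj_vcnj: "vcnj (vcnj v) = v"
  by (simp add: vcnj_def vec_eq_iff)

lemma norm_vcnj: "norm (vcnj v) = norm v"
  by (simp add: vcnj_def norm_vec_def L2_set_def)

lemma norm_cmult: "norm (c *s v) = norm c * norm (v :: complex^3)"
  by (simp add: norm_vec_def L2_set_def norm_mult power_mult_distrib real_sqrt_mult flip: sum_distrib_left)

lemma cmult_scaleR: "c *s (r *\<^sub>R v) = r *\<^sub>R (c *s (v :: complex^3))"
  by (simp add: vec_eq_iff)

lemma cmult_of_real: "complex_of_real r *s v = r *\<^sub>R v"
  by (simp add: vec_eq_iff complex_eq_iff)

lemma cdot_commute: "cdot v w = cdot w v"
  by (simp add: cdot_def mult.commute)

lemma cdot_mult_left: "cdot (c *s v) w = c * cdot v w"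
  by (simp add: cdot_def sum_distrib_left mult.assoc)

lemma cdot_add_left: "cdot (v + w) z = cdot v z + cdot w z"
  by (simp add: cdot_def distrib_right sum.distrib)

lemma cdot_diff_left: "cdot (v - w) z = cdot v z - cdot w z"
  by (simp add: cdot_def left_diff_distrib sum_subtractf)

lemma cdot_scaleR_left: "cdot (r *\<^sub>R v) w = r *\<^sub>R cdot v w"
  by (simp add: cdot_def scaleR_sum_right)

lemma cdot_zero_left: "cdot 0 w = 0"
  by (simp add: cdot_def)

lemma cdot_vcnj: "cdot (vcnj v) w = cnj (cdot v (vcnj w))"
  by (simp add: cdot_def vcnj_def)

text \<open>\<open>cdot\<close> is bilinear, so one factor has to be conjugated to reach the real
  inner product; this explains the conjugation built into \<open>conj_mult\<close>.\<close>

lemma inner_eq_Re_cdot: "v \<bullet> w = Re (cdot (vcnj v) w)"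
  by (simp add: cdot_def vcnj_def inner_vec_def inner_complex_def Re_sum)

text \<open>Rotating \<open>v\<close> by a unit phase \<open>c\<close> makes the value real and
  nonnegative. Then the real Cauchy-Schwarz inequality applies, and the phase does not change the
  norm.\<close>

lemma norm_cdot_le: "norm (cdot v w) \<le> norm v * norm w"
proof (cases "cdot v w = 0")
  case False
  define c where "c = cnj (sgn (cdot v w))"
  have "c * cdot v w = of_real (norm (cdot v w))"
    using False by (simp add: c_def sgn_eq complex_norm_square[symmetric] field_simps power2_eq_square)
  then have "norm (cdot v w) = Re (cdot (c *s v) w)" by (simp add: cdot_mult_left)
  also have "\<dots> = vcnj (c *s v) \<bullet> w" by (simp add: inner_eq_Re_cdot vcnj_vcnj)
  also have "\<dots> \<le> norm (vcnj (c *s v)) * norm w" by (rule norm_cauchy_schwarz)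
  also have "norm (vcnj (c *s v)) = norm v"
    using False by (simp add: norm_vcnj norm_cmult c_def norm_sgn)
  finally show ?thesis .
qed simp

lemma continuous_on_cmult [continuous_intros]:
  "continuous_on S f \<Longrightarrow> continuous_on S g \<Longrightarrow> continuous_on S (\<lambda>x. f x *s (g x :: complex^3))"
  unfolding vector_scalar_mult_def by (intro continuous_intros)

lemma continuous_on_vcnj [continuous_intros]:
  "continuous_on S f \<Longrightarrow> continuous_on S (\<lambda>x. vcnj (f x))"
  unfolding vcnj_def by (intro continuous_intros)

lemma continuous_on_cdot [continuous_intros]:
  "continuous_on S f \<Longrightarrow> continuous_on S g \<Longrightarrow> continuous_on S (\<lambda>x. cdot (f x) (g x))"
  unfolding cdot_def by (intro continuous_intros)

lemma borel_measurable_cmult [measurable]: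
  assumes [measurable]: "f \<in> borel_measurable M" "g \<in> borel_measurable M"
  shows "(\<lambda>x. f x *s (g x :: complex^3)) \<in> borel_measurable M"
  by (rule borel_measurable_continuous_Pair[OF assms]) (intro continuous_intros)

lemma borel_measurable_vcnj [measurable]:
  assumes [measurable]: "f \<in> borel_measurable M"
  shows "(\<lambda>x. vcnj (f x)) \<in> borel_measurable M"
  by (rule borel_measurable_continuous_on[OF _ assms]) (intro continuous_intros)

lemma borel_measurable_cdot [measurable]:
  assumes [measurable]: "f \<in> borel_measurable M" "g \<in> borel_measurable M"
  shows "(\<lambda>x. cdot (f x) (g x)) \<in> borel_measurable M"
  by (rule borel_measurable_continuous_Pair[OF assms]) (intro continuous_intros)

section \<open>Square integrable fields on a domain and multiplication operators\<close>

lemma L2_measurable: "v \<in> L2 \<Omega> \<Longrightarrow> v \<in> borel_measurable (lebesgue_on \<Omega>)"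
  by (simp add: L2_def)

lemma L2_iff_square_integrable:
  assumes "\<Omega> \<in> sets lebesgue"
  shows "v \<in> L2 \<Omega> \<longleftrightarrow> square_integrable (\<lambda>x. indicator \<Omega> x *\<^sub>R v x)"
proof -
  have "(norm (indicat_real \<Omega> x *\<^sub>R v x))\<^sup>2 = indicat_real \<Omega> x *\<^sub>R (norm (v x))\<^sup>2" for x
    by (simp add: indicator_def)
  then show ?thesis
    using assms by (simp add: L2_def square_integrable_def integrable_restrict_space borel_measurable_restrict_space_iff)
qed

lemma L2_dominated:
  assumes "\<Omega> \<in> sets lebesgue" "w \<in> borel_measurable (lebesgue_on \<Omega>)" "v \<in> L2 \<Omega>"
    "AE x in lebesgue_on \<Omega>. norm (w x) \<le> C * norm (v x)"
  shows "w \<in> L2 \<Omega>"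
proof -
  have "integrable (lebesgue_on \<Omega>) (\<lambda>x. (norm (w x))\<^sup>2)"
  proof (rule Bochner_Integration.integrable_bound)
    show "integrable (lebesgue_on \<Omega>) (\<lambda>x. C\<^sup>2 * (norm (v x))\<^sup>2)" using assms(3) by (simp add: L2_def)
    show "(\<lambda>x. (norm (w x))\<^sup>2) \<in> borel_measurable (lebesgue_on \<Omega>)" using assms(2) by measurable
    show "AE x in lebesgue_on \<Omega>. norm ((norm (w x))\<^sup>2) \<le> norm (C\<^sup>2 * (norm (v x))\<^sup>2)"
      using assms(4)
    proof eventually_elim
      case (elim x)
      then have "(norm (w x))\<^sup>2 \<le> (C * norm (v x))\<^sup>2" by (intro power_mono) auto
      then show ?case by (simp add: power_mult_distrib)
    qed
  qed
  then show ?thesis using assms(2) by (simp add: L2_def)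
qed

text \<open>Extension by zero: fields on any domain are placed in one Hilbert space, and integrals
  over \<open>\<Omega>\<close> become integrals over the whole space.\<close>

definition emb :: "(real^3) set \<Rightarrow> (real^3 \<Rightarrow> 'b::euclidean_space) \<Rightarrow> (real^3, 'b) l2" where
  "emb \<Omega> v = abs_l2 (\<lambda>x. indicator \<Omega> x *\<^sub>R v x)"

context
  fixes \<Omega> :: "(real^3) set"
  assumes \<Omega>: "\<Omega> \<in> sets lebesgue"
begin

lemma emb_eq_iff:
  "v \<in> L2 \<Omega> \<Longrightarrow> w \<in> L2 \<Omega> \<Longrightarrow> emb \<Omega> v = emb \<Omega> w \<longleftrightarrow> (AE x in lebesgue_on \<Omega>. v x = w x)"
  unfolding emb_def using \<Omega>
  by (subst abs_l2_eq_iff)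
    (auto simp: L2_iff_square_integrable AE_restrict_space_iff indicator_def elim!: eventually_mono)

lemma L2_add: "v \<in> L2 \<Omega> \<Longrightarrow> w \<in> L2 \<Omega> \<Longrightarrow> (\<lambda>x. v x + w x) \<in> L2 \<Omega>"
  using square_integrable_add by (fastforce simp: L2_iff_square_integrable[OF \<Omega>] scaleR_add_right)

lemma L2_diff: "v \<in> L2 \<Omega> \<Longrightarrow> w \<in> L2 \<Omega> \<Longrightarrow> (\<lambda>x. v x - w x) \<in> L2 \<Omega>"
  using square_integrable_diff by (fastforce simp: L2_iff_square_integrable[OF \<Omega>] scaleR_diff_right)

lemma L2_scaleR: "v \<in> L2 \<Omega> \<Longrightarrow> (\<lambda>x. r *\<^sub>R v x) \<in> L2 \<Omega>"
  by (auto simp: L2_def power_mult_distrib)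

lemma emb_add: "v \<in> L2 \<Omega> \<Longrightarrow> w \<in> L2 \<Omega> \<Longrightarrow> emb \<Omega> (\<lambda>x. v x + w x) = emb \<Omega> v + emb \<Omega> w"
  by (simp add: emb_def L2_iff_square_integrable[OF \<Omega>] scaleR_add_right abs_l2_add)

lemma emb_diff: "v \<in> L2 \<Omega> \<Longrightarrow> w \<in> L2 \<Omega> \<Longrightarrow> emb \<Omega> (\<lambda>x. v x - w x) = emb \<Omega> v - emb \<Omega> w"
  by (simp add: emb_def L2_iff_square_integrable[OF \<Omega>] scaleR_diff_right abs_l2_diff)

lemma emb_scaleR: "v \<in> L2 \<Omega> \<Longrightarrow> emb \<Omega> (\<lambda>x. r *\<^sub>R v x) = r *\<^sub>R emb \<Omega> v"
  by (simp add: emb_def L2_iff_square_integrable[OF \<Omega>] abs_l2_scaleR[symmetric] mult.commute)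

lemma emb_inner: "v \<in> L2 \<Omega> \<Longrightarrow> w \<in> L2 \<Omega> \<Longrightarrow> emb \<Omega> v \<bullet> emb \<Omega> w = (LINT x|lebesgue_on \<Omega>. v x \<bullet> w x)"
  unfolding emb_def using \<Omega>
  by (simp add: L2_iff_square_integrable abs_l2_inner integral_restrict_space indicator_def)
    (auto intro!: Bochner_Integration.integral_cong)

lemma norm_emb: "v \<in> L2 \<Omega> \<Longrightarrow> norm (emb \<Omega> v) = norm_L2 \<Omega> v"
  by (simp add: norm_eq_sqrt_inner emb_inner norm_L2_def power2_norm_eq_inner)

lemma L2_conj_mult: "v \<in> L2 \<Omega> \<Longrightarrow> (\<lambda>x. vcnj (m *s v x)) \<in> L2 \<Omega>"
  by (rule L2_dominated[OF \<Omega>, where v = v and C = "norm m"])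
    (auto simp: norm_vcnj norm_cmult intro!: borel_measurable_vcnj borel_measurable_cmult intro: L2_measurable)

lemma integrable_cdot:
  assumes v: "v \<in> L2 \<Omega>" and w: "w \<in> L2 \<Omega>"
  shows "integrable (lebesgue_on \<Omega>) (\<lambda>x. cdot (v x) (w x))"
proof (rule Bochner_Integration.integrable_bound)
  show "integrable (lebesgue_on \<Omega>) (\<lambda>x. (norm (v x))\<^sup>2 + (norm (w x))\<^sup>2)"
    using v w by (simp add: L2_def)
  show "(\<lambda>x. cdot (v x) (w x)) \<in> borel_measurable (lebesgue_on \<Omega>)"
    using v w by (intro borel_measurable_cdot L2_measurable)
  have "norm (cdot y z) \<le> norm ((norm y)\<^sup>2 + (norm z)\<^sup>2)" for y z
  proof -
    have "2 * (norm y * norm z) \<le> (norm y)\<^sup>2 + (norm z)\<^sup>2"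
      using sum_squares_bound[of "norm y" "norm z"] by (simp add: mult.assoc)
    then have "norm (cdot y z) \<le> (norm y)\<^sup>2 + (norm z)\<^sup>2"
      using norm_cdot_le[of y z] mult_nonneg_nonneg[OF norm_ge_zero[of y] norm_ge_zero[of z]] by linarith
    then show ?thesis by simp
  qed
  then show "AE x in lebesgue_on \<Omega>. norm (cdot (v x) (w x)) \<le> norm ((norm (v x))\<^sup>2 + (norm (w x))\<^sup>2)" by simp
qed

lemma Re_integral_cdot:
  assumes v: "v \<in> L2 \<Omega>" and w: "w \<in> L2 \<Omega>"
  shows "Re (LINT x|lebesgue_on \<Omega>. cdot (v x) (w x)) = emb \<Omega> (\<lambda>x. vcnj (v x)) \<bullet> emb \<Omega> w"
proof -
  have "(\<lambda>x. vcnj (v x)) \<in> L2 \<Omega>" using L2_conj_mult[OF v, of 1] by simp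
  then show ?thesis
    using w by (simp add: emb_inner inner_eq_Re_cdot vcnj_vcnj integral_Re[OF integrable_cdot[OF v w]])
qed

end

text \<open>The bound refers to the whole space because the elements of the Hilbert space live
  there; material weights are therefore cut off outside the domain.\<close>

definition essentially_bounded :: "(real^3 \<Rightarrow> complex) \<Rightarrow> real \<Rightarrow> bool" where
  "essentially_bounded m C \<longleftrightarrow>
     m \<in> borel_measurable lebesgue \<and> 0 \<le> C \<and> (AE x in lebesgue. norm (m x) \<le> C)"

text \<open>Multiplication by \<open>m\<close> followed by conjugation: its real inner product against \<open>w\<close> is the real
  part of the complex bilinear form with coefficient \<open>m\<close>.\<close>

definition conj_mult :: "(real^3 \<Rightarrow> complex) \<Rightarrow> (real^3, complex^3) l2 \<Rightarrow> (real^3, complex^3) l2" where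
  "conj_mult m X = abs_l2 (\<lambda>x. vcnj (m x *s rep_l2 X x))"

context
  fixes m :: "real^3 \<Rightarrow> complex" and C :: real
  assumes m: "essentially_bounded m C"
begin

lemma square_integrable_conj_mult:
  assumes f: "square_integrable f"
  shows "square_integrable (\<lambda>x. vcnj (m x *s f x))"
proof (rule square_integrable_dominated)
  show "(\<lambda>x. vcnj (m x *s f x)) \<in> borel_measurable lebesgue"
    using m f by (intro borel_measurable_vcnj borel_measurable_cmult)
      (auto simp: essentially_bounded_def square_integrable_measurable)
  show "integrable lebesgue (\<lambda>x. C\<^sup>2 * (norm (f x))\<^sup>2)" using f by (simp add: square_integrable_def)
  have "AE x in lebesgue. norm (m x) \<le> C" using m by (simp add: essentially_bounded_def)
  then show "AE x in lebesgue. (norm (vcnj (m x *s f x)))\<^sup>2 \<le> C\<^sup>2 * (norm (f x))\<^sup>2"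
    by eventually_elim (auto simp: norm_vcnj norm_cmult power_mult_distrib intro!: mult_right_mono power_mono)
qed

lemma conj_mult_abs: "square_integrable f \<Longrightarrow> conj_mult m (abs_l2 f) = abs_l2 (\<lambda>x. vcnj (m x *s f x))"
  unfolding conj_mult_def
  by (subst abs_l2_eq_iff)
    (auto intro!: square_integrable_conj_mult square_integrable_rep elim!: eventually_mono[OF rep_abs_l2])

lemma conj_mult_emb:
  assumes "\<Omega> \<in> sets lebesgue" "v \<in> L2 \<Omega>"
  shows "conj_mult m (emb \<Omega> v) = emb \<Omega> (\<lambda>x. vcnj (m x *s v x))"
  using assms by (simp add: emb_def conj_mult_abs L2_iff_square_integrable cmult_scaleR vcnj_scaleR)

lemma L2_conj_mult_fun:
  assumes "\<Omega> \<in> sets lebesgue" "v \<in> L2 \<Omega>"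
  shows "(\<lambda>x. vcnj (m x *s v x)) \<in> L2 \<Omega>"
  using assms square_integrable_conj_mult[of "\<lambda>x. indicator \<Omega> x *\<^sub>R v x"]
  by (simp add: L2_iff_square_integrable cmult_scaleR vcnj_scaleR)

lemma norm_conj_mult: "norm (conj_mult m X) \<le> C * norm X"
proof -
  have C: "C \<ge> 0" and ae: "AE x in lebesgue. norm (m x) \<le> C"
    using m by (auto simp: essentially_bounded_def)
  have r: "square_integrable (rep_l2 X)" by (rule square_integrable_rep)
  have "(norm (conj_mult m X))\<^sup>2 = (LINT x|lebesgue. (norm (vcnj (m x *s rep_l2 X x)))\<^sup>2)"
    unfolding conj_mult_def by (rule norm_abs_l2[OF square_integrable_conj_mult[OF r]])
  also have "\<dots> \<le> (LINT x|lebesgue. C\<^sup>2 * (norm (rep_l2 X x))\<^sup>2)"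
  proof (rule integral_mono_AE)
    show "AE x in lebesgue. (norm (vcnj (m x *s rep_l2 X x)))\<^sup>2 \<le> C\<^sup>2 * (norm (rep_l2 X x))\<^sup>2"
      using ae
      by eventually_elim (auto simp: norm_vcnj norm_cmult power_mult_distrib intro!: mult_right_mono power_mono)
  qed (use r square_integrable_conj_mult[OF r] in \<open>auto simp: square_integrable_def\<close>)
  also have "\<dots> = (C * norm X)\<^sup>2"
    using norm_abs_l2[OF r] by (simp add: abs_rep_l2 power_mult_distrib)
  finally show ?thesis by (rule power2_le_imp_le) (simp add: C)
qed

lemma bounded_linear_conj_mult: "bounded_linear (conj_mult m)"
proof (rule bounded_linear_intro)
  fix X Y :: "(real^3, complex^3) l2" and r :: real
  have sX: "square_integrable (rep_l2 X)" and sY: "square_integrable (rep_l2 Y)"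
    by (rule square_integrable_rep)+
  have "conj_mult m (abs_l2 (\<lambda>x. rep_l2 X x + rep_l2 Y x)) = conj_mult m X + conj_mult m Y"
    unfolding conj_mult_abs[OF square_integrable_add[OF sX sY]]
    by (simp add: conj_mult_def sX sY vector_add_ldistrib vcnj_add abs_l2_add square_integrable_conj_mult)
  then show "conj_mult m (X + Y) = conj_mult m X + conj_mult m Y"
    by (simp add: abs_l2_add sX sY abs_rep_l2)
  have "conj_mult m (abs_l2 (\<lambda>x. r *\<^sub>R rep_l2 X x)) = r *\<^sub>R conj_mult m X"
    unfolding conj_mult_abs[OF square_integrable_scaleR[OF sX]]
    by (simp add: conj_mult_def sX cmult_scaleR vcnj_scaleR abs_l2_scaleR square_integrable_conj_mult)
  then show "conj_mult m (r *\<^sub>R X) = r *\<^sub>R conj_mult m X"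
    by (simp add: abs_l2_scaleR sX abs_rep_l2)
  show "norm (conj_mult m X) \<le> norm X * C" using norm_conj_mult[of X] by (simp add: mult.commute)
qed

text \<open>The conjugation in \<open>conj_mult\<close> cancels the one hidden in the real inner
  product, which leaves the real part of a bilinear expression. Complex coefficients thus cause no
  asymmetry.\<close>

lemma conj_mult_symmetric: "conj_mult m X \<bullet> Y = conj_mult m Y \<bullet> X"
proof -
  have "conj_mult m X \<bullet> Y = (LINT x|lebesgue. Re (m x * cdot (rep_l2 X x) (rep_l2 Y x)))" for X Y
    using abs_l2_inner[OF square_integrable_conj_mult[OF square_integrable_rep[of X]] square_integrable_rep[of Y]]
    by (simp add: abs_rep_l2 conj_mult_def inner_eq_Re_cdot vcnj_vcnj cdot_mult_left)
  then show ?thesis by (simp add: cdot_commute)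
qed

lemma conj_mult_inner_emb:
  assumes \<Omega>: "\<Omega> \<in> sets lebesgue" and v: "v \<in> L2 \<Omega>" and w: "w \<in> L2 \<Omega>"
  shows "conj_mult m (emb \<Omega> v) \<bullet> emb \<Omega> w = Re (LINT x|lebesgue_on \<Omega>. m x * cdot (v x) (w x))"
proof -
  have mv: "(\<lambda>x. m x *s v x) \<in> L2 \<Omega>"
    using L2_conj_mult[OF \<Omega> L2_conj_mult_fun[OF \<Omega> v], of 1] by (simp add: vcnj_vcnj)
  show ?thesis
    using Re_integral_cdot[OF \<Omega> mv w] by (simp add: conj_mult_emb[OF \<Omega> v] cdot_mult_left)
qed

end

lemma L2_integrable:
  assumes \<Omega>: "\<Omega> \<in> lmeasurable" and v: "v \<in> L2 \<Omega>"
  shows "integrable (lebesgue_on \<Omega>) v"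
proof (rule Bochner_Integration.integrable_bound)
  interpret finite_measure "lebesgue_on \<Omega>" using \<Omega> by (rule finite_measure_lebesgue_on)
  show "integrable (lebesgue_on \<Omega>) (\<lambda>x. 1 + (norm (v x))\<^sup>2)" using v by (simp add: L2_def)
  show "v \<in> borel_measurable (lebesgue_on \<Omega>)" using v by (rule L2_measurable)
  have "norm y \<le> 1 + (norm y)\<^sup>2" for y :: 'a
  proof -
    have "2 * norm y \<le> (norm y)\<^sup>2 + 1" using sum_squares_bound[of "norm y" 1] by simp
    then show ?thesis using norm_ge_zero[of y] by linarith
  qed
  then show "AE x in lebesgue_on \<Omega>. norm (v x) \<le> norm (1 + (norm (v x))\<^sup>2)" by simp
qed

lemma continuous_in_L2:
  assumes \<Omega>: "\<Omega> \<in> lmeasurable" "bounded \<Omega>" and v: "continuous_on UNIV v"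
  shows "v \<in> L2 \<Omega>"
proof -
  interpret finite_measure "lebesgue_on \<Omega>" using \<Omega>(1) by (rule finite_measure_lebesgue_on)
  have "compact (v ` closure \<Omega>)"
    using \<Omega>(2) by (intro compact_continuous_image continuous_on_subset[OF v]) auto
  then obtain B where B: "\<And>x. x \<in> closure \<Omega> \<Longrightarrow> norm (v x) \<le> B"
    by (meson compact_imp_bounded bounded_iff image_eqI)
  have vm: "v \<in> borel_measurable (lebesgue_on \<Omega>)"
    using v by (intro continuous_imp_measurable_on_sets_lebesgue continuous_on_subset[OF v])
      (use \<Omega> in \<open>auto simp: fmeasurable_def\<close>)
  have "integrable (lebesgue_on \<Omega>) (\<lambda>x. (norm (v x))\<^sup>2)"
  proof (rule integrable_const_bound)
    show "AE x in lebesgue_on \<Omega>. norm ((norm (v x))\<^sup>2) \<le> B\<^sup>2"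
    proof (rule AE_I2)
      fix x assume "x \<in> space (lebesgue_on \<Omega>)"
      then have "norm (v x) \<le> B" using B closure_subset by auto
      then show "norm ((norm (v x))\<^sup>2) \<le> B\<^sup>2" by (simp add: power_mono)
    qed
    show "(\<lambda>x. (norm (v x))\<^sup>2) \<in> borel_measurable (lebesgue_on \<Omega>)" using vm by measurable
  qed
  then show ?thesis using vm by (simp add: L2_def)
qed

text \<open>The fundamental lemma of the calculus of variations: tests \<open>\<phi> n\<close> times
  a coordinate vector converge boundedly to the indicator of a box, so every component has vanishing
  box integrals.\<close>

lemma AE_zero_of_test_functions:
  assumes \<Omega>: "open \<Omega>" "bounded \<Omega>" and c: "c \<in> L2 \<Omega>"
    and zero: "\<And>\<phi>. test_function \<Omega> \<phi> \<Longrightarrow> (LINT x|lebesgue_on \<Omega>. cdot (c x) (\<phi> x)) = 0"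
  shows "AE x in lebesgue_on \<Omega>. c x = 0"
proof -
  have \<Omega>l: "\<Omega> \<in> sets lebesgue" using sets_completionI_sets[of \<Omega> lborel] \<Omega> by simp
  have \<Omega>m: "\<Omega> \<in> lmeasurable" using \<Omega>(2) \<Omega>l by (rule bounded_set_imp_lmeasurable)
  have comp: "AE x in lebesgue_on \<Omega>. c x $ k = 0" for k
  proof (rule AE_zero_of_box_integrals_on[OF \<Omega>(1)])
    have ic: "integrable (lebesgue_on \<Omega>) c" using \<Omega>m c by (rule L2_integrable)
    show ick: "integrable (lebesgue_on \<Omega>) (\<lambda>x. c x $ k)"
      using ic by (rule integrable_bounded_linear[OF bounded_linear_vec_nth])
    fix a b assume sub: "cbox a b \<subseteq> \<Omega>"
    show "set_lebesgue_integral lebesgue (box a b) (\<lambda>x. c x $ k) = 0"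
    proof (cases "box a b = {}")
      case False
      obtain \<phi> :: "nat \<Rightarrow> real^3 \<Rightarrow> real" where \<phi>: "\<And>n v::complex^3. test_function \<Omega> (\<lambda>x. \<phi> n x *\<^sub>R v)"
        "\<And>n x. \<bar>\<phi> n x\<bar> \<le> 1" "\<And>x. (\<lambda>n. \<phi> n x) \<longlonglongrightarrow> indicator (box a b) x" "\<And>n. \<phi> n \<in> borel_measurable borel"
        using smooth_box_approximation[OF False sub] by metis
      have \<phi>m: "\<phi> n \<in> borel_measurable (lebesgue_on \<Omega>)" for n
        using \<phi>(4)[of n] by (intro measurable_restrict_space1 measurable_completion) simp
      have bl: "indicator (box a b) \<in> borel_measurable (lebesgue_on \<Omega>)"
        by (intro measurable_restrict_space1 measurable_completion) simp
      have "cdot (axis k 1) (c x) = c x $ k" for x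
        by (simp add: cdot_def axis_def if_distrib[where f = "\<lambda>t. t * _"] cong: if_cong)
      then have "cdot (c x) (\<phi> n x *\<^sub>R axis k 1) = \<phi> n x *\<^sub>R (c x $ k)" for n x
        by (simp add: cdot_commute[of "c x"] cdot_scaleR_left)
      then have z: "(LINT x|lebesgue_on \<Omega>. \<phi> n x *\<^sub>R (c x $ k)) = 0" for n
        using zero[OF \<phi>(1)[of n "axis k 1"]] by simp
      have "(\<lambda>n. LINT x|lebesgue_on \<Omega>. \<phi> n x *\<^sub>R (c x $ k)) \<longlonglongrightarrow> (LINT x|lebesgue_on \<Omega>. indicator (box a b) x *\<^sub>R (c x $ k))"
      proof (rule integral_dominated_convergence)
        show "integrable (lebesgue_on \<Omega>) (\<lambda>x. norm (c x $ k))" using ick by (rule integrable_norm)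
        show "(\<lambda>x. indicat_real (box a b) x *\<^sub>R c x $ k) \<in> borel_measurable (lebesgue_on \<Omega>)"
          using bl ick by (intro borel_measurable_scaleR) auto
        show "(\<lambda>x. \<phi> n x *\<^sub>R c x $ k) \<in> borel_measurable (lebesgue_on \<Omega>)" for n
          using \<phi>m ick by (intro borel_measurable_scaleR) auto
        show "AE x in lebesgue_on \<Omega>. (\<lambda>n. \<phi> n x *\<^sub>R c x $ k) \<longlonglongrightarrow> indicat_real (box a b) x *\<^sub>R c x $ k"
          using \<phi>(3) by (intro AE_I2 tendsto_intros)
        show "AE x in lebesgue_on \<Omega>. norm (\<phi> n x *\<^sub>R c x $ k) \<le> norm (c x $ k)" for n
          using \<phi>(2)[of n] by (intro AE_I2) (simp add: mult_left_le_one_le)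
      qed
      then have "(LINT x|lebesgue_on \<Omega>. indicator (box a b) x *\<^sub>R (c x $ k)) = 0"
        unfolding z by (simp add: LIMSEQ_const_iff)
      moreover have "(LINT x|lebesgue_on \<Omega>. indicator (box a b) x *\<^sub>R (c x $ k)) =
          set_lebesgue_integral lebesgue (box a b) (\<lambda>x. c x $ k)"
        unfolding set_lebesgue_integral_def using \<Omega>l order_trans[OF box_subset_cbox sub]
        by (subst integral_restrict_space) (auto intro!: Bochner_Integration.integral_cong simp: indicator_def)
      ultimately show ?thesis by simp
    qed (simp add: set_lebesgue_integral_def)
  qed
  have "AE x in lebesgue_on \<Omega>. \<forall>k\<in>UNIV. c x $ k = 0"
    using comp by (subst AE_finite_all) auto
  then show ?thesis by eventually_elim (simp add: vec_eq_iff)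
qed

section \<open>Weak curls with vanishing tangential trace\<close>

lemma pd_linear:
  assumes L: "bounded_linear L" and \<phi>: "\<phi> differentiable (at x)"
  shows "pd i (\<lambda>x. L (\<phi> x)) x = L (pd i \<phi> x)"
proof -
  have "(\<phi> has_derivative frechet_derivative \<phi> (at x)) (at x)"
    using \<phi> by (simp add: frechet_derivative_works)
  from bounded_linear.has_derivative[OF L this] frechet_derivative_at show ?thesis
    unfolding pd_def by metis
qed

lemma Ck_differentiable: "Ck (Suc k) \<phi> \<Longrightarrow> \<phi> differentiable (at x)"
  by (simp add: differentiable_on_def)

lemma Ck_linear:
  assumes L: "bounded_linear L"
  shows "Ck k \<phi> \<Longrightarrow> Ck k (\<lambda>x. L (\<phi> x))"
proof (induction k arbitrary: \<phi>)
  case 0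
  then show ?case by (simp add: bounded_linear.continuous_on[OF L])
next
  case (Suc k)
  have d: "\<phi> differentiable (at x)" for x using Ck_differentiable[OF Suc.prems] .
  have "(\<lambda>x. L (\<phi> x)) differentiable_on UNIV"
    using d bounded_linear.has_derivative[OF L] unfolding differentiable_on_def differentiable_def by blast
  moreover have "pd i (\<lambda>x. L (\<phi> x)) = (\<lambda>x. L (pd i \<phi> x))" for i
    by (rule ext) (rule pd_linear[OF L d])
  ultimately show ?case using Suc by simp
qed

lemma smooth_linear: "bounded_linear L \<Longrightarrow> smooth \<phi> \<Longrightarrow> smooth (\<lambda>x. L (\<phi> x))"
  by (simp add: smooth_def Ck_linear)

lemma smooth_continuous: "smooth \<phi> \<Longrightarrow> continuous_on UNIV \<phi>"
  unfolding smooth_def by (metis Ck.simps(1))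

lemma smooth_differentiable: "smooth \<phi> \<Longrightarrow> \<phi> differentiable (at x)"
  unfolding smooth_def using Ck_differentiable by blast

lemma smooth_pd_continuous: "smooth \<phi> \<Longrightarrow> continuous_on UNIV (pd i \<phi>)"
  unfolding smooth_def by (metis Ck.simps)

lemma classical_curl_continuous:
  assumes "smooth \<phi>"
  shows "continuous_on UNIV (classical_curl \<phi>)"
proof -
  have "continuous_on UNIV (\<lambda>x. classical_curl \<phi> x $ j)" for j
  proof -
    have *: "continuous_on UNIV (\<lambda>x. pd i \<phi> x $ k)" for i k
      by (intro continuous_intros smooth_pd_continuous assms)
    have "\<forall>j. continuous_on UNIV (\<lambda>x. classical_curl \<phi> x $ j)"
      unfolding classical_curl_def by (simp add: forall_3 continuous_on_diff *)
    then show ?thesis by blast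
  qed
  then have "continuous_on UNIV (\<lambda>x. \<chi> j. classical_curl \<phi> x $ j)"
    by (intro continuous_on_vec_lambda)
  then show ?thesis by simp
qed

lemma bounded_linear_conj_cmult: "bounded_linear (\<lambda>v. vcnj (m *s v))"
  by (intro linear_conv_bounded_linear[THEN iffD1] linearI)
    (simp_all add: vector_add_ldistrib vcnj_add cmult_scaleR vcnj_scaleR)

lemma smooth_conj_cmult: "smooth \<phi> \<Longrightarrow> smooth (\<lambda>x. vcnj (m *s \<phi> x))"
  by (rule smooth_linear[OF bounded_linear_conj_cmult])

lemma classical_curl_conj_cmult:
  assumes "smooth \<phi>"
  shows "classical_curl (\<lambda>x. vcnj (m *s \<phi> x)) x = vcnj (m *s classical_curl \<phi> x)"
  unfolding classical_curl_def pd_linear[OF bounded_linear_conj_cmult smooth_differentiable[OF assms]]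
  by (simp add: vec_eq_iff forall_3 vcnj_def right_diff_distrib)

type_synonym l2_pair = "(real^3, complex^3) l2 \<times> (real^3, complex^3) l2"

text \<open>Green's identity without boundary term, for all smooth fields rather than compactly
  supported ones. It encodes at once that \<open>c\<close> is the weak curl and that the tangential
  trace vanishes; having \<open>c\<close> as an argument avoids the choice made in
  \<open>Curl\<close>.\<close>

definition zero_trace_curl ::
  "(real^3) set \<Rightarrow> (real^3 \<Rightarrow> complex^3) \<Rightarrow> (real^3 \<Rightarrow> complex^3) \<Rightarrow> bool" where
  "zero_trace_curl \<Omega> w c \<longleftrightarrow> w \<in> L2 \<Omega> \<and> c \<in> L2 \<Omega> \<and> (\<forall>\<phi>. smooth \<phi> \<longrightarrow>
     (LINT x|lebesgue_on \<Omega>. cdot (c x) (\<phi> x)) = (LINT x|lebesgue_on \<Omega>. cdot (w x) (classical_curl \<phi> x)))"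

definition graph_curl :: "(real^3) set \<Rightarrow> (real^3 \<Rightarrow> complex^3) \<Rightarrow> l2_pair" where
  "graph_curl \<Omega> w = (emb \<Omega> w, emb \<Omega> (Curl \<Omega> w))"

text \<open>Acts alike on both components because conjugation and constant factors commute with the
  curl. For \<open>m = Complex 1 (- K)\<close> it is the test map.\<close>

definition conj_mult2 :: "complex \<Rightarrow> l2_pair \<Rightarrow> l2_pair" where
  "conj_mult2 m z = (conj_mult (\<lambda>_. m) (fst z), conj_mult (\<lambda>_. m) (snd z))"

lemma essentially_bounded_const: "essentially_bounded (\<lambda>_. m) (norm m)"
  by (simp add: essentially_bounded_def)

lemma essentially_bounded_indicator: "\<Omega> \<in> sets lebesgue \<Longrightarrow> essentially_bounded (indicator \<Omega>) 1"
  by (auto simp: essentially_bounded_def indicator_def intro!: borel_measurable_indicator AE_I2)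

text \<open>The image is the fixed point set of the bounded operator \<open>Q\<close>, restriction
  to \<open>\<Omega>\<close>. \<open>Q\<close> is a composition of two factors because each
  \<open>conj_mult\<close> conjugates once.\<close>

lemma emb_image_closed:
  assumes \<Omega>: "\<Omega> \<in> sets lebesgue"
  shows "closed (emb \<Omega> ` (L2 \<Omega> :: (real^3 \<Rightarrow> complex^3) set))"
proof -
  define Q where "Q X = conj_mult (\<lambda>_. 1) (conj_mult (indicator \<Omega>) X)" for X
  have rep: "rep_l2 X \<in> L2 \<Omega>" for X :: "(real^3, complex^3) l2"
  proof -
    have "square_integrable (\<lambda>x. vcnj (indicator \<Omega> x *s rep_l2 X x))"
      by (rule square_integrable_conj_mult[OF essentially_bounded_indicator[OF \<Omega>] square_integrable_rep])
    from square_integrable_conj_mult[OF essentially_bounded_const[of 1] this]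
    have "square_integrable (\<lambda>x. indicator \<Omega> x *s rep_l2 X x)" by (simp add: vcnj_vcnj)
    moreover have "indicator \<Omega> x *s rep_l2 X x = indicator \<Omega> x *\<^sub>R rep_l2 X x" for x
      by (simp add: indicator_def)
    ultimately show ?thesis by (simp add: L2_iff_square_integrable[OF \<Omega>])
  qed
  have chi_rep: "Q X = emb \<Omega> (rep_l2 X)" for X
  proof -
    have "conj_mult (indicator \<Omega>) X = abs_l2 (\<lambda>x. vcnj (indicator \<Omega> x *s rep_l2 X x))"
      by (simp add: conj_mult_def)
    then have "Q X = abs_l2 (\<lambda>x. indicator \<Omega> x *s rep_l2 X x)"
      unfolding Q_def
      using conj_mult_abs[OF essentially_bounded_const[of 1]
        square_integrable_conj_mult[OF essentially_bounded_indicator[OF \<Omega>] square_integrable_rep[of X]]]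
      by (simp add: vcnj_vcnj)
    also have "(\<lambda>x. indicator \<Omega> x *s rep_l2 X x) = (\<lambda>x. indicator \<Omega> x *\<^sub>R rep_l2 X x)"
      by (simp add: indicator_def fun_eq_iff)
    finally show ?thesis by (simp add: emb_def)
  qed
  have chi_emb: "Q (emb \<Omega> v) = emb \<Omega> v" if v: "v \<in> L2 \<Omega>" for v
  proof -
    have "Q (emb \<Omega> v) = emb \<Omega> (\<lambda>x. indicator \<Omega> x *s v x)"
      unfolding Q_def conj_mult_emb[OF essentially_bounded_indicator[OF \<Omega>] \<Omega> v]
      using conj_mult_emb[OF essentially_bounded_const[of 1] \<Omega>
          L2_conj_mult_fun[OF essentially_bounded_indicator[OF \<Omega>] \<Omega> v]]
      by (simp add: vcnj_vcnj)
    also have "\<dots> = emb \<Omega> v"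
      unfolding emb_def by (rule arg_cong[where f = abs_l2]) (auto simp: indicator_def fun_eq_iff)
    finally show ?thesis .
  qed
  have "emb \<Omega> ` L2 \<Omega> = {X. Q X = X}"
    using chi_emb chi_rep rep by (auto simp: image_iff) (metis)
  moreover have "bounded_linear Q" unfolding Q_def
    by (intro bounded_linear_compose[OF bounded_linear_conj_mult[OF essentially_bounded_const]]
        bounded_linear_conj_mult[OF essentially_bounded_indicator[OF \<Omega>]])
  ultimately show ?thesis
    by (simp add: closed_Collect_eq continuous_on_id linear_continuous_on)
qed

locale bounded_domain =
  fixes \<Omega> :: "(real^3) set"
  assumes open_dom: "open \<Omega>" and bounded_dom: "bounded \<Omega>"
begin

lemma dom_sets: "\<Omega> \<in> sets lebesgue"
  using sets_completionI_sets[of \<Omega> lborel] open_dom by simp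

lemma dom_lmeasurable: "\<Omega> \<in> lmeasurable"
  using bounded_dom dom_sets by (rule bounded_set_imp_lmeasurable)

lemma smooth_L2: "smooth \<phi> \<Longrightarrow> \<phi> \<in> L2 \<Omega>"
  by (rule continuous_in_L2[OF dom_lmeasurable bounded_dom smooth_continuous])

lemma classical_curl_L2: "smooth \<phi> \<Longrightarrow> classical_curl \<phi> \<in> L2 \<Omega>"
  by (rule continuous_in_L2[OF dom_lmeasurable bounded_dom classical_curl_continuous])

lemma test_function_smooth: "test_function \<Omega> \<phi> \<Longrightarrow> smooth \<phi>"
  by (simp add: test_function_def)

lemma weak_curl_unique:
  assumes "c \<in> L2 \<Omega>" "c' \<in> L2 \<Omega>" "is_weak_curl \<Omega> w c" "is_weak_curl \<Omega> w c'"
  shows "AE x in lebesgue_on \<Omega>. c x = c' x"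
proof -
  have "AE x in lebesgue_on \<Omega>. c x - c' x = 0"
  proof (rule AE_zero_of_test_functions[OF open_dom bounded_dom L2_diff[OF dom_sets assms(1,2)]])
    fix \<phi> :: "real^3 \<Rightarrow> complex^3" assume \<phi>: "test_function \<Omega> \<phi>"
    then have "\<phi> \<in> L2 \<Omega>" by (intro smooth_L2 test_function_smooth)
    then show "(LINT x|lebesgue_on \<Omega>. cdot (c x - c' x) (\<phi> x)) = 0"
      using assms \<phi> integrable_cdot[OF dom_sets]
      by (simp add: cdot_diff_left Bochner_Integration.integral_diff is_weak_curl_def)
  qed
  then show ?thesis by eventually_elim simp
qed

lemma Curl_weak:
  assumes "w \<in> Hcurl \<Omega>"
  shows "Curl \<Omega> w \<in> L2 \<Omega>" "is_weak_curl \<Omega> w (Curl \<Omega> w)"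
proof -
  have "\<exists>c. c \<in> L2 \<Omega> \<and> is_weak_curl \<Omega> w c" using assms by (auto simp: Hcurl_def)
  from someI_ex[OF this] show "Curl \<Omega> w \<in> L2 \<Omega>" "is_weak_curl \<Omega> w (Curl \<Omega> w)"
    by (auto simp: Curl_def)
qed

lemma H0curl_zero_trace: "w \<in> H0curl \<Omega> \<Longrightarrow> zero_trace_curl \<Omega> w (Curl \<Omega> w)"
  using Curl_weak(1) by (auto simp: H0curl_def zero_trace_curl_def tangential_trace_def Hcurl_def)

text \<open>Weak curls are unique almost everywhere, so any witness \<open>c\<close> can stand for
  the chosen \<open>Curl\<close>. Linearity and conjugation are therefore checked on
  witnesses.\<close>

lemma zero_trace_curlD:
  assumes z: "zero_trace_curl \<Omega> w c"
  shows "w \<in> H0curl \<Omega>" "graph_curl \<Omega> w = (emb \<Omega> w, emb \<Omega> c)" "AE x in lebesgue_on \<Omega>. Curl \<Omega> w x = c x"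
proof -
  have wc: "w \<in> L2 \<Omega>" "c \<in> L2 \<Omega>" using z by (auto simp: zero_trace_curl_def)
  have weak: "is_weak_curl \<Omega> w c"
    using z by (auto simp: zero_trace_curl_def is_weak_curl_def test_function_smooth)
  have H: "w \<in> Hcurl \<Omega>" using wc weak by (auto simp: Hcurl_def)
  show ae: "AE x in lebesgue_on \<Omega>. Curl \<Omega> w x = c x"
    using weak_curl_unique[OF Curl_weak(1)[OF H] wc(2) Curl_weak(2)[OF H] weak] .
  show "graph_curl \<Omega> w = (emb \<Omega> w, emb \<Omega> c)"
    using ae emb_eq_iff[OF dom_sets Curl_weak(1)[OF H] wc(2)] by (simp add: graph_curl_def)
  have "(LINT x|lebesgue_on \<Omega>. cdot (Curl \<Omega> w x) (\<phi> x)) = (LINT x|lebesgue_on \<Omega>. cdot (c x) (\<phi> x))"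
    if "smooth \<phi>" for \<phi>
    using ae Curl_weak(1)[OF H] wc(2) smooth_L2[OF that]
    by (intro integral_cong_AE borel_measurable_cdot L2_measurable) (auto elim!: eventually_mono)
  then show "w \<in> H0curl \<Omega>"
    using H z by (auto simp: H0curl_def zero_trace_curl_def tangential_trace_def)
qed

lemma zero_trace_curl_add:
  assumes "zero_trace_curl \<Omega> w c" "zero_trace_curl \<Omega> w' c'"
  shows "zero_trace_curl \<Omega> (\<lambda>x. w x + w' x) (\<lambda>x. c x + c' x)"
  using assms integrable_cdot[OF dom_sets _ smooth_L2] integrable_cdot[OF dom_sets _ classical_curl_L2]
  by (auto simp: zero_trace_curl_def cdot_add_left Bochner_Integration.integral_add L2_add[OF dom_sets])

lemma zero_trace_curl_scaleR:
  assumes "zero_trace_curl \<Omega> w c"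
  shows "zero_trace_curl \<Omega> (\<lambda>x. r *\<^sub>R w x) (\<lambda>x. r *\<^sub>R c x)"
  using assms by (auto simp: zero_trace_curl_def cdot_scaleR_left L2_scaleR[OF dom_sets])

lemma zero_trace_curl_conj:
  assumes z: "zero_trace_curl \<Omega> w c"
  shows "zero_trace_curl \<Omega> (\<lambda>x. vcnj (m *s w x)) (\<lambda>x. vcnj (m *s c x))"
  unfolding zero_trace_curl_def
proof (intro conjI allI impI)
  show "(\<lambda>x. vcnj (m *s w x)) \<in> L2 \<Omega>" "(\<lambda>x. vcnj (m *s c x)) \<in> L2 \<Omega>"
    using z by (auto simp: zero_trace_curl_def L2_conj_mult[OF dom_sets])
  fix \<phi> :: "real^3 \<Rightarrow> complex^3" assume \<phi>: "smooth \<phi>"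
  \<comment> \<open>Factor and conjugation are moved onto the test field, which remains
    smooth.\<close>
  have *: "cdot (vcnj (m *s y)) p = cnj (cdot y (vcnj (cnj m *s p)))" for y p
    by (simp add: cdot_vcnj cdot_mult_left vcnj_mult cdot_commute[of y])
  show "(LINT x|lebesgue_on \<Omega>. cdot (vcnj (m *s c x)) (\<phi> x)) =
      (LINT x|lebesgue_on \<Omega>. cdot (vcnj (m *s w x)) (classical_curl \<phi> x))"
    unfolding * integral_cnj classical_curl_conj_cmult[OF \<phi>, symmetric]
    using z smooth_conj_cmult[OF \<phi>] by (simp add: zero_trace_curl_def)
qed

lemma graph_curl_add:
  assumes "w \<in> H0curl \<Omega>" "w' \<in> H0curl \<Omega>"
  shows "(\<lambda>x. w x + w' x) \<in> H0curl \<Omega>" "graph_curl \<Omega> (\<lambda>x. w x + w' x) = graph_curl \<Omega> w + graph_curl \<Omega> w'"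
  using zero_trace_curlD[OF zero_trace_curl_add[OF assms[THEN H0curl_zero_trace]]] assms[THEN H0curl_zero_trace]
  by (auto simp: emb_add[OF dom_sets] zero_trace_curl_def graph_curl_def)

lemma graph_curl_scaleR:
  assumes "w \<in> H0curl \<Omega>"
  shows "(\<lambda>x. r *\<^sub>R w x) \<in> H0curl \<Omega>" "graph_curl \<Omega> (\<lambda>x. r *\<^sub>R w x) = r *\<^sub>R graph_curl \<Omega> w"
  using zero_trace_curlD[OF zero_trace_curl_scaleR[OF H0curl_zero_trace[OF assms]]] H0curl_zero_trace[OF assms]
  by (auto simp: emb_scaleR[OF dom_sets] zero_trace_curl_def graph_curl_def)

lemma graph_curl_conj:
  assumes "w \<in> H0curl \<Omega>"
  shows "(\<lambda>x. vcnj (m *s w x)) \<in> H0curl \<Omega>" "graph_curl \<Omega> (\<lambda>x. vcnj (m *s w x)) = conj_mult2 m (graph_curl \<Omega> w)"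
    "AE x in lebesgue_on \<Omega>. Curl \<Omega> (\<lambda>x. vcnj (m *s w x)) x = vcnj (m *s Curl \<Omega> w x)"
  using zero_trace_curlD[OF zero_trace_curl_conj[OF H0curl_zero_trace[OF assms]], of m] H0curl_zero_trace[OF assms]
  by (auto simp: conj_mult_emb[OF essentially_bounded_const dom_sets] zero_trace_curl_def graph_curl_def conj_mult2_def)

lemma graph_curl_diff:
  assumes "w \<in> H0curl \<Omega>" "w' \<in> H0curl \<Omega>"
  shows "(\<lambda>x. w x - w' x) \<in> H0curl \<Omega>" "graph_curl \<Omega> (\<lambda>x. w x - w' x) = graph_curl \<Omega> w - graph_curl \<Omega> w'"
  using graph_curl_add[OF assms(1) graph_curl_scaleR(1)[OF assms(2), of "-1"]] graph_curl_scaleR(2)[OF assms(2), of "-1"]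
  by simp_all

lemma norm_graph_curl: "w \<in> H0curl \<Omega> \<Longrightarrow> norm (graph_curl \<Omega> w) = norm_Hcurl \<Omega> w"
  using H0curl_zero_trace[of w]
  by (simp add: graph_curl_def norm_Hcurl_def norm_Pair norm_emb[OF dom_sets] zero_trace_curl_def)

lemma subspace_graph:
  assumes "V \<subseteq> H0curl \<Omega>" "(\<lambda>x. 0) \<in> V" "\<And>v w. v \<in> V \<Longrightarrow> w \<in> V \<Longrightarrow> (\<lambda>x. v x + w x) \<in> V"
    "\<And>r v. v \<in> V \<Longrightarrow> (\<lambda>x. r *\<^sub>R v x) \<in> V"
  shows "subspace (graph_curl \<Omega> ` V)"
proof (rule subspaceI)
  have "graph_curl \<Omega> (\<lambda>x. 0) = 0"
    using graph_curl_scaleR(2)[of "\<lambda>x. 0" 0] assms(1,2) by auto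
  then show "0 \<in> graph_curl \<Omega> ` V" using image_eqI[OF _ assms(2), of 0 "graph_curl \<Omega>"] by simp
  fix y assume "y \<in> graph_curl \<Omega> ` V"
  then obtain v where v: "v \<in> V" "y = graph_curl \<Omega> v" by blast
  show "r *\<^sub>R y \<in> graph_curl \<Omega> ` V" for r
  proof (rule image_eqI)
    show "r *\<^sub>R y = graph_curl \<Omega> (\<lambda>x. r *\<^sub>R v x)" using graph_curl_scaleR(2)[of v r] v assms(1) by auto
  qed (rule assms(4)[OF v(1)])
  fix z assume "z \<in> graph_curl \<Omega> ` V"
  then obtain w where w: "w \<in> V" "z = graph_curl \<Omega> w" by blast
  show "y + z \<in> graph_curl \<Omega> ` V"
  proof (rule image_eqI)
    show "y + z = graph_curl \<Omega> (\<lambda>x. v x + w x)"       using graph_curl_add(2)[OF subsetD[OF assms(1) v(1)] subsetD[OF assms(1) w(1)]] v(2) w(2) by simp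
  qed (rule assms(3)[OF v(1) w(1)])
qed

lemma zero_in_H0curl: "(\<lambda>x. 0) \<in> H0curl \<Omega>"
proof (rule zero_trace_curlD(1))
  show "zero_trace_curl \<Omega> (\<lambda>x. 0) (\<lambda>x. 0)"
    by (simp add: zero_trace_curl_def cdot_zero_left L2_def)
qed

lemma subspace_H0curl: "subspace (graph_curl \<Omega> ` H0curl \<Omega>)"
  by (intro subspace_graph zero_in_H0curl graph_curl_add(1) graph_curl_scaleR(1)) auto

text \<open>Membership is rewritten by conditions from which closedness can be read off. Real parts
  suffice because test fields may be multiplied by \<open>\<i>\<close>.\<close>

lemma graph_H0curl_iff:
  "z \<in> graph_curl \<Omega> ` H0curl \<Omega> \<longleftrightarrow> fst z \<in> emb \<Omega> ` L2 \<Omega> \<and> snd z \<in> emb \<Omega> ` L2 \<Omega> \<and>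
     (\<forall>\<phi>. smooth \<phi> \<longrightarrow> snd z \<bullet> emb \<Omega> (\<lambda>x. vcnj (\<phi> x)) = fst z \<bullet> emb \<Omega> (\<lambda>x. vcnj (classical_curl \<phi> x)))"
    (is "?l \<longleftrightarrow> ?r")
proof -
  have Re_pair: "emb \<Omega> v \<bullet> emb \<Omega> (\<lambda>x. vcnj (\<psi> x)) = Re (LINT x|lebesgue_on \<Omega>. cdot (v x) (\<psi> x))"
    if "v \<in> L2 \<Omega>" "\<psi> \<in> L2 \<Omega>" for v \<psi>
    using Re_integral_cdot[OF dom_sets that(2,1)] by (simp add: inner_commute cdot_commute)
  show ?thesis
  proof
    assume ?l
    then obtain w where w: "w \<in> H0curl \<Omega>" "z = graph_curl \<Omega> w" by blast
    then have "zero_trace_curl \<Omega> w (Curl \<Omega> w)" by (intro H0curl_zero_trace)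
    then show ?r
      using w(2) by (auto simp: graph_curl_def zero_trace_curl_def Re_pair smooth_L2 classical_curl_L2)
  next
    assume r: ?r
    then obtain w c where wc: "w \<in> L2 \<Omega>" "c \<in> L2 \<Omega>" "z = (emb \<Omega> w, emb \<Omega> c)" by (cases z) auto
    have Re: "Re (LINT x|lebesgue_on \<Omega>. cdot (c x) (\<phi> x)) = Re (LINT x|lebesgue_on \<Omega>. cdot (w x) (classical_curl \<phi> x))"
      if "smooth \<phi>" for \<phi>
      using r that wc by (simp add: Re_pair[symmetric] smooth_L2 classical_curl_L2)
    have "zero_trace_curl \<Omega> w c"
      unfolding zero_trace_curl_def
    proof (intro conjI allI impI wc complex_eqI)
      fix \<phi> :: "real^3 \<Rightarrow> complex^3" assume \<phi>: "smooth \<phi>"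
      show "Re (LINT x|lebesgue_on \<Omega>. cdot (c x) (\<phi> x)) = Re (LINT x|lebesgue_on \<Omega>. cdot (w x) (classical_curl \<phi> x))"
        using Re[OF \<phi>] .
      \<comment> \<open>This is \<open>\<i> *s \<phi> x\<close>, written with two conjugations so
        that the rules for \<open>vcnj (m *s \<phi> x)\<close> give its smoothness and its
        curl.\<close>
      define \<psi> where "\<psi> x = vcnj (1 *s vcnj (\<i> *s \<phi> x))" for x
      have \<psi>: "smooth \<psi>" unfolding \<psi>_def by (intro smooth_conj_cmult \<phi>)
      have "classical_curl \<psi> x = \<i> *s classical_curl \<phi> x" for x
        unfolding \<psi>_def[abs_def] classical_curl_conj_cmult[OF smooth_conj_cmult[OF \<phi>]] classical_curl_conj_cmult[OF \<phi>]
        by (simp add: vcnj_vcnj)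
      moreover have "\<psi> x = \<i> *s \<phi> x" for x by (simp add: \<psi>_def vcnj_vcnj)
      ultimately have "Re (\<i> * (LINT x|lebesgue_on \<Omega>. cdot (c x) (\<phi> x))) =
          Re (\<i> * (LINT x|lebesgue_on \<Omega>. cdot (w x) (classical_curl \<phi> x)))"
        using Re[OF \<psi>] by (simp add: cdot_commute[of _ "\<i> *s _"] cdot_mult_left cdot_commute[of "\<phi> _"]
            cdot_commute[of "classical_curl \<phi> _"])
      then show "Im (LINT x|lebesgue_on \<Omega>. cdot (c x) (\<phi> x)) = Im (LINT x|lebesgue_on \<Omega>. cdot (w x) (classical_curl \<phi> x))"
        by simp
    qed
    from image_eqI[OF _ zero_trace_curlD(1)[OF this], of z "graph_curl \<Omega>"] zero_trace_curlD(2)[OF this]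
    show ?l using wc(3) by simp
  qed
qed

lemma closed_graph_H0curl: "closed (graph_curl \<Omega> ` H0curl \<Omega>)"
proof -
  have "graph_curl \<Omega> ` H0curl \<Omega> = (fst -` (emb \<Omega> ` L2 \<Omega>) \<inter> snd -` (emb \<Omega> ` L2 \<Omega>)) \<inter>
     (\<Inter>\<phi>\<in>{\<phi>. smooth \<phi>}. {z. snd z \<bullet> emb \<Omega> (\<lambda>x. vcnj (\<phi> x)) = fst z \<bullet> emb \<Omega> (\<lambda>x. vcnj (classical_curl \<phi> x))})"
    by (rule set_eqI) (auto simp: graph_H0curl_iff)
  also have "closed \<dots>"
    by (intro closed_Int closed_INT ballI closed_vimage_fst closed_vimage_snd emb_image_closed dom_sets
        closed_Collect_eq continuous_intros)
  finally show ?thesis .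
qed

end

section \<open>Lowest-order edge elements\<close>

text \<open>An injective linear image inside a finitely generated span forces every basis of
  \<open>V\<close> to be finite. For edge elements \<open>f\<close> will forget the curl.\<close>

lemma closed_of_finite_dimensional_image:
  fixes V :: "'a::{real_inner,complete_space} set" and f :: "'a \<Rightarrow> 'b::real_vector"
  assumes V: "subspace V" and f: "linear f" and inj: "inj_on f V" and B: "finite B" "f ` V \<subseteq> span B"
  shows "closed V"
proof -
  obtain B' where B': "B' \<subseteq> V" "independent B'" "V \<subseteq> span B'"
    using maximal_independent_subset by blast
  have sp: "span B' = V" using B'(1,3) V by (metis span_minimal subset_antisym)
  have "independent (f ` B')"
    using linear_independent_injective_image[OF f B'(2)] inj sp by simp
  moreover have "f ` B' \<subseteq> span B" using B'(1) B(2) by blast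
  ultimately have "finite (f ` B')" using independent_span_bound[OF B(1)] by blast
  then have "finite B'" using finite_imageD inj_on_subset[OF inj B'(1)] by blast
  then show ?thesis using closed_span_finite sp by metis
qed

lemma range_in_span_Basis:
  fixes f :: "'a::euclidean_space \<Rightarrow> 'b::real_vector"
  assumes "linear f"
  shows "f x \<in> span (f ` Basis)"
proof -
  have "f x = (\<Sum>b\<in>Basis. (x \<bullet> b) *\<^sub>R f b)"
    using euclidean_representation[of x] linear_sum[OF assms] linear_scale[OF assms] by (metis (mono_tags, lifting) sum.cong)
  then show ?thesis by (simp add: span_sum span_scale span_base)
qed

lemma ccross_add_right: "ccross v (d + d') = ccross v d + ccross v d'"
  by (simp add: ccross_def vec_eq_iff forall_3 algebra_simps)

lemma ccross_scaleR_right: "ccross v (r *\<^sub>R d) = r *\<^sub>R ccross v d"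
  by (simp add: ccross_def vec_eq_iff forall_3 algebra_simps)

lemma ccross_zero_right: "ccross v 0 = 0"
  by (simp add: ccross_def vec_eq_iff forall_3)

lemma conj_ccross_cvec: "vcnj (m *s ccross (cvec x) d) = ccross (cvec x) (vcnj (m *s d))"
  by (simp add: ccross_def vec_eq_iff forall_3 vcnj_def cvec_def algebra_simps)

lemma continuous_on_ccross_cvec: "continuous_on S (\<lambda>x. ccross (cvec x) d)"
proof -
  have *: "continuous_on S (\<lambda>x. cvec x $ i)" for i
    unfolding cvec_def by (simp add: continuous_intros)
  have "\<forall>i. continuous_on S (\<lambda>x. ccross (cvec x) d $ i)"
    unfolding ccross_def by (simp add: forall_3 continuous_on_diff continuous_on_mult * continuous_on_const)
  then have "continuous_on S (\<lambda>x. \<chi> i. ccross (cvec x) d $ i)"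
    by (intro continuous_on_vec_lambda) blast
  then show ?thesis by simp
qed

context bounded_domain
begin

lemma emb_indicator_L2:
  fixes w :: "real^3 \<Rightarrow> complex^3"
  assumes "w \<in> L2 \<Omega>" "A \<in> sets lebesgue"
  shows "(\<lambda>x. indicator A x *\<^sub>R w x) \<in> L2 \<Omega>"
proof (rule L2_dominated[OF dom_sets _ assms(1), of _ 1])
  show "(\<lambda>x. indicat_real A x *\<^sub>R w x) \<in> borel_measurable (lebesgue_on \<Omega>)"
    using assms by (intro borel_measurable_scaleR L2_measurable measurable_restrict_space1 borel_measurable_indicator)
qed (auto simp: indicator_def)

text \<open>The elements are split off one after the other, the remainder being cut down to \<open>A - T\<close>; hence
  no property of the triangulation besides measurability of the elements is needed.\<close>

lemma piecewise_span:
  assumes "finite \<T>" "\<And>T. T \<in> \<T> \<Longrightarrow> T \<in> sets lebesgue" "A \<in> sets lebesgue"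
  shows "\<exists>B. finite B \<and> (\<forall>w. w \<in> L2 \<Omega> \<longrightarrow>
     (\<forall>T\<in>\<T>. \<exists>c d. AE x in lebesgue_on T. w x = c + ccross (cvec x) d) \<longrightarrow>
     emb \<Omega> (\<lambda>x. indicator (A \<inter> \<Union>\<T>) x *\<^sub>R w x) \<in> span B)"
  using assms
proof (induction \<T> arbitrary: A rule: finite_induct)
  case empty
  have "emb \<Omega> (\<lambda>x. 0) = (0 :: (real^3, complex^3) l2)"
    by (simp add: emb_def zero_l2_def)
  then show ?case by (intro exI[of _ "{}"]) auto
next
  case (insert T \<T>)
  have T: "T \<in> sets lebesgue" using insert.prems by simp
  have AT: "A \<inter> T \<in> sets lebesgue" "A - T \<in> sets lebesgue" using T insert.prems by auto
  have "\<exists>B. finite B \<and> (\<forall>w. w \<in> L2 \<Omega> \<longrightarrow>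
      (\<forall>T\<in>\<T>. \<exists>c d. AE x in lebesgue_on T. w x = c + ccross (cvec x) d) \<longrightarrow>
      emb \<Omega> (\<lambda>x. indicator ((A - T) \<inter> \<Union>\<T>) x *\<^sub>R w x) \<in> span B)"
    by (rule insert.IH[OF _ AT(2)]) (use insert.prems(1) in blast)
  then obtain B where B: "finite B" "\<And>w. w \<in> L2 \<Omega> \<Longrightarrow>
      (\<forall>T\<in>\<T>. \<exists>c d. AE x in lebesgue_on T. w x = c + ccross (cvec x) d) \<Longrightarrow>
      emb \<Omega> (\<lambda>x. indicator ((A - T) \<inter> \<Union>\<T>) x *\<^sub>R w x) \<in> span B"
    by blast
  \<comment> \<open>The local field with coefficient pair \<open>cd\<close>, cut off to
    \<open>A \<inter> T\<close>. It is linear in finitely many real parameters, so the images of the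
    basis vectors span all such fields.\<close>
  define p where "p cd x = indicator (A \<inter> T) x *\<^sub>R (fst cd + ccross (cvec x) (snd cd))" for cd :: "(complex^3) \<times> (complex^3)" and x
  have p: "p cd \<in> L2 \<Omega>" for cd
    unfolding p_def
    by (intro emb_indicator_L2 AT continuous_in_L2 dom_lmeasurable bounded_dom continuous_on_add
        continuous_on_const continuous_on_ccross_cvec)
  have lin: "linear (\<lambda>cd. emb \<Omega> (p cd))"
  proof
    show "emb \<Omega> (p (x + y)) = emb \<Omega> (p x) + emb \<Omega> (p y)" for x y
      using emb_add[OF dom_sets p p, of x y]
      by (simp add: p_def[abs_def] ccross_add_right scaleR_add_right add.assoc add.left_commute)
    show "emb \<Omega> (p (r *\<^sub>R x)) = r *\<^sub>R emb \<Omega> (p x)" for r x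
      using emb_scaleR[OF dom_sets p, of r x]
      by (simp add: p_def[abs_def] ccross_scaleR_right scaleR_add_right mult.commute)
  qed
  define B' where "B' = (\<lambda>cd. emb \<Omega> (p cd)) ` Basis \<union> B"
  have "emb \<Omega> (\<lambda>x. indicator (A \<inter> \<Union>(insert T \<T>)) x *\<^sub>R w x) \<in> span B'"
    if w: "w \<in> L2 \<Omega>" and aff: "\<forall>T\<in>insert T \<T>. \<exists>c d. AE x in lebesgue_on T. w x = c + ccross (cvec x) d" for w
  proof -
    have U: "\<Union>\<T> \<in> sets lebesgue" using insert.hyps(1) insert.prems(1) by (intro sets.finite_Union) auto
    obtain c d where cd: "AE x in lebesgue_on T. w x = c + ccross (cvec x) d" using aff by blast
    have "emb \<Omega> (\<lambda>x. indicator (A \<inter> T) x *\<^sub>R w x) = emb \<Omega> (p (c, d))"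
    proof (subst emb_eq_iff[OF dom_sets emb_indicator_L2[OF w AT(1)] p])
      from cd have "AE x in lebesgue. x \<in> T \<longrightarrow> w x = c + ccross (cvec x) d"
        using T by (simp add: AE_restrict_space_iff)
      then show "AE x in lebesgue_on \<Omega>. indicator (A \<inter> T) x *\<^sub>R w x = p (c, d) x"
        using dom_sets by (auto simp: AE_restrict_space_iff p_def indicator_def elim!: eventually_mono)
    qed
    then have 1: "emb \<Omega> (\<lambda>x. indicator (A \<inter> T) x *\<^sub>R w x) \<in> span B'"
      using range_in_span_Basis[OF lin, of "(c, d)"] span_mono[of _ B'] unfolding B'_def by auto
    have 2: "emb \<Omega> (\<lambda>x. indicator ((A - T) \<inter> \<Union>\<T>) x *\<^sub>R w x) \<in> span B'"
      using B(2)[OF w] aff span_mono[of B B'] unfolding B'_def by auto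
    have "(\<lambda>x. indicator (A \<inter> \<Union>(insert T \<T>)) x *\<^sub>R w x) =
        (\<lambda>x. indicator (A \<inter> T) x *\<^sub>R w x + indicator ((A - T) \<inter> \<Union>\<T>) x *\<^sub>R w x)"
      by (auto simp: indicator_def fun_eq_iff)
    then have "emb \<Omega> (\<lambda>x. indicator (A \<inter> \<Union>(insert T \<T>)) x *\<^sub>R w x) =
        emb \<Omega> (\<lambda>x. indicator (A \<inter> T) x *\<^sub>R w x) + emb \<Omega> (\<lambda>x. indicator ((A - T) \<inter> \<Union>\<T>) x *\<^sub>R w x)"
      using emb_add[OF dom_sets emb_indicator_L2[OF w AT(1)] emb_indicator_L2[OF w sets.Int[OF AT(2) U]]] by simp
    then show ?thesis using span_add[OF 1 2] by simp
  qed
  moreover have "finite B'" using B(1) by (simp add: B'_def)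
  ultimately show ?case by blast
qed

lemma nedelec_subset: "nedelec \<Omega> \<T> \<subseteq> H0curl \<Omega>"
  by (auto simp: nedelec_def)

text \<open>The local form survives because \<open>cvec x\<close> is real: conjugation and constant
  factors pass to the coefficients.\<close>

lemma nedelec_conj:
  assumes "w \<in> nedelec \<Omega> \<T>"
  shows "(\<lambda>x. vcnj (m *s w x)) \<in> nedelec \<Omega> \<T>"
proof -
  have "\<exists>c d. AE x in lebesgue_on T. vcnj (m *s w x) = c + ccross (cvec x) d" if T: "T \<in> \<T>" for T
  proof -
    obtain c d where "AE x in lebesgue_on T. w x = c + ccross (cvec x) d" using assms T by (auto simp: nedelec_def)
    then have "AE x in lebesgue_on T. vcnj (m *s w x) = vcnj (m *s c) + ccross (cvec x) (vcnj (m *s d))"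
      by eventually_elim (simp add: vector_add_ldistrib vcnj_add conj_ccross_cvec)
    then show ?thesis by blast
  qed
  then show ?thesis using assms graph_curl_conj(1)[of w m] by (simp add: nedelec_def)
qed

lemma subspace_nedelec: "subspace (graph_curl \<Omega> ` nedelec \<Omega> \<T>)"
proof (rule subspace_graph[OF nedelec_subset])
  have "\<exists>c d. AE x in lebesgue_on T. 0 = c + ccross (cvec x) d" for T
    by (intro exI[of _ 0]) (simp add: ccross_zero_right)
  then show "(\<lambda>x. 0) \<in> nedelec \<Omega> \<T>" by (simp add: nedelec_def zero_in_H0curl)
  fix v assume v: "v \<in> nedelec \<Omega> \<T>"
  have "\<exists>c d. AE x in lebesgue_on T. r *\<^sub>R v x = c + ccross (cvec x) d" if T: "T \<in> \<T>" for T r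
  proof -
    obtain c d where "AE x in lebesgue_on T. v x = c + ccross (cvec x) d" using v T by (auto simp: nedelec_def)
    then have "AE x in lebesgue_on T. r *\<^sub>R v x = r *\<^sub>R c + ccross (cvec x) (r *\<^sub>R d)"
      by eventually_elim (simp add: scaleR_add_right ccross_scaleR_right)
    then show ?thesis by blast
  qed
  then show "(\<lambda>x. r *\<^sub>R v x) \<in> nedelec \<Omega> \<T>" for r
    using v graph_curl_scaleR(1)[of v r] by (simp add: nedelec_def)
  fix w assume w: "w \<in> nedelec \<Omega> \<T>"
  have "\<exists>c d. AE x in lebesgue_on T. v x + w x = c + ccross (cvec x) d" if T: "T \<in> \<T>" for T
  proof -
    obtain c d where "AE x in lebesgue_on T. v x = c + ccross (cvec x) d" using v T by (auto simp: nedelec_def)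
    moreover obtain c' d' where "AE x in lebesgue_on T. w x = c' + ccross (cvec x) d'" using w T by (auto simp: nedelec_def)
    ultimately have "AE x in lebesgue_on T. v x + w x = (c + c') + ccross (cvec x) (d + d')"
      by eventually_elim (simp add: ccross_add_right)
    then show ?thesis by blast
  qed
  then show "(\<lambda>x. v x + w x) \<in> nedelec \<Omega> \<T>"
    using v w graph_curl_add(1)[of v w] by (simp add: nedelec_def)
qed

text \<open>A field determines its weak curl almost everywhere, so dropping the second component of
  the graph loses nothing.\<close>

lemma graph_curl_eq_fst:
  assumes "v \<in> H0curl \<Omega>" "w \<in> H0curl \<Omega>" "emb \<Omega> v = emb \<Omega> w"
  shows "graph_curl \<Omega> v = graph_curl \<Omega> w"
proof -
  have v: "v \<in> L2 \<Omega>" and w: "w \<in> L2 \<Omega>" and cw: "zero_trace_curl \<Omega> w (Curl \<Omega> w)"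
    using assms(1,2)[THEN H0curl_zero_trace] by (auto simp: zero_trace_curl_def)
  have ae: "AE x in lebesgue_on \<Omega>. v x = w x" using assms(3) emb_eq_iff[OF dom_sets v w] by simp
  have "(LINT x|lebesgue_on \<Omega>. cdot (v x) (classical_curl \<phi> x)) = (LINT x|lebesgue_on \<Omega>. cdot (w x) (classical_curl \<phi> x))"
    if "smooth \<phi>" for \<phi>
    using ae v w classical_curl_L2[OF that]
    by (intro integral_cong_AE borel_measurable_cdot L2_measurable) (auto elim!: eventually_mono)
  then have "zero_trace_curl \<Omega> v (Curl \<Omega> w)" using cw v by (simp add: zero_trace_curl_def)
  from zero_trace_curlD(2)[OF this] show ?thesis using assms(3) by (simp add: graph_curl_def)
qed

text \<open>On each of the finitely many elements the field is fixed by two constant vectors; the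
  first components of the graph therefore lie in a finite-dimensional span, and they determine the
  curls.\<close>

lemma closed_nedelec:
  assumes \<T>: "simplicial_mesh \<Omega> \<T>"
  shows "closed (graph_curl \<Omega> ` nedelec \<Omega> \<T>)"
proof -
  have fin: "finite \<T>" and meas: "\<And>T. T \<in> \<T> \<Longrightarrow> T \<in> sets lebesgue"
    using \<T> by (auto simp: simplicial_mesh_def triangulation_def
        intro!: fmeasurableD lmeasurable_compact polytope_imp_compact dest: simplex_imp_polytope)
  have cover: "\<Omega> \<subseteq> \<Union>\<T>" using \<T> closure_subset by (auto simp: simplicial_mesh_def)
  obtain B where B: "finite B" "\<And>w. w \<in> L2 \<Omega> \<Longrightarrow>
     (\<forall>T\<in>\<T>. \<exists>c d. AE x in lebesgue_on T. w x = c + ccross (cvec x) d) \<Longrightarrow>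
     emb \<Omega> (\<lambda>x. indicator (UNIV \<inter> \<Union>\<T>) x *\<^sub>R w x) \<in> span B"
    using piecewise_span[OF fin meas, of UNIV] by auto
  show ?thesis
  proof (rule closed_of_finite_dimensional_image[OF subspace_nedelec _ _ B(1)])
    show "linear (fst :: l2_pair \<Rightarrow> _)"
      by (simp add: bounded_linear.linear bounded_linear_fst)
    show "inj_on fst (graph_curl \<Omega> ` nedelec \<Omega> \<T>)"
    proof (rule inj_onI)
      fix y z assume "y \<in> graph_curl \<Omega> ` nedelec \<Omega> \<T>" "z \<in> graph_curl \<Omega> ` nedelec \<Omega> \<T>" "fst y = fst z"
      then obtain v w where vw: "v \<in> nedelec \<Omega> \<T>" "w \<in> nedelec \<Omega> \<T>" "y = graph_curl \<Omega> v" "z = graph_curl \<Omega> w"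
          "fst (graph_curl \<Omega> v) = fst (graph_curl \<Omega> w)" by blast
      then have "emb \<Omega> v = emb \<Omega> w" by (simp add: graph_curl_def)
      from graph_curl_eq_fst[OF subsetD[OF nedelec_subset vw(1)] subsetD[OF nedelec_subset vw(2)] this]
      show "y = z" using vw(3,4) by simp
    qed
    show "fst ` graph_curl \<Omega> ` nedelec \<Omega> \<T> \<subseteq> span B"
    proof
      fix X assume "X \<in> fst ` graph_curl \<Omega> ` nedelec \<Omega> \<T>"
      then obtain w where w: "w \<in> nedelec \<Omega> \<T>" and X: "X = fst (graph_curl \<Omega> w)" by blast
      then have wL: "w \<in> L2 \<Omega>" using H0curl_zero_trace by (auto simp: nedelec_def zero_trace_curl_def)
      have "emb \<Omega> (\<lambda>x. indicator (UNIV \<inter> \<Union>\<T>) x *\<^sub>R w x) \<in> span B"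
        using B(2)[OF wL] w by (simp add: nedelec_def)
      also have "emb \<Omega> (\<lambda>x. indicator (UNIV \<inter> \<Union>\<T>) x *\<^sub>R w x) = emb \<Omega> w"
        unfolding emb_def using cover by (intro arg_cong[where f = abs_l2]) (auto simp: indicator_def fun_eq_iff)
      finally show "X \<in> span B" by (simp add: X graph_curl_def)
    qed
  qed
qed

end

section \<open>The Maxwell form\<close>

text \<open>The coefficient is controlled in the domain only, hence the indicator; outside,
  \<open>inverse 0 = 0\<close> makes the weight vanish.\<close>

definition mu_weight :: "'l maxwell \<Rightarrow> real^3 \<Rightarrow> complex" where
  "mu_weight M x = complex_of_real (inverse (indicator (dom M) x *\<^sub>R mu M x))"

text \<open>Contains the sign and the factor \<open>(freq M)\<^sup>2\<close> of the mass term, so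
  that the whole form is the curl part plus the sum of the mass parts weighted by
  \<open>u $ k\<close>.\<close>

definition eps_weight :: "'l maxwell \<Rightarrow> 'l \<Rightarrow> real^3 \<Rightarrow> complex" where
  "eps_weight M k x = - complex_of_real ((freq M)\<^sup>2) * (indicator (part M k) x *
     (complex_of_real (indicator (dom M) x *\<^sub>R eps M x) + \<i> * complex_of_real (indicator (dom M) x *\<^sub>R sig M x / freq M)))"

definition curl_operator :: "'l maxwell \<Rightarrow> l2_pair \<Rightarrow> l2_pair" where
  "curl_operator M z = (0, conj_mult (mu_weight M) (snd z))"

definition mass_operator :: "'l maxwell \<Rightarrow> 'l \<Rightarrow> l2_pair \<Rightarrow> l2_pair" where
  "mass_operator M k z = (conj_mult (eps_weight M k) (fst z), 0)"

text \<open>The two conjugations cancel and the factors combine to \<open>m * cnj m\<close>. So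
  \<open>conj_mult2 m\<close> with \<open>m \<noteq> 0\<close> is its own inverse up to a positive
  scaling, which is how invariant spaces are mapped onto themselves.\<close>

lemma conj_mult2_conj_mult2: "conj_mult2 m (conj_mult2 m z) = (norm m)\<^sup>2 *\<^sub>R z"
proof -
  have "conj_mult (\<lambda>_. m) (conj_mult (\<lambda>_. m) X) = (norm m)\<^sup>2 *\<^sub>R X" for X
  proof -
    note c = essentially_bounded_const[of m]
    have r: "square_integrable (rep_l2 X)" by (rule square_integrable_rep)
    have "vcnj (m *s vcnj (m *s v)) = (norm m)\<^sup>2 *\<^sub>R v" for v
      by (simp add: vcnj_mult vcnj_vcnj vector_smult_assoc complex_norm_square[symmetric] mult.commute cmult_of_real[symmetric] del: of_real_power)
    moreover have "conj_mult (\<lambda>_. m) (conj_mult (\<lambda>_. m) X) = abs_l2 (\<lambda>x. vcnj (m *s vcnj (m *s rep_l2 X x)))"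
      unfolding conj_mult_def[of _ X] by (rule conj_mult_abs[OF c square_integrable_conj_mult[OF c r]])
    ultimately show ?thesis by (simp add: abs_l2_scaleR r abs_rep_l2)
  qed
  then show ?thesis by (simp add: conj_mult2_def prod_eq_iff)
qed

lemma bounded_linear_conj_mult2: "bounded_linear (conj_mult2 m)"
  unfolding conj_mult2_def
  by (intro bounded_linear_Pair bounded_linear_compose[OF bounded_linear_conj_mult[OF essentially_bounded_const]]
      bounded_linear_fst bounded_linear_snd)

lemma norm_conj_mult2_le: "norm (conj_mult2 m z) \<le> norm m * norm z"
proof -
  have "norm (conj_mult2 m z) \<le> sqrt ((norm m * norm (fst z))\<^sup>2 + (norm m * norm (snd z))\<^sup>2)"
    unfolding conj_mult2_def norm_Pair
    by (intro real_sqrt_le_mono add_mono power_mono norm_conj_mult[OF essentially_bounded_const]) auto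
  also have "\<dots> = norm m * norm z"
    by (simp add: norm_prod_def power_mult_distrib real_sqrt_mult flip: distrib_left)
  finally show ?thesis .
qed

context bounded_domain
begin

lemma conj_mult2_image:
  assumes m: "m \<noteq> 0" and V: "V \<subseteq> H0curl \<Omega>" "subspace (graph_curl \<Omega> ` V)"
    and conj: "\<And>w m. w \<in> V \<Longrightarrow> (\<lambda>x. vcnj (m *s w x)) \<in> V"
  shows "conj_mult2 m ` graph_curl \<Omega> ` V = graph_curl \<Omega> ` V"
proof -
  have sub: "conj_mult2 m z \<in> graph_curl \<Omega> ` V" if z: "z \<in> graph_curl \<Omega> ` V" for z
  proof -
    obtain w where w: "w \<in> V" "z = graph_curl \<Omega> w" using z by blast
    then have "conj_mult2 m z = graph_curl \<Omega> (\<lambda>x. vcnj (m *s w x))" using graph_curl_conj(2)[of w m] V(1) by auto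
    then show ?thesis using conj[OF w(1)] by blast
  qed
  have "z \<in> conj_mult2 m ` graph_curl \<Omega> ` V" if z: "z \<in> graph_curl \<Omega> ` V" for z
  proof (rule image_eqI)
    show "(1 / (norm m)\<^sup>2) *\<^sub>R conj_mult2 m z \<in> graph_curl \<Omega> ` V"
      using subspace_scale[OF V(2) sub[OF z]] .
    show "z = conj_mult2 m ((1 / (norm m)\<^sup>2) *\<^sub>R conj_mult2 m z)"
      using m by (simp add: linear_simps[OF bounded_linear_conj_mult2] conj_mult2_conj_mult2)
  qed
  then show ?thesis using sub by blast
qed

lemma L2_mult_fun:
  fixes v :: "real^3 \<Rightarrow> complex^3"
  assumes "essentially_bounded m C" "v \<in> L2 \<Omega>"
  shows "(\<lambda>x. m x *s v x) \<in> L2 \<Omega>"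
  using L2_conj_mult[OF dom_sets L2_conj_mult_fun[OF assms(1) dom_sets assms(2)], of 1] by (simp add: vcnj_vcnj)

lemma integrable_mult_cdot:
  assumes "essentially_bounded m C" "v \<in> L2 \<Omega>" "w \<in> L2 \<Omega>"
  shows "integrable (lebesgue_on \<Omega>) (\<lambda>x. m x * cdot (v x) (w x))"
  using integrable_cdot[OF dom_sets L2_mult_fun[OF assms(1,2)] assms(3)] by (simp add: cdot_mult_left)

lemma integrable_norm_square: "v \<in> L2 \<Omega> \<Longrightarrow> integrable (lebesgue_on \<Omega>) (\<lambda>x. (norm (v x))\<^sup>2)"
  by (simp add: L2_def)

lemma cdot_vcnj_cmult: "cdot v (vcnj (m *s v)) = cnj m * complex_of_real ((norm v)\<^sup>2)"
proof -
  have "cdot v (vcnj v) = complex_of_real ((norm v)\<^sup>2)"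
    by (simp add: cdot_def vcnj_def norm_vec_def L2_set_def complex_norm_square sum_nonneg del: of_real_power)
  then show ?thesis by (simp add: vcnj_mult cdot_commute[of v] cdot_mult_left)
qed

text \<open>The test field is a constant times \<open>v\<close>, conjugated, so the pairing
  collapses to a weighted integral of \<open>(norm (v x))\<^sup>2\<close>. Coercivity becomes a
  pointwise lower bound for \<open>Re (m x * cnj \<tau>)\<close>.\<close>

lemma conj_mult_T_inner:
  assumes m: "essentially_bounded m C" and v: "v \<in> L2 \<Omega>"
  shows "conj_mult m (emb \<Omega> v) \<bullet> conj_mult (\<lambda>_. \<tau>) (emb \<Omega> v) =
     (LINT x|lebesgue_on \<Omega>. Re (m x * cnj \<tau>) * (norm (v x))\<^sup>2)"
    and "integrable (lebesgue_on \<Omega>) (\<lambda>x. Re (m x * cnj \<tau>) * (norm (v x))\<^sup>2)"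
proof -
  have vt: "(\<lambda>x. vcnj (\<tau> *s v x)) \<in> L2 \<Omega>" by (rule L2_conj_mult[OF dom_sets v])
  have i: "integrable (lebesgue_on \<Omega>) (\<lambda>x. m x * cdot (v x) (vcnj (\<tau> *s v x)))"
    by (rule integrable_mult_cdot[OF m v vt])
  have eq: "Re (m x * cdot (v x) (vcnj (\<tau> *s v x))) = Re (m x * cnj \<tau>) * (norm (v x))\<^sup>2" for x
    by (simp add: cdot_vcnj_cmult mult.assoc[symmetric] del: of_real_power)
  have "conj_mult m (emb \<Omega> v) \<bullet> conj_mult (\<lambda>_. \<tau>) (emb \<Omega> v) =
      Re (LINT x|lebesgue_on \<Omega>. m x * cdot (v x) (vcnj (\<tau> *s v x)))"
    using conj_mult_inner_emb[OF m dom_sets v vt]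
    by (simp add: conj_mult_emb[OF essentially_bounded_const dom_sets v])
  also have "\<dots> = (LINT x|lebesgue_on \<Omega>. Re (m x * cdot (v x) (vcnj (\<tau> *s v x))))"
    by (rule integral_Re[OF i, symmetric])
  finally show "conj_mult m (emb \<Omega> v) \<bullet> conj_mult (\<lambda>_. \<tau>) (emb \<Omega> v) = (LINT x|lebesgue_on \<Omega>. Re (m x * cnj \<tau>) * (norm (v x))\<^sup>2)"
    unfolding eq .
  show "integrable (lebesgue_on \<Omega>) (\<lambda>x. Re (m x * cnj \<tau>) * (norm (v x))\<^sup>2)"
    using integrable_Re[OF i] unfolding eq .
qed

end

lemma borel_measurable_complex_of_real:
  "f \<in> borel_measurable N \<Longrightarrow> (\<lambda>x. complex_of_real (f x)) \<in> borel_measurable N"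
  by (rule borel_measurable_continuous_on) (intro continuous_intros)

section \<open>Bounds for the material weights and coercivity\<close>

locale maxwell_setting =
  fixes M :: "'l::finite maxwell"
  assumes data: "maxwell_data M"

sublocale maxwell_setting \<subseteq> bounded_domain "dom M"
  using data by unfold_locales (auto simp: maxwell_data_def)

context maxwell_setting
begin

abbreviation "\<omega> \<equiv> freq M"

lemma freq_pos: "\<omega> > 0"
  using data by (simp add: maxwell_data_def)

lemma part_sets: "part M k \<in> sets lebesgue" and part_subset: "part M k \<subseteq> dom M"
  using data sets_completionI_sets[of "part M k" lborel] by (auto simp: maxwell_data_def domain_partition_def)

lemma part_indicator_sum: "AE x in lebesgue_on (dom M). (\<Sum>k\<in>UNIV. indicator (part M k) x) = (1::real)"
proof -
  have disj: "k \<noteq> l \<Longrightarrow> part M k \<inter> part M l = {}" for k l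
    using data by (auto simp: maxwell_data_def domain_partition_def)
  have "negligible (dom M - (\<Union>k. part M k))" using data by (simp add: maxwell_data_def domain_partition_def)
  then have "AE x in lebesgue. x \<notin> dom M - (\<Union>k. part M k)"
    by (intro AE_not_in) (simp add: negligible_iff_null_sets)
  then have "AE x in lebesgue. x \<in> dom M \<longrightarrow> (\<Sum>k\<in>UNIV. indicator (part M k) x) = (1::real)"
  proof eventually_elim
    case (elim x)
    show ?case
    proof
      assume "x \<in> dom M"
      then obtain k where k: "x \<in> part M k" using elim by blast
      then have "indicator (part M l) x = (if l = k then 1 else 0 :: real)" for l
        using disj[of l k] by (auto simp: indicator_def)
      then show "(\<Sum>k\<in>UNIV. indicator (part M k) x) = (1::real)" by simp
    qed
  qed
  then show ?thesis using dom_sets by (simp add: AE_restrict_space_iff)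
qed

lemma Linf_measurable:
  fixes f :: "real^3 \<Rightarrow> real"
  assumes "f \<in> Linf (dom M)"
  shows "(\<lambda>x. indicator (dom M) x *\<^sub>R f x) \<in> borel_measurable lebesgue"
  using assms dom_sets by (simp add: Linf_def borel_measurable_restrict_space_iff)

lemma mu_weight_bounds:
  "\<exists>C. essentially_bounded (mu_weight M) C"
  "\<exists>c>0. AE x in lebesgue_on (dom M). c \<le> Re (mu_weight M x)"
proof -
  obtain \<mu>0 where \<mu>0: "\<mu>0 > 0" "AE x in lebesgue_on (dom M). \<mu>0 \<le> mu M x"
    using data by (auto simp: maxwell_data_def)
  have mu: "mu M \<in> Linf (dom M)" using data by (simp add: maxwell_data_def)
  then obtain C where C: "AE x in lebesgue_on (dom M). norm (mu M x) \<le> C" by (auto simp: Linf_def)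
  have "mu_weight M \<in> borel_measurable lebesgue"
    unfolding mu_weight_def using Linf_measurable[OF mu]
    by (intro borel_measurable_complex_of_real borel_measurable_inverse)
  moreover have "AE x in lebesgue. norm (mu_weight M x) \<le> 1 / \<mu>0"
  proof -
    have "AE x in lebesgue. x \<in> dom M \<longrightarrow> \<mu>0 \<le> mu M x" using \<mu>0(2) dom_sets by (simp add: AE_restrict_space_iff)
    then show ?thesis
    proof eventually_elim
      case (elim x)
      then show ?case using \<mu>0(1)
        by (cases "x \<in> dom M") (auto simp: mu_weight_def norm_inverse inverse_eq_divide norm_divide intro!: divide_left_mono)
    qed
  qed
  ultimately have "essentially_bounded (mu_weight M) (1 / \<mu>0)" using \<mu>0(1) by (simp add: essentially_bounded_def)
  then show "\<exists>C. essentially_bounded (mu_weight M) C" by blast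
  show "\<exists>c>0. AE x in lebesgue_on (dom M). c \<le> Re (mu_weight M x)"
  proof (intro exI conjI)
    \<comment> \<open>The maximum makes the bound positive whatever the sign of
      \<open>C\<close>.\<close>
    define C' where "C' = max C \<mu>0"
    show "1 / C' > 0" using \<mu>0(1) by (simp add: C'_def)
    have "AE x in lebesgue_on (dom M). x \<in> dom M" by (rule AE_I2) simp
    with \<mu>0(2) C show "AE x in lebesgue_on (dom M). 1 / C' \<le> Re (mu_weight M x)"
    proof eventually_elim
      case (elim x)
      then have "0 < mu M x" "mu M x \<le> C'" using \<mu>0(1) by (auto simp: C'_def)
      then show ?case using elim(3) by (auto simp: mu_weight_def inverse_eq_divide intro!: divide_left_mono mult_pos_pos)
    qed
  qed
qed

text \<open>For the second claim note that \<open>cnj (Complex 1 (- K))\<close> is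
  \<open>1 + \<i>K\<close>; on a piece the real part equals
  \<open>K * \<omega> * sig M x - \<omega>\<^sup>2 * eps M x\<close>.\<close>

lemma eps_weight_bounds:
  "\<exists>C. \<forall>k. essentially_bounded (eps_weight M k) C"
  "\<exists>K. AE x in lebesgue_on (dom M). \<forall>k. indicator (part M k) x \<le> Re (eps_weight M k x * cnj (Complex 1 (- K)))"
proof -
  obtain e E where e: "e > 0" and eE: "AE x in lebesgue_on (dom M). e \<le> eps M x \<and> eps M x \<le> E"
    using data by (auto simp: maxwell_data_def)
  obtain s S where s: "s > 0" and sS: "AE x in lebesgue_on (dom M). s \<le> sig M x \<and> sig M x \<le> S"
    using data by (auto simp: maxwell_data_def)
  have lin: "eps M \<in> Linf (dom M)" "sig M \<in> Linf (dom M)" using data by (auto simp: maxwell_data_def)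
  have meas: "eps_weight M k \<in> borel_measurable lebesgue" for k
    unfolding eps_weight_def using Linf_measurable[OF lin(1)] Linf_measurable[OF lin(2)] part_sets[of k]
    by (intro borel_measurable_times borel_measurable_add borel_measurable_complex_of_real borel_measurable_const
        borel_measurable_divide borel_measurable_indicator)
  define C where "C = \<omega>\<^sup>2 * (\<bar>E\<bar> + \<bar>S\<bar> / \<omega>)"
  have C0: "C \<ge> 0" using freq_pos by (simp add: C_def)
  from eE sS have b: "AE x in lebesgue_on (dom M). (e \<le> eps M x \<and> eps M x \<le> E) \<and> (s \<le> sig M x \<and> sig M x \<le> S)"
    by eventually_elim blast
  have "AE x in lebesgue. x \<in> dom M \<longrightarrow> (e \<le> eps M x \<and> eps M x \<le> E) \<and> (s \<le> sig M x \<and> sig M x \<le> S)"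
    by (rule AE_restrict_space_iff[THEN iffD1, OF _ b]) (simp add: dom_sets)
  then have "AE x in lebesgue. norm (eps_weight M k x) \<le> C" for k
  proof eventually_elim
    case (elim x)
    show ?case
    proof (cases "x \<in> part M k")
      case True
      then have x: "x \<in> dom M" using part_subset by blast
      then have b: "0 \<le> eps M x" "eps M x \<le> \<bar>E\<bar>" "0 \<le> sig M x" "sig M x \<le> \<bar>S\<bar>" using elim e s by auto
      have "norm (eps_weight M k x) = \<omega>\<^sup>2 * norm (complex_of_real (eps M x) + \<i> * complex_of_real (sig M x / \<omega>))"
        using True x by (simp add: eps_weight_def norm_mult norm_power)
      also have "\<dots> \<le> \<omega>\<^sup>2 * (norm (complex_of_real (eps M x)) + norm (\<i> * complex_of_real (sig M x / \<omega>)))"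
        by (intro mult_left_mono norm_triangle_ineq) simp
      also have "\<dots> \<le> C"
        unfolding C_def using b freq_pos
        by (intro mult_left_mono add_mono) (auto simp: norm_mult norm_divide divide_right_mono)
      finally show ?thesis .
    qed (use C0 in \<open>simp add: eps_weight_def\<close>)
  qed
  then show "\<exists>C. \<forall>k. essentially_bounded (eps_weight M k) C"
    using meas C0 by (auto simp: essentially_bounded_def)
  \<comment> \<open>Solves \<open>K * (\<omega> * s) = 1 + \<omega>\<^sup>2 * \<bar>E\<bar>\<close>:
    the second summand absorbs the permittivity, and the 1 remains as lower bound.\<close>
  define K where "K = (1 + \<omega>\<^sup>2 * \<bar>E\<bar>) / (\<omega> * s)"
  have dom: "AE x in lebesgue_on (dom M). x \<in> dom M" by (rule AE_I2) simp
  from eE sS dom have "AE x in lebesgue_on (dom M). \<forall>k. indicator (part M k) x \<le> Re (eps_weight M k x * cnj (Complex 1 (- K)))"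
  proof eventually_elim
    case (elim x)
    have "K * (\<omega> * s) = 1 + \<omega>\<^sup>2 * \<bar>E\<bar>" using freq_pos s by (simp add: K_def)
    moreover have "K * (\<omega> * s) \<le> K * (\<omega> * sig M x)"
      using elim freq_pos s by (intro mult_left_mono) (auto simp: K_def)
    moreover have "\<omega>\<^sup>2 * eps M x \<le> \<omega>\<^sup>2 * \<bar>E\<bar>" using elim by (intro mult_left_mono) auto
    ultimately have "1 \<le> K * \<omega> * sig M x - \<omega>\<^sup>2 * eps M x" by (simp add: mult.assoc)
    moreover have "Re (eps_weight M k x * cnj (Complex 1 (- K))) = indicator (part M k) x * (K * \<omega> * sig M x - \<omega>\<^sup>2 * eps M x)" for k
      using elim freq_pos by (simp add: eps_weight_def indicator_def field_simps power2_eq_square)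
    ultimately show ?case by (simp add: indicator_def)
  qed
  then show "\<exists>K. AE x in lebesgue_on (dom M). \<forall>k. indicator (part M k) x \<le> Re (eps_weight M k x * cnj (Complex 1 (- K)))" by blast
qed

end

context maxwell_setting
begin

text \<open>The left side realises a complex bilinear expression, while \<open>aform\<close>
  conjugates its second argument; this is why the test field appears conjugated on the
  right.\<close>

lemma operator_form:
  assumes y: "y \<in> H0curl (dom M)" and w: "w \<in> H0curl (dom M)"
  shows "(curl_operator M (graph_curl (dom M) y) + (\<Sum>k\<in>UNIV. u $ k *\<^sub>R mass_operator M k (graph_curl (dom M) y))) \<bullet>
      graph_curl (dom M) w = Re (aform M u y (\<lambda>x. vcnj (w x)))"
proof -
  let ?\<Omega> = "dom M"
  have L: "y \<in> L2 ?\<Omega>" "w \<in> L2 ?\<Omega>" "Curl ?\<Omega> y \<in> L2 ?\<Omega>" "Curl ?\<Omega> w \<in> L2 ?\<Omega>"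
    using y[THEN H0curl_zero_trace] w[THEN H0curl_zero_trace] by (auto simp: zero_trace_curl_def)
  obtain C0 where C0: "essentially_bounded (mu_weight M) C0" using mu_weight_bounds(1) by blast
  obtain C1 where C1: "\<And>k. essentially_bounded (eps_weight M k) C1" using eps_weight_bounds(1) by blast
  have AEdom: "AE x in lebesgue_on ?\<Omega>. x \<in> ?\<Omega>" by (rule AE_I2) simp
  have muL: "(\<lambda>x. complex_of_real (inverse (mu M x))) \<in> borel_measurable (lebesgue_on ?\<Omega>)"
    using data by (intro borel_measurable_complex_of_real borel_measurable_inverse) (simp add: maxwell_data_def Linf_def)
  have curl_eq: "AE x in lebesgue_on ?\<Omega>. Curl ?\<Omega> (\<lambda>x. vcnj (w x)) x = vcnj (Curl ?\<Omega> w x)"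
    and wc: "(\<lambda>x. vcnj (w x)) \<in> H0curl ?\<Omega>"
    using graph_curl_conj(1,3)[OF w, of 1] by simp_all
  have Lc: "Curl ?\<Omega> (\<lambda>x. vcnj (w x)) \<in> L2 ?\<Omega>" using H0curl_zero_trace[OF wc] by (simp add: zero_trace_curl_def)
  have "ip ?\<Omega> (\<lambda>x. complex_of_real (inverse (mu M x)) *s Curl ?\<Omega> y x) (Curl ?\<Omega> (\<lambda>x. vcnj (w x))) =
      (LINT x|lebesgue_on ?\<Omega>. mu_weight M x * cdot (Curl ?\<Omega> y x) (Curl ?\<Omega> w x))"
    unfolding ip_def
  proof (rule integral_cong_AE)
    show "AE x in lebesgue_on ?\<Omega>. cdot (complex_of_real (inverse (mu M x)) *s Curl ?\<Omega> y x) (vcnj (Curl ?\<Omega> (\<lambda>x. vcnj (w x)) x)) =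
        mu_weight M x * cdot (Curl ?\<Omega> y x) (Curl ?\<Omega> w x)"
      using curl_eq AEdom by eventually_elim (simp add: cdot_mult_left vcnj_vcnj mu_weight_def)
    show "(\<lambda>x. mu_weight M x * cdot (Curl ?\<Omega> y x) (Curl ?\<Omega> w x)) \<in> borel_measurable (lebesgue_on ?\<Omega>)"
      using integrable_mult_cdot[OF C0 L(3,4)] by (rule borel_measurable_integrable)
    show "(\<lambda>x. cdot (complex_of_real (inverse (mu M x)) *s Curl ?\<Omega> y x) (vcnj (Curl ?\<Omega> (\<lambda>x. vcnj (w x)) x))) \<in> borel_measurable (lebesgue_on ?\<Omega>)"
      using L(3) Lc by (intro borel_measurable_cdot borel_measurable_cmult borel_measurable_vcnj muL L2_measurable)
  qed
  then have curl: "curl_operator M (graph_curl ?\<Omega> y) \<bullet> graph_curl ?\<Omega> w =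
      Re (ip ?\<Omega> (\<lambda>x. complex_of_real (inverse (mu M x)) *s Curl ?\<Omega> y x) (Curl ?\<Omega> (\<lambda>x. vcnj (w x))))"
    using conj_mult_inner_emb[OF C0 dom_sets L(3,4)] by (simp add: curl_operator_def graph_curl_def)
  have mass: "mass_operator M k (graph_curl ?\<Omega> y) \<bullet> graph_curl ?\<Omega> w =
      Re (LINT x|lebesgue_on ?\<Omega>. eps_weight M k x * cdot (y x) (w x))" for k
    using conj_mult_inner_emb[OF C1 dom_sets L(1,2)] by (simp add: mass_operator_def graph_curl_def)
  have ik: "integrable (lebesgue_on ?\<Omega>) (\<lambda>x. complex_of_real (u $ k) * (eps_weight M k x * cdot (y x) (w x)))" for k
    using integrable_mult_cdot[OF C1 L(1,2), of k] by simp
  \<comment> \<open>Distributes the piecewise coefficient over the pieces, which exhibits the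
    operator as affine in the control.\<close>
  have "- complex_of_real (\<omega>\<^sup>2) * ip ?\<Omega> (\<lambda>x. coef M u x *s y x) (\<lambda>x. vcnj (w x)) =
      (LINT x|lebesgue_on ?\<Omega>. (\<Sum>k\<in>UNIV. complex_of_real (u $ k) * (eps_weight M k x * cdot (y x) (w x))))"
    unfolding ip_def integral_mult_right_zero[symmetric]
  proof (rule Bochner_Integration.integral_cong)
    fix x assume "x \<in> space (lebesgue_on ?\<Omega>)"
    then have x: "x \<in> ?\<Omega>" by simp
    have "- complex_of_real (\<omega>\<^sup>2) * (if x \<in> part M k then complex_of_real (u $ k) * eps_sigma M x else 0) =
        complex_of_real (u $ k) * eps_weight M k x" for k
      using x by (simp add: eps_weight_def eps_sigma_def indicator_def)
    then have "- complex_of_real (\<omega>\<^sup>2) * coef M u x = (\<Sum>k\<in>UNIV. complex_of_real (u $ k) * eps_weight M k x)"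
      by (simp add: coef_def sum_distrib_left)
    then show "- complex_of_real (\<omega>\<^sup>2) * cdot (coef M u x *s y x) (vcnj (vcnj (w x))) =
        (\<Sum>k\<in>UNIV. complex_of_real (u $ k) * (eps_weight M k x * cdot (y x) (w x)))"
      by (simp add: cdot_mult_left vcnj_vcnj mult.assoc[symmetric] sum_distrib_right[symmetric])
  qed simp
  also have "\<dots> = (\<Sum>k\<in>UNIV. complex_of_real (u $ k) * (LINT x|lebesgue_on ?\<Omega>. eps_weight M k x * cdot (y x) (w x)))"
    using ik by (subst Bochner_Integration.integral_sum) auto
  finally have "Re (- complex_of_real (\<omega>\<^sup>2) * ip ?\<Omega> (\<lambda>x. coef M u x *s y x) (\<lambda>x. vcnj (w x))) =
      (\<Sum>k\<in>UNIV. u $ k * (mass_operator M k (graph_curl ?\<Omega> y) \<bullet> graph_curl ?\<Omega> w))"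
    by (simp add: mass Re_sum)
  then show ?thesis
    by (simp add: aform_def inner_add_left inner_sum_left curl)
qed

text \<open>Testing with \<open>(1 - \<i>K) y\<close> conjugated makes the absorption dominate the indefinite mass term.\<close>

lemma operator_coercive:
  "\<exists>K c0. c0 > 0 \<and> (\<forall>\<beta>>0. \<forall>u. (\<forall>k. \<beta> \<le> u $ k) \<longrightarrow> (\<forall>z \<in> graph_curl (dom M) ` H0curl (dom M).
     min c0 \<beta> * (norm z)\<^sup>2 \<le>
     (curl_operator M z + (\<Sum>k\<in>UNIV. u $ k *\<^sub>R mass_operator M k z)) \<bullet> conj_mult2 (Complex 1 (- K)) z))"
proof -
  let ?\<Omega> = "dom M"
  obtain C0 where C0: "essentially_bounded (mu_weight M) C0" using mu_weight_bounds(1) by blast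
  obtain C1 where C1: "\<And>k. essentially_bounded (eps_weight M k) C1" using eps_weight_bounds(1) by blast
  obtain c0 where c0: "c0 > 0" "AE x in lebesgue_on ?\<Omega>. c0 \<le> Re (mu_weight M x)" using mu_weight_bounds(2) by blast
  obtain K where K: "AE x in lebesgue_on ?\<Omega>. \<forall>k. indicator (part M k) x \<le> Re (eps_weight M k x * cnj (Complex 1 (- K)))"
    using eps_weight_bounds(2) by blast
  let ?\<tau> = "Complex 1 (- K)"
  have "min c0 \<beta> * (norm z)\<^sup>2 \<le> (curl_operator M z + (\<Sum>k\<in>UNIV. u $ k *\<^sub>R mass_operator M k z)) \<bullet> conj_mult2 ?\<tau> z"
    if \<beta>: "\<beta> > 0" and u: "\<And>k. \<beta> \<le> u $ k" and z: "z \<in> graph_curl ?\<Omega> ` H0curl ?\<Omega>" for \<beta> u z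
  proof -
    obtain y where y: "y \<in> H0curl ?\<Omega>" "z = graph_curl ?\<Omega> y" using z by blast
    have L: "y \<in> L2 ?\<Omega>" "Curl ?\<Omega> y \<in> L2 ?\<Omega>"
      using y(1)[THEN H0curl_zero_trace] by (auto simp: zero_trace_curl_def)
    have "curl_operator M z \<bullet> conj_mult2 ?\<tau> z = (LINT x|lebesgue_on ?\<Omega>. Re (mu_weight M x * cnj ?\<tau>) * (norm (Curl ?\<Omega> y x))\<^sup>2)"
      using conj_mult_T_inner(1)[OF C0 L(2), of ?\<tau>] by (simp add: y(2) graph_curl_def curl_operator_def conj_mult2_def)
    also have "\<dots> \<ge> (LINT x|lebesgue_on ?\<Omega>. c0 * (norm (Curl ?\<Omega> y x))\<^sup>2)"
    proof (rule integral_mono_AE)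
      show "AE x in lebesgue_on ?\<Omega>. c0 * (norm (Curl ?\<Omega> y x))\<^sup>2 \<le> Re (mu_weight M x * cnj ?\<tau>) * (norm (Curl ?\<Omega> y x))\<^sup>2"
      proof -
        \<comment> \<open>The weight of the curl term is real, so the imaginary part of the test
          factor drops out.\<close>
        have "Re (complex_of_real r * cnj ?\<tau>) = Re (complex_of_real r)" for r by simp
        then have "Re (mu_weight M x * cnj ?\<tau>) = Re (mu_weight M x)" for x by (simp only: mu_weight_def)
        then show ?thesis
          using c0(2) by (simp only:) (auto elim!: eventually_mono intro!: mult_right_mono)
      qed
      show "integrable (lebesgue_on ?\<Omega>) (\<lambda>x. c0 * (norm (Curl ?\<Omega> y x))\<^sup>2)"
        using integrable_norm_square[OF L(2)] by simp
    qed (rule conj_mult_T_inner(2)[OF C0 L(2)])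
    finally have 1: "c0 * (norm (emb ?\<Omega> (Curl ?\<Omega> y)))\<^sup>2 \<le> curl_operator M z \<bullet> conj_mult2 ?\<tau> z"
      by (simp add: norm_emb[OF dom_sets L(2)] norm_L2_def)
    have mk: "mass_operator M k z \<bullet> conj_mult2 ?\<tau> z = (LINT x|lebesgue_on ?\<Omega>. Re (eps_weight M k x * cnj ?\<tau>) * (norm (y x))\<^sup>2)" for k
      using conj_mult_T_inner(1)[OF C1 L(1), of k ?\<tau>] by (simp add: y(2) graph_curl_def mass_operator_def conj_mult2_def)
    have ik: "integrable (lebesgue_on ?\<Omega>) (\<lambda>x. u $ k * (Re (eps_weight M k x * cnj ?\<tau>) * (norm (y x))\<^sup>2))" for k
      using conj_mult_T_inner(2)[OF C1 L(1)] by (rule integrable_mult_right)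
    have "(\<Sum>k\<in>UNIV. u $ k *\<^sub>R mass_operator M k z) \<bullet> conj_mult2 ?\<tau> z =
        (LINT x|lebesgue_on ?\<Omega>. (\<Sum>k\<in>UNIV. u $ k * (Re (eps_weight M k x * cnj ?\<tau>) * (norm (y x))\<^sup>2)))"
      by (subst Bochner_Integration.integral_sum[OF ik]) (simp add: inner_sum_left mk)
    also have "\<dots> \<ge> (LINT x|lebesgue_on ?\<Omega>. \<beta> * (norm (y x))\<^sup>2)"
    proof (rule integral_mono_AE)
      show "AE x in lebesgue_on ?\<Omega>. \<beta> * (norm (y x))\<^sup>2 \<le> (\<Sum>k\<in>UNIV. u $ k * (Re (eps_weight M k x * cnj ?\<tau>) * (norm (y x))\<^sup>2))"
        using K part_indicator_sum
      proof eventually_elim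
        case (elim x)
        \<comment> \<open>The piece indicators sum to 1 almost everywhere; the square is split over
          the pieces and compared there with \<open>u $ k\<close> times the weight.\<close>
        have "\<beta> * (norm (y x))\<^sup>2 = (\<Sum>k\<in>UNIV. \<beta> * (indicator (part M k) x * (norm (y x))\<^sup>2))"
          by (simp only: sum_distrib_left[symmetric] sum_distrib_right[symmetric] elim(2) mult_1)
        also have "\<dots> \<le> (\<Sum>k\<in>UNIV. u $ k * (Re (eps_weight M k x * cnj ?\<tau>) * (norm (y x))\<^sup>2))"
          using u \<beta> elim(1) order_trans[OF less_imp_le[OF \<beta>] u]
          by (intro sum_mono mult_mono mult_right_mono) auto
        finally show ?case .
      qed
      show "integrable (lebesgue_on ?\<Omega>) (\<lambda>x. \<beta> * (norm (y x))\<^sup>2)" using integrable_norm_square[OF L(1)] by simp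
    qed (rule Bochner_Integration.integrable_sum[OF ik])
    finally have 2: "\<beta> * (norm (emb ?\<Omega> y))\<^sup>2 \<le> (\<Sum>k\<in>UNIV. u $ k *\<^sub>R mass_operator M k z) \<bullet> conj_mult2 ?\<tau> z"
      by (simp add: norm_emb[OF dom_sets L(1)] norm_L2_def)
    have "min c0 \<beta> * (norm z)\<^sup>2 = min c0 \<beta> * (norm (emb ?\<Omega> y))\<^sup>2 + min c0 \<beta> * (norm (emb ?\<Omega> (Curl ?\<Omega> y)))\<^sup>2"
      by (simp add: y(2) graph_curl_def norm_Pair distrib_left)
    also have "\<dots> \<le> \<beta> * (norm (emb ?\<Omega> y))\<^sup>2 + c0 * (norm (emb ?\<Omega> (Curl ?\<Omega> y)))\<^sup>2"
      by (intro add_mono mult_right_mono) auto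
    finally show ?thesis using 1 2 by (simp add: inner_add_left)
  qed
  then show ?thesis using c0(1) by (intro exI[of _ K] exI[of _ c0] conjI allI impI ballI) auto
qed

text \<open>All controls in the open set exceed \<open>\<beta>\<close>, so one coercivity constant
  serves them. Taking \<open>q\<close> as the norm of the first component is possible because the
  mass operators ignore curls.\<close>

lemma control_problem_exists:
  assumes \<beta>: "\<beta> > 0"
  shows "\<exists>c K Kb. control_problem (curl_operator M) (mass_operator M) (conj_mult2 (Complex 1 (- K)))
     (graph_curl (dom M) ` H0curl (dom M)) c (norm (Complex 1 (- K))) {u. \<forall>k. \<beta> < u $ k} (\<lambda>z. norm (fst z)) Kb"
proof -
  obtain C0 where C0: "essentially_bounded (mu_weight M) C0" using mu_weight_bounds(1) by blast
  obtain C1 where C1: "\<And>k. essentially_bounded (eps_weight M k) C1" using eps_weight_bounds(1) by blast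
  obtain K c0 where c0: "c0 > 0" and K': "\<forall>\<beta>>0. \<forall>u. (\<forall>k. \<beta> \<le> u $ k) \<longrightarrow> (\<forall>z \<in> graph_curl (dom M) ` H0curl (dom M).
     min c0 \<beta> * (norm z)\<^sup>2 \<le>
     (curl_operator M z + (\<Sum>k\<in>UNIV. u $ k *\<^sub>R mass_operator M k z)) \<bullet> conj_mult2 (Complex 1 (- K)) z)"
    using operator_coercive by (elim exE conjE) (rule that)
  note K = c0 K'[rule_format, OF \<beta>]
  have "control_problem (curl_operator M) (mass_operator M) (conj_mult2 (Complex 1 (- K)))
     (graph_curl (dom M) ` H0curl (dom M)) (min c0 \<beta>) (norm (Complex 1 (- K))) {u. \<forall>k. \<beta> < u $ k} (\<lambda>z. norm (fst z)) C1"
  proof (intro control_problem.intro parametric_problem.intro control_problem_axioms.intro)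
    show "bounded_linear (curl_operator M)"
      unfolding curl_operator_def
      by (intro bounded_linear_Pair bounded_linear_zero bounded_linear_compose[OF bounded_linear_conj_mult[OF C0]] bounded_linear_snd)
    show "bounded_linear (mass_operator M k)" for k
      unfolding mass_operator_def
      by (intro bounded_linear_Pair bounded_linear_zero bounded_linear_compose[OF bounded_linear_conj_mult[OF C1]] bounded_linear_fst)
    show "curl_operator M y \<bullet> w = curl_operator M w \<bullet> y" for y w
      by (simp add: curl_operator_def inner_prod_def conj_mult_symmetric[OF C0, of "snd y"])
    show "mass_operator M k y \<bullet> w = mass_operator M k w \<bullet> y" for k y w
      by (simp add: mass_operator_def inner_prod_def conj_mult_symmetric[OF C1, of _ "fst y"])
    show "bounded_linear (conj_mult2 (Complex 1 (- K)))" by (rule bounded_linear_conj_mult2)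
    show "norm (conj_mult2 (Complex 1 (- K)) y) \<le> norm (Complex 1 (- K)) * norm y" for y by (rule norm_conj_mult2_le)
    show "0 < min c0 \<beta>" using K(1) \<beta> by simp
    have "{u::real^'l. \<forall>k. \<beta> < u $ k} = (\<Inter>k. {u. \<beta> < u $ k})" by auto
    then show "open {u::real^'l. \<forall>k. \<beta> < u $ k}"
      by (simp only:) (intro open_INT finite ballI open_Collect_less continuous_intros)
    show "subspace (graph_curl (dom M) ` H0curl (dom M))" by (rule subspace_H0curl)
    show "closed (graph_curl (dom M) ` H0curl (dom M))" by (rule closed_graph_H0curl)
    show "conj_mult2 (Complex 1 (- K)) ` graph_curl (dom M) ` H0curl (dom M) = graph_curl (dom M) ` H0curl (dom M)"
      by (rule conj_mult2_image[OF _ _ subspace_H0curl]) (auto simp: complex_eq_iff graph_curl_conj(1))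
    show "min c0 \<beta> * (norm y)\<^sup>2 \<le> (curl_operator M y + (\<Sum>k\<in>UNIV. u $ k *\<^sub>R mass_operator M k y)) \<bullet> conj_mult2 (Complex 1 (- K)) y"
      if "u \<in> {u. \<forall>k. \<beta> < u $ k}" "y \<in> graph_curl (dom M) ` H0curl (dom M)" for u y
      using that by (intro K(2)) (auto intro: less_imp_le)
    show "0 \<le> norm (fst y)" "norm (fst y) \<le> norm y" for y :: "l2_pair"
      using norm_fst_le[of "fst y" "snd y"] by simp_all
    show C0': "0 \<le> C1" using C1 by (simp add: essentially_bounded_def)
    show "\<bar>mass_operator M k y \<bullet> w\<bar> \<le> C1 * norm y * norm (fst w)" for k y w
    proof -
      have "\<bar>mass_operator M k y \<bullet> w\<bar> = \<bar>conj_mult (eps_weight M k) (fst y) \<bullet> fst w\<bar>"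
        by (simp add: mass_operator_def inner_prod_def)
      also have "\<dots> \<le> norm (conj_mult (eps_weight M k) (fst y)) * norm (fst w)" by (rule Cauchy_Schwarz_ineq2)
      also have "\<dots> \<le> C1 * norm y * norm (fst w)"
        using norm_conj_mult[OF C1, of k "fst y"] mult_left_mono[OF norm_fst_le[of "fst y" "snd y"] C0']
        by (intro mult_right_mono) auto
      finally show ?thesis .
    qed
  qed
  then show ?thesis by blast
qed

end

section \<open>States, adjoint states and the reduced cost\<close>

context maxwell_setting
begin

lemma ip_cmult_right: "ip \<Omega> f (\<lambda>x. m *s w x) = cnj m * ip \<Omega> f w"
proof -
  have "cdot (f x) (vcnj (m *s w x)) = cnj m * cdot (f x) (vcnj (w x))" for x
    by (simp add: vcnj_mult cdot_commute[of "f x"] cdot_mult_left)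
  then show ?thesis by (simp add: ip_def)
qed

lemma ip_cong:
  assumes "f \<in> L2 (dom M)" "v \<in> L2 (dom M)" "w \<in> L2 (dom M)" "AE x in lebesgue_on (dom M). v x = w x"
  shows "ip (dom M) f v = ip (dom M) f w"
  unfolding ip_def using assms
  by (intro integral_cong_AE borel_measurable_cdot borel_measurable_vcnj L2_measurable)
    (auto elim!: eventually_mono)

lemma H0curl_cmult:
  assumes "w \<in> H0curl (dom M)"
  shows "(\<lambda>x. m *s w x) \<in> H0curl (dom M)"
    "AE x in lebesgue_on (dom M). Curl (dom M) (\<lambda>x. m *s w x) x = m *s Curl (dom M) w x"
  using zero_trace_curlD[OF zero_trace_curl_conj[OF zero_trace_curl_conj[OF H0curl_zero_trace[OF assms], of m], of 1]]
  by (simp_all add: vcnj_vcnj)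

lemma Curl_L2: "w \<in> H0curl (dom M) \<Longrightarrow> Curl (dom M) w \<in> L2 (dom M)"
  and H0curl_L2: "w \<in> H0curl (dom M) \<Longrightarrow> w \<in> L2 (dom M)"
  using H0curl_zero_trace by (auto simp: zero_trace_curl_def)

lemma ip_Curl_cmult:
  assumes f: "f \<in> L2 (dom M)" and w: "w \<in> H0curl (dom M)"
  shows "ip (dom M) f (Curl (dom M) (\<lambda>x. m *s w x)) = cnj m * ip (dom M) f (Curl (dom M) w)"
proof -
  have mL: "(\<lambda>x. m *s Curl (dom M) w x) \<in> L2 (dom M)"
    by (rule L2_mult_fun[OF essentially_bounded_const Curl_L2[OF w]])
  show ?thesis
    using ip_cong[OF f Curl_L2[OF H0curl_cmult(1)[OF w]] mL H0curl_cmult(2)[OF w]] by (simp add: ip_cmult_right)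
qed

lemma aform_cmult:
  assumes y: "y \<in> H0curl (dom M)" and w: "w \<in> H0curl (dom M)"
  shows "aform M u y (\<lambda>x. m *s w x) = cnj m * aform M u y w"
proof -
  obtain C0 where C0: "essentially_bounded (mu_weight M) C0" using mu_weight_bounds(1) by blast
  have 1: "(\<lambda>x. mu_weight M x *s Curl (dom M) y x) \<in> L2 (dom M)" by (rule L2_mult_fun[OF C0 Curl_L2[OF y]])
  have 2: "AE x in lebesgue_on (dom M). norm (complex_of_real (inverse (mu M x)) *s Curl (dom M) y x) \<le>
      1 * norm (mu_weight M x *s Curl (dom M) y x)"
    by (rule AE_I2) (simp add: mu_weight_def)
  have 3: "(\<lambda>x. complex_of_real (inverse (mu M x)) *s Curl (dom M) y x) \<in> borel_measurable (lebesgue_on (dom M))"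
    using data by (intro borel_measurable_cmult borel_measurable_complex_of_real borel_measurable_inverse L2_measurable[OF Curl_L2[OF y]])
      (simp add: maxwell_data_def Linf_def)
  have "(\<lambda>x. complex_of_real (inverse (mu M x)) *s Curl (dom M) y x) \<in> L2 (dom M)"
    by (rule L2_dominated[OF dom_sets 3 1 2])
  then show ?thesis
    by (simp add: aform_def ip_Curl_cmult[OF _ w] ip_cmult_right right_diff_distrib)
qed

lemma nedelec_admissible_image:
  assumes "m \<noteq> 0"
  shows "conj_mult2 m ` graph_curl (dom M) ` nedelec (dom M) \<T> = graph_curl (dom M) ` nedelec (dom M) \<T>"
  by (rule conj_mult2_image[OF assms nedelec_subset subspace_nedelec nedelec_conj])

end

locale maxwell_control = maxwell_setting M for M :: "'l::finite maxwell" +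
  fixes f y\<Omega> E\<Omega> :: "real^3 \<Rightarrow> complex^3" and \<alpha> K c Kb :: real and U :: "(real^'l) set"
  assumes rhs: "f \<in> L2 (dom M)" "y\<Omega> \<in> L2 (dom M)" "E\<Omega> \<in> L2 (dom M)"
    and problem: "control_problem (curl_operator M) (mass_operator M) (conj_mult2 (Complex 1 (- K)))
      (graph_curl (dom M) ` H0curl (dom M)) c (norm (Complex 1 (- K))) U (\<lambda>z. norm (fst z)) Kb"

text \<open>The load contains \<open>vcnj (f x)\<close>, because the real part of \<open>f\<close>
  paired with a conjugated field is the real inner product with the conjugate of \<open>f\<close>.
  The target stays unconjugated, since the adjoint right-hand side already conjugates the
  residual.\<close>

sublocale maxwell_control \<subseteq> control_problem "curl_operator M" "mass_operator M" "conj_mult2 (Complex 1 (- K))"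
  "graph_curl (dom M) ` H0curl (dom M)" c "norm (Complex 1 (- K))" U
  "(emb (dom M) (\<lambda>x. vcnj (f x)), 0)" "(emb (dom M) y\<Omega>, emb (dom M) E\<Omega>)" "\<lambda>z. norm (fst z)" Kb \<alpha>
  by (rule problem)

context maxwell_control
begin

abbreviation "\<G> \<equiv> graph_curl (dom M)"
abbreviation "\<H> \<equiv> \<G> ` H0curl (dom M)"
abbreviation "\<N> \<T> \<equiv> \<G> ` nedelec (dom M) \<T>"

lemma admissible_H0curl: "admissible \<H>"
  by (rule admissible_G)

lemma admissible_nedelec: "simplicial_mesh (dom M) \<T> \<Longrightarrow> admissible (\<N> \<T>)"
  unfolding admissible_def
  by (intro conjI subspace_nedelec closed_nedelec image_mono nedelec_subset nedelec_admissible_image)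
    (auto simp: complex_eq_iff)

lemma A_form:
  assumes "y \<in> H0curl (dom M)" "w \<in> H0curl (dom M)"
  shows "A u (\<G> y) \<bullet> \<G> w = Re (aform M u y (\<lambda>x. vcnj (w x)))"
  using operator_form[OF assms, of u] by (simp add: A_def L_def)

text \<open>Since the test space is invariant under conjugation and multiplication by \<open>\<i>\<close>, the complex
  equation is equivalent to the real parts of the equation tested with conjugated fields.\<close>

lemma variational_solution:
  assumes u: "u \<in> U" and V: "V \<subseteq> H0curl (dom M)" "admissible (\<G> ` V)"
    and conj: "\<And>w m. w \<in> V \<Longrightarrow> (\<lambda>x. vcnj (m *s w x)) \<in> V"
    and F: "\<And>w m. w \<in> V \<Longrightarrow> F (\<lambda>x. m *s w x) = cnj m * F w"
    and Fg: "\<And>w. w \<in> V \<Longrightarrow> Re (F (\<lambda>x. vcnj (w x))) = g' \<bullet> \<G> w"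
  shows "variational_solution M u V F \<in> V" "\<G> (variational_solution M u V F) = sol (\<G> ` V) u g'"
proof -
  have cmult: "(\<lambda>x. m *s w x) \<in> V" if "w \<in> V" for w m
    using conj[OF conj[OF that, of m], of 1] by (simp add: vcnj_vcnj)
  have real_form: "(\<forall>w\<in>V. aform M u y w = F w) \<longleftrightarrow> (\<forall>z\<in>\<G> ` V. A u (\<G> y) \<bullet> z = g' \<bullet> z)" if y: "y \<in> V" for y
  proof
    assume eq: "\<forall>w\<in>V. aform M u y w = F w"
    show "\<forall>z\<in>\<G> ` V. A u (\<G> y) \<bullet> z = g' \<bullet> z"
    proof
      fix z assume "z \<in> \<G> ` V"
      then obtain w where w: "w \<in> V" and z: "z = \<G> w" by blast
      then have "(\<lambda>x. vcnj (w x)) \<in> V" using conj[of w 1] by simp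
      then show "A u (\<G> y) \<bullet> z = g' \<bullet> z"
        using eq w y V(1) Fg[OF w] by (simp add: z A_form subsetD)
    qed
  next
    assume eq: "\<forall>z\<in>\<G> ` V. A u (\<G> y) \<bullet> z = g' \<bullet> z"
    have Re: "Re (aform M u y w) = Re (F w)" if w: "w \<in> V" for w
    proof -
      define w' where "w' x = vcnj (w x)" for x
      have w': "w' \<in> V" using conj[OF w, of 1] by (simp add: w'_def[abs_def])
      have "A u (\<G> y) \<bullet> \<G> w' = g' \<bullet> \<G> w'" using eq w' by blast
      then show ?thesis
        using A_form[of y w' u] Fg[OF w'] y w' V(1) by (simp add: subsetD w'_def vcnj_vcnj)
    qed
    show "\<forall>w\<in>V. aform M u y w = F w"
    proof
      fix w assume w: "w \<in> V"
      \<comment> \<open>Testing with \<open>\<i>\<close> times the field recovers the imaginary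
        part, by antilinearity in the test field.\<close>
      have "Re (aform M u y (\<lambda>x. \<i> *s w x)) = Re (F (\<lambda>x. \<i> *s w x))" by (rule Re[OF cmult[OF w]])
      then have "Im (aform M u y w) = Im (F w)"
        using aform_cmult[of y w u \<i>] F[OF w, of \<i>] y w V(1) by (simp add: subsetD)
      then show "aform M u y w = F w" using Re[OF w] by (simp add: complex_eq_iff)
    qed
  qed
  \<comment> \<open>A representative of the abstract solution shows that the choice in
    \<open>variational_solution\<close> succeeds; uniqueness then identifies the class of the chosen
    field.\<close>
  obtain y0 where y0: "y0 \<in> V" "sol (\<G> ` V) u g' = \<G> y0" using sol(1)[OF u V(2), of g'] by blast
  have "y0 \<in> V \<and> (\<forall>w\<in>V. aform M u y0 w = F w)"
    using real_form[OF y0(1)] sol(2)[OF u V(2), of _ g'] y0 by simp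
  then have "variational_solution M u V F \<in> V \<and> (\<forall>w\<in>V. aform M u (variational_solution M u V F) w = F w)"
    unfolding variational_solution_def by (rule someI[where P = "\<lambda>y. y \<in> V \<and> (\<forall>w\<in>V. aform M u y w = F w)"])
  then have v: "variational_solution M u V F \<in> V" "\<forall>w\<in>V. aform M u (variational_solution M u V F) w = F w" by auto
  then show "variational_solution M u V F \<in> V" by simp
  show "\<G> (variational_solution M u V F) = sol (\<G> ` V) u g'"
  proof (rule sol_unique[OF u V(2), symmetric])
    show "\<G> (variational_solution M u V F) \<in> \<G> ` V" using v(1) by blast
    show "A u (\<G> (variational_solution M u V F)) \<bullet> w = g' \<bullet> w" if "w \<in> \<G> ` V" for w
      using real_form[OF v(1)] v(2) that by blast
  qed
qed

lemma Re_ip_conj: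
  assumes "v \<in> L2 (dom M)" "w \<in> L2 (dom M)"
  shows "Re (ip (dom M) v (\<lambda>x. vcnj (w x))) = emb (dom M) (\<lambda>x. vcnj (v x)) \<bullet> emb (dom M) w"
  using Re_integral_cdot[OF dom_sets assms] by (simp add: ip_def vcnj_vcnj)

lemma L2_vcnj: "v \<in> L2 (dom M) \<Longrightarrow> (\<lambda>x. vcnj (v x)) \<in> L2 (dom M)"
  using L2_conj_mult[OF dom_sets, of v 1] by simp

context
  fixes V u
  assumes u: "u \<in> U" and V: "V \<subseteq> H0curl (dom M)" "admissible (\<G> ` V)"
    and conj: "\<And>w m. w \<in> V \<Longrightarrow> (\<lambda>x. vcnj (m *s w x)) \<in> V"
begin

lemma state_solution:
  shows "variational_solution M u V (ip (dom M) f) \<in> V"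
    "\<G> (variational_solution M u V (ip (dom M) f)) = S (\<G> ` V) u"
proof -
  have "Re (ip (dom M) f (\<lambda>x. vcnj (w x))) = (emb (dom M) (\<lambda>x. vcnj (f x)), 0) \<bullet> \<G> w" if "w \<in> V" for w
    using that V(1) Re_ip_conj[OF rhs(1) H0curl_L2] by (auto simp: graph_curl_def)
  from variational_solution[OF u V conj ip_cmult_right this]
  show "variational_solution M u V (ip (dom M) f) \<in> V"
    "\<G> (variational_solution M u V (ip (dom M) f)) = S (\<G> ` V) u" by (auto simp: S_def)
qed

text \<open>In the real part the conjugations of residual and test field cancel, which leaves the
  plain residual as load. The field \<open>y\<close> need not lie in \<open>V\<close>, so the
  discrete adjoint with continuous state is covered.\<close>

lemma adjoint_solution:
  fixes y
  defines "F \<equiv> adjoint_rhs (dom M) y\<Omega> E\<Omega> y"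
  assumes y: "y \<in> H0curl (dom M)"
  shows "variational_solution M u V F \<in> V"
    "\<G> (variational_solution M u V F) = sol (\<G> ` V) u (\<G> y - (emb (dom M) y\<Omega>, emb (dom M) E\<Omega>))"
proof -
  have L: "(\<lambda>x. y x - y\<Omega> x) \<in> L2 (dom M)" "(\<lambda>x. Curl (dom M) y x - E\<Omega> x) \<in> L2 (dom M)"
    by (intro L2_diff[OF dom_sets] rhs Curl_L2 H0curl_L2 y)+
  have Fc: "F (\<lambda>x. m *s w x) = cnj m * F w" if "w \<in> V" for w m
    using that V(1) ip_Curl_cmult[OF L2_vcnj[OF L(2)], of w m]
    by (auto simp: F_def adjoint_rhs_def ip_cmult_right distrib_left)
  have Fg: "Re (F (\<lambda>x. vcnj (w x))) = (\<G> y - (emb (dom M) y\<Omega>, emb (dom M) E\<Omega>)) \<bullet> \<G> w" if w: "w \<in> V" for w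
  proof -
    have w: "w \<in> H0curl (dom M)" using w V(1) by blast
    have wc: "(\<lambda>x. vcnj (w x)) \<in> H0curl (dom M)"
      "AE x in lebesgue_on (dom M). Curl (dom M) (\<lambda>x. vcnj (w x)) x = vcnj (Curl (dom M) w x)"
      using graph_curl_conj(1,3)[OF w, of 1] by simp_all
    have "ip (dom M) (\<lambda>x. vcnj (Curl (dom M) y x - E\<Omega> x)) (Curl (dom M) (\<lambda>x. vcnj (w x))) =
        ip (dom M) (\<lambda>x. vcnj (Curl (dom M) y x - E\<Omega> x)) (\<lambda>x. vcnj (Curl (dom M) w x))"
      by (rule ip_cong[OF L2_vcnj[OF L(2)] Curl_L2[OF wc(1)] L2_vcnj[OF Curl_L2[OF w]] wc(2)])
    then have "Re (F (\<lambda>x. vcnj (w x))) = emb (dom M) (\<lambda>x. y x - y\<Omega> x) \<bullet> emb (dom M) w +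
        emb (dom M) (\<lambda>x. Curl (dom M) y x - E\<Omega> x) \<bullet> emb (dom M) (Curl (dom M) w)"
      using Re_ip_conj[OF L2_vcnj[OF L(1)] H0curl_L2[OF w]] Re_ip_conj[OF L2_vcnj[OF L(2)] Curl_L2[OF w]]
      by (simp add: F_def adjoint_rhs_def vcnj_vcnj)
    then show ?thesis
      by (simp add: emb_diff[OF dom_sets] rhs H0curl_L2[OF y] Curl_L2[OF y] graph_curl_def)
  qed
  from variational_solution[OF u V conj Fc Fg]
  show "variational_solution M u V F \<in> V"
    "\<G> (variational_solution M u V F) = sol (\<G> ` V) u (\<G> y - (emb (dom M) y\<Omega>, emb (dom M) E\<Omega>))" by auto
qed

lemma cost_solution: "cost (dom M) y\<Omega> E\<Omega> \<alpha> (variational_solution M u V (ip (dom M) f)) u = J (\<G> ` V) u"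
proof -
  define y where "y = variational_solution M u V (ip (dom M) f)"
  have y: "y \<in> H0curl (dom M)" "\<G> y = S (\<G> ` V) u" using state_solution V(1) by (auto simp: y_def)
  have L: "(\<lambda>x. y x - y\<Omega> x) \<in> L2 (dom M)" "(\<lambda>x. Curl (dom M) y x - E\<Omega> x) \<in> L2 (dom M)"
    by (intro L2_diff[OF dom_sets] rhs Curl_L2 H0curl_L2 y)+
  have "S (\<G> ` V) u - (emb (dom M) y\<Omega>, emb (dom M) E\<Omega>) =
      (emb (dom M) (\<lambda>x. y x - y\<Omega> x), emb (dom M) (\<lambda>x. Curl (dom M) y x - E\<Omega> x))"
    by (simp add: y(2)[symmetric] graph_curl_def[of "dom M" y] emb_diff[OF dom_sets] rhs H0curl_L2[OF y(1)] Curl_L2[OF y(1)])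
  then have "(norm (S (\<G> ` V) u - (emb (dom M) y\<Omega>, emb (dom M) E\<Omega>)))\<^sup>2 =
      (norm_L2 (dom M) (\<lambda>x. y x - y\<Omega> x))\<^sup>2 + (norm_L2 (dom M) (\<lambda>x. Curl (dom M) y x - E\<Omega> x))\<^sup>2"
    by (simp add: norm_Pair norm_emb[OF dom_sets] L)
  then show ?thesis by (simp add: cost_def J_def y_def[symmetric] algebra_simps)
qed

end

lemma H0curl_conj_closed: "w \<in> H0curl (dom M) \<Longrightarrow> (\<lambda>x. vcnj (m *s w x)) \<in> H0curl (dom M)"
  by (rule graph_curl_conj(1))

lemma state_facts:
  assumes u: "u \<in> U"
  shows "state M f u \<in> H0curl (dom M)" "\<G> (state M f u) = S \<H> u"
    "adjoint_state M f y\<Omega> E\<Omega> u \<in> H0curl (dom M)"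
    "\<G> (adjoint_state M f y\<Omega> E\<Omega> u) = P \<H> \<H> u"
    "jred M f y\<Omega> E\<Omega> \<alpha> u = J \<H> u"
proof -
  note H = order_refl admissible_H0curl H0curl_conj_closed
  show s: "state M f u \<in> H0curl (dom M)" "\<G> (state M f u) = S \<H> u"
    using state_solution[OF u H] by (simp_all add: state_def)
  show "adjoint_state M f y\<Omega> E\<Omega> u \<in> H0curl (dom M)"
    "\<G> (adjoint_state M f y\<Omega> E\<Omega> u) = P \<H> \<H> u"
    using adjoint_solution[OF u H s(1)] by (simp_all add: adjoint_state_def P_def s(2))
  show "jred M f y\<Omega> E\<Omega> \<alpha> u = J \<H> u"
    using cost_solution[OF u H] by (simp add: jred_def state_def)
qed

lemma discrete_state_facts:
  assumes u: "u \<in> U" and \<T>: "simplicial_mesh (dom M) \<T>"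
  shows "discrete_state M \<T> f u \<in> H0curl (dom M)" "\<G> (discrete_state M \<T> f u) = S (\<N> \<T>) u"
    "discrete_adjoint_state M \<T> f y\<Omega> E\<Omega> u \<in> H0curl (dom M)"
    "\<G> (discrete_adjoint_state M \<T> f y\<Omega> E\<Omega> u) = P (\<N> \<T>) \<H> u"
    "discrete_jred M \<T> f y\<Omega> E\<Omega> \<alpha> u = J (\<N> \<T>) u"
proof -
  note H = nedelec_subset admissible_nedelec[OF \<T>] nedelec_conj
  show "discrete_state M \<T> f u \<in> H0curl (dom M)" "\<G> (discrete_state M \<T> f u) = S (\<N> \<T>) u"
    using state_solution[OF u H] nedelec_subset by (auto simp: discrete_state_def)
  show "discrete_adjoint_state M \<T> f y\<Omega> E\<Omega> u \<in> H0curl (dom M)"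
    "\<G> (discrete_adjoint_state M \<T> f y\<Omega> E\<Omega> u) = P (\<N> \<T>) \<H> u"
    using adjoint_solution[OF u H state_facts(1)[OF u]] nedelec_subset
    by (auto simp: discrete_adjoint_state_def P_def state_facts(2)[OF u])
  show "discrete_jred M \<T> f y\<Omega> E\<Omega> \<alpha> u = J (\<N> \<T>) u"
    using cost_solution[OF u H] by (simp add: discrete_jred_def discrete_state_def)
qed

lemma reduced_gradient_eq:
  assumes u: "u \<in> U"
  shows "reduced_gradient M f y\<Omega> E\<Omega> \<alpha> u k = grad \<H> u $ k"
proof -
  let ?y = "state M f u" and ?p = "adjoint_state M f y\<Omega> E\<Omega> u"
  note s = state_facts[OF u]
  obtain C1 where C1: "\<And>k. essentially_bounded (eps_weight M k) C1" using eps_weight_bounds(1) by blast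
  have "mass_operator M k (\<G> ?y) \<bullet> \<G> ?p = Re (LINT x|lebesgue_on (dom M). eps_weight M k x * cdot (?y x) (?p x))"
    using conj_mult_inner_emb[OF C1 dom_sets H0curl_L2[OF s(1)] H0curl_L2[OF s(3)]]
    by (simp add: mass_operator_def graph_curl_def)
  also have "(LINT x|lebesgue_on (dom M). eps_weight M k x * cdot (?y x) (?p x)) =
      (LINT x|lebesgue_on (part M k). - complex_of_real (\<omega>\<^sup>2) * (eps_sigma M x * cdot (?y x) (?p x)))"
  proof -
    \<comment> \<open>The piece is contained in the domain, so the weight localises the integral to
      the piece.\<close>
    have pt: "indicator (dom M) x *\<^sub>R (eps_weight M k x * z) =
        indicator (part M k) x *\<^sub>R (- complex_of_real (\<omega>\<^sup>2) * (eps_sigma M x * z))" for x z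
      using part_subset[of k] by (cases "x \<in> part M k") (auto simp: eps_weight_def eps_sigma_def)
    have sets: "dom M \<inter> space lebesgue \<in> sets lebesgue" "part M k \<inter> space lebesgue \<in> sets lebesgue"
      using dom_sets part_sets by simp_all
    show ?thesis unfolding integral_restrict_space[OF sets(1)] integral_restrict_space[OF sets(2)] pt ..
  qed
  finally have "mass_operator M k (\<G> ?y) \<bullet> \<G> ?p =
      - \<omega>\<^sup>2 * Re (LINT x|lebesgue_on (part M k). eps_sigma M x * cdot (?y x) (?p x))"
    by (simp del: of_real_power)
  then show ?thesis by (simp add: reduced_gradient_def grad_def s(2,4))
qed

end

section \<open>The error estimate\<close>

context maxwell_control
begin

text \<open>For \<open>h < 1\<close> both powers are at most \<open>h powr (min s r)\<close>. The
  assumed adjoint rate concerns \<open>P (\<N> (\<T> h)) \<H>\<close>, exactly the term that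
  \<open>grad_error\<close> measures by \<open>q\<close>.\<close>

lemma gradient_rate:
  assumes U: "Uad a b \<subseteq> U" and H: "H \<subseteq> {0<..}" and mesh: "\<And>h. h \<in> H \<Longrightarrow> simplicial_mesh (dom M) (\<T> h)"
    and f: "f \<in> Hdiv (dom M)"
    and state_rate: "\<exists>C>0. \<forall>g\<in>Hdiv (dom M). \<forall>u\<in>Uad a b. \<forall>h\<in>H.
           norm_Hcurl (dom M) (\<lambda>x. state M g u x - discrete_state M (\<T> h) g u x) \<le> C * h powr s * norm_Hdiv (dom M) g"
    and adjoint_rate: "\<exists>C>0. \<forall>u\<in>Uad a b. \<forall>h\<in>H.
           norm_L2 (dom M) (\<lambda>x. adjoint_state M f y\<Omega> E\<Omega> u x -
             discrete_adjoint_state M (\<T> h) f y\<Omega> E\<Omega> u x) \<le> C * h powr r"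
  shows "\<exists>C>0. \<forall>h\<in>H. h < 1 \<longrightarrow> (\<forall>u\<in>Uad a b.
     norm (grad \<H> u - grad (\<N> (\<T> h)) u) \<le> C * h powr (min s r))"
proof -
  obtain C0 where C0: "C0 \<ge> 0" "\<And>V u. admissible V \<Longrightarrow> u \<in> U \<Longrightarrow>
     norm (grad \<H> u - grad V u) \<le> C0 * (norm (S \<H> u - S V u) +
       norm (fst (P \<H> \<H> u - P V \<H> u)))"
    using grad_error by blast
  obtain C1 where C1: "C1 > 0" "\<And>u h. u \<in> Uad a b \<Longrightarrow> h \<in> H \<Longrightarrow>
      norm_Hcurl (dom M) (\<lambda>x. state M f u x - discrete_state M (\<T> h) f u x) \<le> C1 * h powr s * norm_Hdiv (dom M) f"
    using state_rate f by blast
  obtain C2 where C2: "C2 > 0" "\<And>u h. u \<in> Uad a b \<Longrightarrow> h \<in> H \<Longrightarrow>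
      norm_L2 (dom M) (\<lambda>x. adjoint_state M f y\<Omega> E\<Omega> u x - discrete_adjoint_state M (\<T> h) f y\<Omega> E\<Omega> u x) \<le> C2 * h powr r"
    using adjoint_rate by blast
  define N where "N = norm_Hdiv (dom M) f"
  have N: "N \<ge> 0" by (simp add: N_def norm_Hdiv_def)
  \<comment> \<open>The added 1 makes the constant positive even if the other summand
    vanishes.\<close>
  define C where "C = C0 * (C1 * N + C2) + 1"
  have "norm (grad \<H> u - grad (\<N> (\<T> h)) u) \<le> C * h powr (min s r)"
    if h: "h \<in> H" "h < 1" and uad: "u \<in> Uad a b" for h u
  proof -
    have u: "u \<in> U" using uad U by blast
    have h0: "0 < h" using h H by auto
    note st = state_facts[OF u] and dst = discrete_state_facts[OF u mesh[OF h(1)]]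
    have "norm (S \<H> u - S (\<N> (\<T> h)) u) =
        norm_Hcurl (dom M) (\<lambda>x. state M f u x - discrete_state M (\<T> h) f u x)"
      using norm_graph_curl[OF graph_curl_diff(1)[OF st(1) dst(1)]]
      unfolding graph_curl_diff(2)[OF st(1) dst(1)] st(2) dst(2) .
    also have "\<dots> \<le> C1 * h powr s * N" using C1(2)[OF uad h(1)] by (simp add: N_def)
    also have "\<dots> = C1 * N * h powr s" by simp
    also have "\<dots> \<le> C1 * N * h powr (min s r)"
      using C1(1) N h0 h(2) by (intro mult_left_mono powr_mono') auto
    finally have 1: "norm (S \<H> u - S (\<N> (\<T> h)) u) \<le> C1 * N * h powr (min s r)" .
    have "norm (fst (P \<H> \<H> u - P (\<N> (\<T> h)) \<H> u)) =
        norm_L2 (dom M) (\<lambda>x. adjoint_state M f y\<Omega> E\<Omega> u x - discrete_adjoint_state M (\<T> h) f y\<Omega> E\<Omega> u x)"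
    proof -
      have L: "adjoint_state M f y\<Omega> E\<Omega> u \<in> L2 (dom M)" "discrete_adjoint_state M (\<T> h) f y\<Omega> E\<Omega> u \<in> L2 (dom M)"
        using st(3) dst(3) by (auto intro: H0curl_L2)
      have "fst (P \<H> \<H> u) = emb (dom M) (adjoint_state M f y\<Omega> E\<Omega> u)"
        unfolding st(4)[symmetric] by (simp add: graph_curl_def)
      moreover have "fst (P (\<N> (\<T> h)) \<H> u) = emb (dom M) (discrete_adjoint_state M (\<T> h) f y\<Omega> E\<Omega> u)"
        unfolding dst(4)[symmetric] by (simp add: graph_curl_def)
      ultimately show ?thesis
        by (simp add: emb_diff[OF dom_sets L, symmetric] norm_emb[OF dom_sets L2_diff[OF dom_sets L]])
    qed
    also have "\<dots> \<le> C2 * h powr r" by (rule C2(2)[OF uad h(1)])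
    also have "\<dots> \<le> C2 * h powr (min s r)"
      using C2(1) h0 h(2) by (intro mult_left_mono powr_mono') auto
    finally have 2: "norm (fst (P \<H> \<H> u - P (\<N> (\<T> h)) \<H> u))
        \<le> C2 * h powr (min s r)" .
    have "norm (grad \<H> u - grad (\<N> (\<T> h)) u) \<le>
        C0 * (C1 * N * h powr (min s r) + C2 * h powr (min s r))"
      using C0(2)[OF admissible_nedelec[OF mesh[OF h(1)]] u] mult_left_mono[OF add_mono[OF 1 2] C0(1)] by linarith
    also have "\<dots> \<le> C * h powr (min s r)"
      by (simp add: C_def algebra_simps)
    finally show ?thesis .
  qed
  moreover have "C > 0" using C0(1) C1(1) C2(1) N by (simp add: C_def add_nonneg_pos)
  ultimately show ?thesis by blast
qed

end

theorem theorem5p6: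
  fixes M :: "'l::finite maxwell"
    and f y\<Omega> E\<Omega> :: "real^3 \<Rightarrow> complex^3"
    and \<alpha> t r s :: real
    and a b ustar :: "real^'l"
    and H :: "real set"
    and \<T> :: "real \<Rightarrow> (real^3) set set"
    and uh :: "real \<Rightarrow> real^'l"
  assumes data: "maxwell_data M"
    and rhs: "f \<in> L2 (dom M)" "y\<Omega> \<in> L2 (dom M)" "E\<Omega> \<in> L2 (dom M)"
    and alpha: "\<alpha> > 0"
    and bounds: "\<forall>k. 0 < a $ k \<and> a $ k < b $ k"
    and meshes: "mesh_family M H \<T>"
    and ustar: "strict_local_solution (jred M f y\<Omega> E\<Omega> \<alpha>) (Uad a b) ustar"
    and uh: "\<forall>h\<in>H. local_solution (discrete_jred M (\<T> h) f y\<Omega> E\<Omega> \<alpha>) (Uad a b) (uh h)"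
    and conv: "(uh \<longlongrightarrow> ustar) (at 0 within H)"
    and second_order: "\<exists>\<tau>>0. \<exists>\<nu>>0. \<forall>v\<in>critical_cone M f y\<Omega> E\<Omega> \<alpha> a b \<tau> ustar.
           second_derivative (jred M f y\<Omega> E\<Omega> \<alpha>) ustar v v \<ge> \<nu> * (norm v)\<^sup>2"
    and f_div: "f \<in> Hdiv (dom M)"
    and mu_PW: "(\<lambda>x. complex_of_real (mu M x)) \<in> PW1inf (dom M) (part M)"
    and eps_PW: "eps_sigma M \<in> PW1inf (dom M) (part M)"
    and t: "regularity_exponent M H \<T> a b t"
    and r: "0 < r" "r \<le> 1"
    and adjoint_rate: "\<exists>C>0. \<forall>u\<in>Uad a b. \<forall>h\<in>H.
           norm_L2 (dom M) (\<lambda>x. adjoint_state M f y\<Omega> E\<Omega> u x -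
             discrete_adjoint_state M (\<T> h) f y\<Omega> E\<Omega> u x) \<le> C * h powr r"
    and s: "0 \<le> s" "s < t"
  shows "\<exists>h0>0. \<exists>C>0. \<forall>h\<in>H. h < h0 \<longrightarrow> norm (ustar - uh h) \<le> C * h powr (min s r)"
proof -
  interpret setting: maxwell_setting M by unfold_locales (rule data)
  \<comment> \<open>Half the smallest lower bound: the box then lies in the open set of controls
    exceeding \<open>\<beta>\<close>, so derivatives exist even at its boundary points.\<close>
  define \<beta> where "\<beta> = Min (range (($) a)) / 2"
  have \<beta>: "\<beta> > 0" using bounds by (auto simp: \<beta>_def)
  have a\<beta>: "\<beta> < a $ k" for k
  proof -
    have "Min (range (($) a)) \<le> a $ k" by (rule Min_le) auto
    then show ?thesis using \<beta> unfolding \<beta>_def by linarith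
  qed
  define U where "U = {u::real^'l. \<forall>k. \<beta> < u $ k}"
  obtain c K Kb where problem: "control_problem (curl_operator M) (mass_operator M) (conj_mult2 (Complex 1 (- K)))
     (graph_curl (dom M) ` H0curl (dom M)) c (norm (Complex 1 (- K))) U (\<lambda>z. norm (fst z)) Kb"
    using setting.control_problem_exists[OF \<beta>] unfolding U_def by blast
  interpret maxwell_control M f y\<Omega> E\<Omega> \<alpha> K c Kb U
    by (intro maxwell_control.intro maxwell_control_axioms.intro setting.maxwell_setting_axioms rhs problem)
  have UadU: "Uad a b \<subseteq> U"
  proof
    fix x assume "x \<in> Uad a b"
    then have "a $ k \<le> x $ k" for k by (simp add: mem_Uad)
    then have "\<beta> < x $ k" for k by (rule less_le_trans[OF a\<beta>])
    then show "x \<in> U" by (simp add: U_def)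
  qed
  have H: "H \<subseteq> {0<..}" and mesh: "\<And>h. h \<in> H \<Longrightarrow> simplicial_mesh (dom M) (\<T> h)"
    using meshes by (auto simp: mesh_family_def)
  let ?G = "graph_curl (dom M) ` H0curl (dom M)" and ?V = "\<lambda>h. graph_curl (dom M) ` nedelec (dom M) (\<T> h)"
  have state_rate: "\<exists>C>0. \<forall>g\<in>Hdiv (dom M). \<forall>u\<in>Uad a b. \<forall>h\<in>H.
      norm_Hcurl (dom M) (\<lambda>x. state M g u x - discrete_state M (\<T> h) g u x) \<le> C * h powr s' * norm_Hdiv (dom M) g"
    if "0 \<le> s'" "s' < t" for s'
    using t that unfolding regularity_exponent_def by blast
  \<comment> \<open>Stated for every exponent below \<open>t\<close> because it is used twice: with
    \<open>t / 2\<close> for the consistency limit and with \<open>s\<close> for the final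
    rate.\<close>
  have rate: "\<exists>C>0. \<forall>h\<in>H. h < 1 \<longrightarrow> (\<forall>u\<in>Uad a b. norm (grad ?G u - grad (?V h) u) \<le> C * h powr (min s' r))"
    if "0 \<le> s'" "s' < t" for s'
    by (rule gradient_rate[OF UadU H mesh f_div state_rate[OF that] adjoint_rate])
  have uhU: "uh h \<in> Uad a b" if "h \<in> H" for h using uh that by (auto simp: local_solution_def)
  have Hsmall: "\<forall>\<^sub>F h in at 0 within H. h \<in> H \<and> h < 1"
    unfolding eventually_at by (intro exI[of _ 1]) (auto simp: dist_real_def)
  text \<open>Consistency needs a positive exponent even if \<open>s = 0\<close>.\<close>
  have consistent: "((\<lambda>h. grad ?G (uh h) - grad (?V h) (uh h)) \<longlongrightarrow> 0) (at 0 within H)"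
  proof -
    have t0: "0 < t" using t by (simp add: regularity_exponent_def)
    obtain C where C: "\<And>h u. h \<in> H \<Longrightarrow> h < 1 \<Longrightarrow> u \<in> Uad a b \<Longrightarrow>
        norm (grad ?G u - grad (?V h) u) \<le> C * h powr (min (t / 2) r)"
      using rate[of "t / 2"] t0 by auto
    have p: "min (t / 2) r > 0" using t0 r by simp
    have "((\<lambda>h. C * h powr (min (t / 2) r)) \<longlongrightarrow> C * 0) (at 0 within H)"
    proof (rule tendsto_mult[OF tendsto_const])
      have "((\<lambda>h::real. h powr (min (t / 2) r)) \<longlongrightarrow> 0 powr (min (t / 2) r)) (at 0 within H)"
      proof (rule tendsto_powr'[OF tendsto_ident_at tendsto_const])
        have "\<forall>\<^sub>F h in at 0 within H. 0 \<le> h"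
          using Hsmall by eventually_elim (use H in auto)
        then show "0 \<noteq> (0::real) \<or> 0 < min (t / 2) r \<and> (\<forall>\<^sub>F h in at 0 within H. 0 \<le> h)" using p by simp
      qed
      then show "((\<lambda>h::real. h powr (min (t / 2) r)) \<longlongrightarrow> 0) (at 0 within H)" by simp
    qed
    then have lim: "((\<lambda>h. C * h powr (min (t / 2) r)) \<longlongrightarrow> 0) (at 0 within H)" by simp
    show ?thesis
      by (rule Lim_null_comparison[OF _ lim]) (use Hsmall in eventually_elim, auto intro!: C uhU)
  qed
  have jred_deriv: "(jred M f y\<Omega> E\<Omega> \<alpha> has_derivative (\<lambda>v. grad ?G u \<bullet> v)) (at u)" if u: "u \<in> U" for u
    by (rule has_derivative_transform_within_open[OF J_has_derivative[OF u admissible_H0curl] U u])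
      (simp add: state_facts(5))
  have discrete_deriv: "(discrete_jred M (\<T> h) f y\<Omega> E\<Omega> \<alpha> has_derivative (\<lambda>v. grad (?V h) u \<bullet> v)) (at u)"
    if h: "h \<in> H" and u: "u \<in> U" for h u
    by (rule has_derivative_transform_within_open[OF J_has_derivative[OF u admissible_nedelec[OF mesh[OF h]]] U u])
      (simp add: discrete_state_facts(5)[OF _ mesh[OF h]])
  have loc: "local_solution (jred M f y\<Omega> E\<Omega> \<alpha>) (Uad a b) ustar"
    using ustar unfolding strict_local_solution_def local_solution_def by (metis less_imp_le order_refl)
  have usU: "ustar \<in> U" using loc UadU by (auto simp: local_solution_def)
  obtain \<tau> \<nu> where \<tau>: "\<tau> > 0" and \<nu>: "\<nu> > 0" and so: "\<And>v. v \<in> critical_cone M f y\<Omega> E\<Omega> \<alpha> a b \<tau> ustar \<Longrightarrow>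
           second_derivative (jred M f y\<Omega> E\<Omega> \<alpha>) ustar v v \<ge> \<nu> * (norm v)\<^sup>2"
    using second_order by blast
  have "\<forall>\<^sub>F h in at 0 within H. norm (ustar - uh h) \<le> 2 / \<nu> * norm (grad ?G (uh h) - grad (?V h) (uh h))"
  proof (rule local_solution_error_estimate[OF U UadU jred_deriv discrete_deriv
        grad_differentiable[OF usU admissible_H0curl] loc _ conv \<tau> \<nu> _ consistent])
    show "local_solution (discrete_jred M (\<T> h) f y\<Omega> E\<Omega> \<alpha>) (Uad a b) (uh h)" if "h \<in> H" for h
      using uh that by blast
    show "second_derivative (jred M f y\<Omega> E\<Omega> \<alpha>) ustar v v \<ge> \<nu> * (norm v)\<^sup>2"
      if "\<And>k. (ustar $ k = a $ k \<longrightarrow> v $ k \<ge> 0) \<and> (ustar $ k = b $ k \<longrightarrow> v $ k \<le> 0) \<and>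
           (\<bar>grad ?G ustar $ k\<bar> > \<tau> \<longrightarrow> v $ k = 0)" for v
      using that by (intro so) (simp add: critical_cone_def reduced_gradient_eq[OF usU])
  qed
  then obtain d where d: "d > 0" "\<And>h. h \<in> H \<Longrightarrow> h \<noteq> 0 \<Longrightarrow> dist h 0 < d \<Longrightarrow>
      norm (ustar - uh h) \<le> 2 / \<nu> * norm (grad ?G (uh h) - grad (?V h) (uh h))"
    unfolding eventually_at by blast
  obtain C where C: "C > 0" "\<And>h u. h \<in> H \<Longrightarrow> h < 1 \<Longrightarrow> u \<in> Uad a b \<Longrightarrow>
      norm (grad ?G u - grad (?V h) u) \<le> C * h powr (min s r)"
    using rate[OF s] by blast
  \<comment> \<open>Below \<open>d\<close> the abstract estimate is available, below 1 the gradient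
    rate.\<close>
  have "norm (ustar - uh h) \<le> 2 / \<nu> * C * h powr (min s r)" if h: "h \<in> H" "h < min d 1" for h
  proof -
    have h0: "0 < h" using h(1) H by auto
    have "norm (ustar - uh h) \<le> 2 / \<nu> * norm (grad ?G (uh h) - grad (?V h) (uh h))"
      using d(2)[OF h(1)] h0 h(2) by (simp add: dist_real_def)
    also have "\<dots> \<le> 2 / \<nu> * (C * h powr (min s r))"
      using \<nu> h by (intro mult_left_mono C(2) uhU) auto
    finally show ?thesis by (simp add: mult.assoc)
  qed
  moreover have "2 / \<nu> * C > 0" "min d 1 > 0" using \<nu> C(1) d(1) by auto
  ultimately show ?thesis by blast
qed

end
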